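(* In the Fraenkel–Mostowski model $\mathcal{N}9$, $\mathsf{EDM_{BG}}$ is true.
   Context: Fraenkel–Mostowski models. Let $\mathcal{M}$ be a model of $\mathsf{ZFA}+\mathsf{AC}$ ($\mathsf{ZFA}$ is $\mathsf{ZF}$ modified to allow a set of atoms) with set of atoms $A$, and let $\mathcal{G}$ be a group of permutations of $A$. Each $\phi\in\mathcal{G}$ extends to an automorphism of $\mathcal{M}$ by $\phi(x)=\{\phi(y):y\in x\}$ for $x\notin A$. For $x\in\mathcal{M}$ put $\mathrm{Sym}_{\mathcal{G}}(x)=\{\phi\in\mathcal{G}:\phi(x)=x\}$. A normal filter $\Gamma$ of subgroups of $\mathcal{G}$ is a collection of subgroups that contains $\mathcal{G}$, is closed under supergroups (within $\mathcal{G}$), intersections of two members and conjugation by elements of $\mathcal{G}$, and contains $\mathrm{Sym}_{\mathcal{G}}(a)$ for all $a\in A$. The Fraenkel–Mostowski model determined by $\mathcal{M},\mathcal{G},\Gamma$ is the class of all $x\in\mathcal{M}$ such that $x$ and every element of its transitive closure have $\mathrm{Sym}_{\mathcal{G}}$ in $\Gamma$; it is a model of $\mathsf{ZFA}$. The model $\mathcal{N}9$. The set $A$ of atoms is identified (via a bijection in $\mathcal{M}$) with $\omega^{(\omega)}=\{s:\omega\to\omega : (\exists n\in\omega)(\forall j>n)\ s_j=0\}$. The pseudo length of $s\in A$ is the least $k\in\omega$ such that $s_\ell=0$ for all $\ell\ge k$. A subset of $A$ is bounded if there is an upper bound for the pseudo lengths of its elements. $\mathcal{G}$ is the group of all permutations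 $\phi$ of $A$ such that $\{a\in A:\phi(a)\ne a\}$ is bounded. For $s\in A$, $n\in\omega$, the $n$-block containing $s$ is $A_s^n=\{t\in A:(\forall j\ge n)\ t_j=s_j\}$; the $n$-location of $t\in A$ is $t\upharpoonright n=(t_0,\dots,t_{n-1})$; $A_0^n$ is the $n$-block containing the constant sequence $0$. For $n\in\omega$, $\mathcal{G}_n$ is the subgroup of all $\phi\in\mathcal{G}$ such that (i) $\phi$ fixes $A_0^n$ pointwise, (ii) for all $s,t\in A$, $A_s^n=A_t^n$ if and only if $A_{\phi(s)}^n=A_{\phi(t)}^n$, and (iii) for each $s\in A$ the $n$-location of $\phi(s)$ equals the $n$-location of $s$. $\Gamma$ is the set of all subgroups $H$ of $\mathcal{G}$ such that $\mathcal{G}_n\subseteq H$ for some $n\in\omega$; it is a normal filter. $\mathcal{N}9$ is the Fraenkel–Mostowski model determined by $\mathcal{M}$, $\mathcal{G}$, $\Gamma$. $\mathsf{EDM_{BG}}$: if $G=(V,E)$ is a graph ($E$ a set of unordered pairs of distinct elements of $V$) such that $V$ is not countable ($|V|\nleq\aleph_0$), then either $V$ contains an independent set $I$ (no pair of distinct elements of $I$ is in $E$) with $|I|\ge\aleph_0$ (i.e. there is an injection of $\omega$ into $I$), or there is a subgraph $G'=(V',E')$ of $G$ which is a clique (any two distinct elements of $V'$ form an edge) with $|V'|\nleq\aleph_0$. *)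

theory Defs
  imports "HOL-Algebra.Bij"
begin

section \<open>First-order formulas of set theory\<close>

datatype fm = Mem nat nat | Equal nat nat | Neg fm | Conj fm fm | Exists nat fm

primrec sat :: "'m set \<Rightarrow> ('m \<Rightarrow> 'm \<Rightarrow> bool) \<Rightarrow> (nat \<Rightarrow> 'm) \<Rightarrow> fm \<Rightarrow> bool" where
  "sat D mem e (Mem i j) \<longleftrightarrow> mem (e i) (e j)"
| "sat D mem e (Equal i j) \<longleftrightarrow> e i = e j"
| "sat D mem e (Neg p) \<longleftrightarrow> \<not> sat D mem e p"
| "sat D mem e (Conj p q) \<longleftrightarrow> sat D mem e p \<and> sat D mem e q"
| "sat D mem e (Exists i p) \<longleftrightarrow> (\<exists>x\<in>D. sat D mem (e(i := x)) p)"


section \<open>Structures for the language of ZFA\<close>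

text \<open>
  A structure has a domain \<open>D\<close>, a membership relation \<open>\<epsilon>\<close> and a constant \<open>A\<close> for the set of
  atoms. Every notion below is evaluated in the structure: quantifiers range over \<open>D\<close> only, so
  instantiating \<open>D\<close> with a subclass gives the relativised notion. The relation \<open>\<epsilon>\<close> need not be
  well-founded and the internal \<open>\<omega>\<close> need not be standard.
\<close>

locale eps_structure =
  fixes D :: "'m set"
    and mem :: "'m \<Rightarrow> 'm \<Rightarrow> bool" (infix "\<epsilon>" 50)
    and A :: 'm
begin

definition els :: "'m \<Rightarrow> 'm set" where
  "els x = {y \<in> D. y \<epsilon> x}"

definition is_set :: "'m \<Rightarrow> bool" where
  "is_set x \<longleftrightarrow> \<not> x \<epsilon> A"

definition zero :: 'm where
  "zero = (THE e. e \<in> D \<and> is_set e \<and> els e = {})"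

definition is_inductive :: "'m \<Rightarrow> bool" where
  "is_inductive w \<longleftrightarrow>
     (\<exists>e \<in> els w. is_set e \<and> els e = {}) \<and>
     (\<forall>n \<in> els w. \<exists>s \<in> els w. els s = insert n (els n))"

definition omega :: 'm where
  "omega = (THE w. w \<in> D \<and> is_inductive w \<and> (\<forall>v \<in> D. is_inductive v \<longrightarrow> els w \<subseteq> els v))"

definition is_opair :: "'m \<Rightarrow> 'm \<Rightarrow> 'm \<Rightarrow> bool" where
  "is_opair p x y \<longleftrightarrow> (\<exists>u \<in> D. \<exists>v \<in> D. els u = {x} \<and> els v = {x, y} \<and> els p = {u, v})"

definition maps_to :: "'m \<Rightarrow> 'm \<Rightarrow> 'm \<Rightarrow> bool" where
  "maps_to f x y \<longleftrightarrow> (\<exists>p \<in> els f. is_opair p x y)"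

definition is_function :: "'m \<Rightarrow> 'm \<Rightarrow> 'm \<Rightarrow> bool" where
  "is_function f X Y \<longleftrightarrow> is_set f \<and>
     (\<forall>p \<in> els f. \<exists>x \<in> els X. \<exists>y \<in> els Y. is_opair p x y) \<and>
     (\<forall>x \<in> els X. \<exists>!y. y \<in> els Y \<and> maps_to f x y)"

definition app :: "'m \<Rightarrow> 'm \<Rightarrow> 'm" where
  "app f x = (THE y. y \<in> D \<and> maps_to f x y)"

definition is_injection :: "'m \<Rightarrow> 'm \<Rightarrow> 'm \<Rightarrow> bool" where
  "is_injection f X Y \<longleftrightarrow> is_function f X Y \<and> inj_on (app f) (els X)"

definition is_bijection :: "'m \<Rightarrow> 'm \<Rightarrow> 'm \<Rightarrow> bool" where
  "is_bijection f X Y \<longleftrightarrow> is_function f X Y \<and> bij_betw (app f) (els X) (els Y)"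


subsection \<open>The axioms of ZFA and the axiom of choice\<close>

definition ax_atoms :: bool where
  "ax_atoms \<longleftrightarrow> A \<in> D \<and> is_set A \<and> (\<forall>a \<in> els A. els a = {})"

definition ax_empty :: bool where
  "ax_empty \<longleftrightarrow> (\<exists>e \<in> D. is_set e \<and> els e = {})"

definition ax_extensionality :: bool where
  "ax_extensionality \<longleftrightarrow>
     (\<forall>x \<in> D. \<forall>y \<in> D. is_set x \<and> is_set y \<and> els x = els y \<longrightarrow> x = y)"

definition ax_pairing :: bool where
  "ax_pairing \<longleftrightarrow> (\<forall>x \<in> D. \<forall>y \<in> D. \<exists>z \<in> D. els z = {x, y})"

definition ax_union :: bool where
  "ax_union \<longleftrightarrow> (\<forall>x \<in> D. \<exists>u \<in> D. is_set u \<and> els u = (\<Union>y \<in> els x. els y))"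

definition ax_power :: bool where
  "ax_power \<longleftrightarrow>
     (\<forall>x \<in> D. \<exists>p \<in> D. is_set p \<and> els p = {y \<in> D. is_set y \<and> els y \<subseteq> els x})"

definition ax_infinity :: bool where
  "ax_infinity \<longleftrightarrow> (\<exists>w \<in> D. is_inductive w)"

definition ax_foundation :: bool where
  "ax_foundation \<longleftrightarrow> (\<forall>x \<in> D. els x \<noteq> {} \<longrightarrow> (\<exists>y \<in> els x. els y \<inter> els x = {}))"

text \<open>
  The two schemas range over first-order formulas with parameters, supplied by the assignment
  \<open>e\<close>. As \<open>A\<close> may itself be a parameter, formulas need no symbol for it.
\<close>

definition ax_separation :: bool where
  "ax_separation \<longleftrightarrow>
     (\<forall>p e. \<forall>x \<in> D. range e \<subseteq> D \<longrightarrow>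
        (\<exists>y \<in> D. is_set y \<and> els y = {z \<in> els x. sat D mem (e(0 := z)) p}))"

definition ax_replacement :: bool where
  "ax_replacement \<longleftrightarrow>
     (\<forall>p e. \<forall>x \<in> D. range e \<subseteq> D \<longrightarrow>
        (\<forall>u \<in> els x. \<forall>v \<in> D. \<forall>w \<in> D.
           sat D mem (e(0 := u, 1 := v)) p \<and> sat D mem (e(0 := u, 1 := w)) p \<longrightarrow> v = w) \<longrightarrow>
        (\<exists>y \<in> D. is_set y \<and>
           els y = {v \<in> D. \<exists>u \<in> els x. sat D mem (e(0 := u, 1 := v)) p}))"

definition ax_choice :: bool where
  "ax_choice \<longleftrightarrow>
     (\<forall>x \<in> D. (\<forall>y \<in> els x. els y \<noteq> {}) \<and>
               (\<forall>y \<in> els x. \<forall>z \<in> els x. y \<noteq> z \<longrightarrow> els y \<inter> els z = {}) \<longrightarrow>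
        (\<exists>c \<in> D. \<forall>y \<in> els x. \<exists>!z. z \<in> els c \<inter> els y))"

definition ZFA :: bool where
  "ZFA \<longleftrightarrow> ax_atoms \<and> ax_empty \<and> ax_extensionality \<and> ax_pairing \<and> ax_union \<and> ax_power \<and>
     ax_infinity \<and> ax_foundation \<and> ax_separation \<and> ax_replacement"

definition ZFA_AC :: bool where
  "ZFA_AC \<longleftrightarrow> ZFA \<and> ax_choice"


subsection \<open>Fraenkel--Mostowski models\<close>

definition transitive :: "'m \<Rightarrow> bool" where
  "transitive T \<longleftrightarrow> is_set T \<and> (\<forall>z \<in> els T. els z \<subseteq> els T)"

definition trans_closure :: "'m \<Rightarrow> 'm set" where
  "trans_closure x = {y \<in> D. \<forall>T \<in> D. transitive T \<and> els x \<subseteq> els T \<longrightarrow> y \<in> els T}"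

text \<open>
  The extension of a permutation \<open>f\<close> of the atoms to the universe is defined by \<open>\<epsilon>\<close>-recursion
  inside the structure: \<open>act f x\<close> is the value at \<open>x\<close> of any function of the structure that has a
  transitive domain containing \<open>x\<close> and obeys the recursion equations there.
\<close>

definition act :: "'m \<Rightarrow> 'm \<Rightarrow> 'm" where
  "act f x = (THE y. y \<in> D \<and>
     (\<exists>T \<in> D. \<exists>Y \<in> D. \<exists>F \<in> D. transitive T \<and> x \<in> els T \<and> is_function F T Y \<and>
        (\<forall>z \<in> els T.
           if z \<in> els A then app F z = app f z
           else is_set (app F z) \<and> els (app F z) = app F ` els z) \<and>
        y = app F x))"

definition Sym :: "'m set \<Rightarrow> 'm \<Rightarrow> 'm set" where
  "Sym G x = {f \<in> G. act f x = x}"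

text \<open>
  \<open>G\<close> is a class of permutations of the atoms, and \<open>\<Gamma>\<close> a class of elements of the structure,
  each of which is a set of such permutations.
\<close>

definition FM :: "'m set \<Rightarrow> 'm set \<Rightarrow> 'm set" where
  "FM G \<Gamma> = {x \<in> D. \<forall>y \<in> insert x (trans_closure x). \<exists>h \<in> \<Gamma>. els h = Sym G y}"


subsection \<open>Finitely supported sequences of natural numbers\<close>

definition fin_seq :: "'m \<Rightarrow> bool" where
  "fin_seq s \<longleftrightarrow> is_function s omega omega \<and>
     (\<exists>n \<in> els omega. \<forall>j \<in> els omega. n \<epsilon> j \<longrightarrow> app s j = zero)"

definition identifies_atoms :: "'m \<Rightarrow> bool" where
  "identifies_atoms b \<longleftrightarrow>
     b \<in> D \<and> (\<exists>S \<in> D. is_set S \<and> els S = {s \<in> D. fin_seq s} \<and> is_bijection b A S)"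


subsection \<open>The statement EDM-BG, evaluated in the structure\<close>

definition is_graph :: "'m \<Rightarrow> 'm \<Rightarrow> bool" where
  "is_graph V E \<longleftrightarrow> is_set V \<and> is_set E \<and>
     (\<forall>e \<in> els E. \<exists>x \<in> els V. \<exists>y \<in> els V. x \<noteq> y \<and> els e = {x, y})"

definition edge :: "'m \<Rightarrow> 'm \<Rightarrow> 'm \<Rightarrow> bool" where
  "edge E x y \<longleftrightarrow> (\<exists>e \<in> els E. els e = {x, y})"

definition at_most_countable :: "'m \<Rightarrow> bool" where
  "at_most_countable X \<longleftrightarrow> (\<exists>f \<in> D. is_injection f X omega)"

definition EDM_BG :: bool where
  "EDM_BG \<longleftrightarrow>
     (\<forall>V \<in> D. \<forall>E \<in> D. is_graph V E \<and> \<not> at_most_countable V \<longrightarrow>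
        (\<exists>I \<in> D. is_set I \<and> els I \<subseteq> els V \<and>
           (\<forall>x \<in> els I. \<forall>y \<in> els I. x \<noteq> y \<longrightarrow> \<not> edge E x y) \<and>
           (\<exists>f \<in> D. is_injection f omega I)) \<or>
        (\<exists>V' \<in> D. \<exists>E' \<in> D. is_graph V' E' \<and> els V' \<subseteq> els V \<and> els E' \<subseteq> els E \<and>
           (\<forall>x \<in> els V'. \<forall>y \<in> els V'. x \<noteq> y \<longrightarrow> edge E' x y) \<and>
           \<not> at_most_countable V'))"

end


section \<open>The model N9\<close>

text \<open>
  The ground model is the whole type \<open>'m\<close>; \<open>b\<close> is the bijection, belonging to the model, that
  identifies the atoms with the finitely supported sequences.
\<close>

locale N9_setting = eps_structure UNIV mem A
  for mem :: "'m \<Rightarrow> 'm \<Rightarrow> bool" (infix "\<epsilon>" 50) and A :: 'm +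
  fixes b :: 'm
  assumes ZFA_AC: ZFA_AC
    and identifies_atoms: "identifies_atoms b"
begin

definition coord :: "'m \<Rightarrow> 'm \<Rightarrow> 'm" where
  "coord a j = app (app b a) j"

text \<open>The order of the von Neumann natural numbers of the model.\<close>

definition leq :: "'m \<Rightarrow> 'm \<Rightarrow> bool" where
  "leq m n \<longleftrightarrow> m \<epsilon> n \<or> m = n"

definition zero_from :: "'m \<Rightarrow> 'm \<Rightarrow> bool" where
  "zero_from k a \<longleftrightarrow> (\<forall>l \<in> els omega. leq k l \<longrightarrow> coord a l = zero)"

definition pseudo_length :: "'m \<Rightarrow> 'm" where
  "pseudo_length a = (THE k. k \<in> els omega \<and> zero_from k a \<and>
     (\<forall>k' \<in> els omega. zero_from k' a \<longrightarrow> leq k k'))"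

definition bounded :: "'m set \<Rightarrow> bool" where
  "bounded X \<longleftrightarrow> (\<exists>k \<in> els omega. \<forall>a \<in> X. leq (pseudo_length a) k)"

definition G :: "'m set" where
  "G = {f. is_bijection f A A \<and> bounded {a \<in> els A. app f a \<noteq> a}}"

definition block :: "'m \<Rightarrow> 'm \<Rightarrow> 'm set" where
  "block n s = {t \<in> els A. \<forall>j \<in> els omega. leq n j \<longrightarrow> coord t j = coord s j}"

definition zero_atom :: 'm where
  "zero_atom = (THE a. a \<in> els A \<and> (\<forall>j \<in> els omega. coord a j = zero))"

text \<open>For a natural number \<open>n\<close> of the model, \<open>els n\<close> is the set of its predecessors.\<close>

definition location :: "'m \<Rightarrow> 'm \<Rightarrow> 'm \<Rightarrow> 'm" where
  "location n t = restrict (coord t) (els n)"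

definition Gn :: "'m \<Rightarrow> 'm set" where
  "Gn n = {f \<in> G.
     (\<forall>a \<in> block n zero_atom. app f a = a) \<and>
     (\<forall>s \<in> els A. \<forall>t \<in> els A.
        block n s = block n t \<longleftrightarrow> block n (app f s) = block n (app f t)) \<and>
     (\<forall>s \<in> els A. location n (app f s) = location n s)}"

text \<open>
  Subgroups are elements \<open>h\<close> of the model. The group structure on permutations belonging to the
  model is that of the actual permutations of \<open>els A\<close> that they represent.
\<close>

definition perm :: "'m \<Rightarrow> 'm \<Rightarrow> 'm" where
  "perm f = restrict (app f) (els A)"

definition \<Gamma> :: "'m set" where
  "\<Gamma> = {h. is_set h \<and> els h \<subseteq> G \<and> subgroup (perm ` els h) (BijGroup (els A)) \<and>
     (\<exists>n \<in> els omega. Gn n \<subseteq> els h)}"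

definition N9 :: "'m set" where
  "N9 = FM G \<Gamma>"

end

end

theory Submission
  imports Defs
begin

text \<open>
  Let \<open>(V, E)\<close> be an uncountable graph in \<open>N9\<close>, supported by \<open>G_n\<close>. If \<open>G_n\<close> fixes every vertex,
  all subsets of \<open>V\<close> and all its injections into \<open>\<omega>\<close> that exist in the ground model lie in \<open>N9\<close>,
  and a partition argument with choice in the ground model applies. Otherwise some \<open>f\<close> in \<open>G_n\<close>
  moves a vertex \<open>v\<close>. From \<open>f\<close> and \<open>v\<close> one obtains a vertex whose orbit under some \<open>G_k\<close> is
  nontrivial and indexed by the \<open>k\<close>-blocks other than \<open>A_0^k\<close>, which makes it a set of
  indiscernibles: it is either a non-well-orderable clique or contains a countable independent set.

  As the ground model may be nonstandard, all recursions, choices and permutations have to be carried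
  out inside it; only first-order definable objects are available.
\<close>

section \<open>Definability\<close>

text \<open>In the second case \<open>v\<close> may depend only on points inside
  \<open>A_0^k\<close>, a block that \<open>G_k\<close> fixes pointwise, so \<open>G_k\<close>
  itself need not move \<open>v\<close> and yields no orbit. The dependence has to be transported to
  other blocks: either \<open>A_0^k\<close>, apart from \<open>A_0^n\<close>, is exchanged with
  another \<open>k\<close>-block, or the action of \<open>f\<close> is repeated in other blocks. If
  the resulting vertex varies with the target block, it generates the orbit that is sought. If it
  never varies, infinitely many copies of \<open>f\<close> can be compared with infinitely many and
  one more, and the additional copy turns out to fix \<open>v\<close>. This comparison is possible
  because a \<open>(k+1)\<close>-block contains infinitely many \<open>k\<close>-blocks and is still
  a bounded set: \<open>G\<close> asks for bounded, not for finite, sets of moved atoms, so it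
  contains such infinite products.\<close>

primrec rename :: "(nat \<Rightarrow> nat) \<Rightarrow> fm \<Rightarrow> fm" where
  "rename f (Mem i j) = Mem (f i) (f j)"
| "rename f (Equal i j) = Equal (f i) (f j)"
| "rename f (Neg p) = Neg (rename f p)"
| "rename f (Conj p q) = Conj (rename f p) (rename f q)"
| "rename f (Exists i p) = Exists (f i) (rename f p)"

text \<open>Bound variables are renamed as well; injectivity prevents capture, since an update at
  \<open>f i\<close> then disturbs no other \<open>f j\<close>.\<close>

lemma sat_rename:
  assumes "inj f"
  shows "sat D mem e (rename f p) \<longleftrightarrow> sat D mem (\<lambda>i. e (f i)) p"
proof (induction p arbitrary: e)
  case (Exists i p)
  have "(\<lambda>j. (e(f i := x)) (f j)) = (\<lambda>j. e (f j))(i := x)" for x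
    using assms by (auto simp: fun_eq_iff dest: injD)
  then show ?case
    using Exists.IH by simp
qed auto

definition mix :: "(nat \<Rightarrow> 'm) \<Rightarrow> (nat \<Rightarrow> 'm) \<Rightarrow> nat \<Rightarrow> 'm" where
  "mix e c i = (if even i then e (i div 2) else c (i div 2))"

lemma mix_simps [simp]: "mix e c (2 * i) = e i" "mix e c (Suc (2 * i)) = c i" "mix e c 0 = e 0"
  by (auto simp: mix_def)

lemma nat_parity_cases:
  obtains j where "i = 2 * j" | j where "i = Suc (2 * j)"
  by (metis evenE oddE Suc_eq_plus1)

lemma mix_upd: "(mix e c)(0 := z) = mix (e(0 := z)) c"
proof
  show "((mix e c)(0 := z)) i = mix (e(0 := z)) c i" for i
    by (cases i rule: nat_parity_cases) auto
qed

lemma inj_mix: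
  assumes "inj f" "inj g" "\<And>i j. f i \<noteq> g j"
  shows "inj (mix f g)"
proof (rule injI)
  show "i = j" if "mix f g i = mix f g j" for i j
    using that assms
    by (cases i rule: nat_parity_cases; cases j rule: nat_parity_cases)
      (auto dest: injD, metis)
qed

locale zfa = eps_structure UNIV mem A
  for mem :: "'m \<Rightarrow> 'm \<Rightarrow> bool" (infix "\<epsilon>" 50) and A :: 'm +
  assumes model: ZFA_AC
begin

text \<open>
  \<open>dfn P\<close>: the predicate \<open>P\<close> on assignments is first-order definable with parameters. The
  assignment stands for a context of bound variables in de Bruijn style, the innermost binder being
  \<open>e 0\<close>; everything that does not depend on \<open>e\<close> is a parameter. Formulas keep the variables of
  the context at even and the parameters at odd indices. With the rules \<open>dfn_intros\<close>, definability
  is decided by the syntax of \<open>P\<close>.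
\<close>

definition dfn :: "((nat \<Rightarrow> 'm) \<Rightarrow> bool) \<Rightarrow> bool" where
  "dfn P \<longleftrightarrow> (\<exists>p c. \<forall>e. sat UNIV mem (mix e c) p \<longleftrightarrow> P e)"

text \<open>The language has no function symbols, so a term is represented by a function of the
  assignment whose graph is definable.\<close>

definition trm :: "((nat \<Rightarrow> 'm) \<Rightarrow> 'm) \<Rightarrow> bool" where
  "trm t \<longleftrightarrow> dfn (\<lambda>e. e 0 = t (\<lambda>i. e (Suc i)))"

named_theorems dfn_intros

lemma dfn_not [dfn_intros]: "dfn P \<Longrightarrow> dfn (\<lambda>e. \<not> P e)"
  unfolding dfn_def by (metis sat.simps(3))

lemma dfn_conj [dfn_intros]:
  assumes "dfn P" "dfn Q"
  shows "dfn (\<lambda>e. P e \<and> Q e)"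
proof -
  obtain p c where p: "\<And>e. sat UNIV mem (mix e c) p \<longleftrightarrow> P e"
    using assms(1) dfn_def by auto
  obtain q d where q: "\<And>e. sat UNIV mem (mix e d) q \<longleftrightarrow> Q e"
    using assms(2) dfn_def by auto
  \<comment> \<open>The parameters of the two formulas are merged into \<open>mix c d\<close>: those
    of the first formula move to its even places, those of the second to its odd places.\<close>
  define f where "f = mix (\<lambda>i. 2 * i) (\<lambda>i. Suc (2 * (2 * i)))"
  define g where "g = mix (\<lambda>i. 2 * i) (\<lambda>i. Suc (2 * (Suc (2 * i))))"
  have "inj f" "inj g"
    unfolding f_def g_def by (rule inj_mix; simp add: inj_def; presburger)+
  moreover have "mix e (mix c d) (f i) = mix e c i" "mix e (mix c d) (g i) = mix e d i" for e i
    unfolding f_def g_def by (cases i rule: nat_parity_cases; simp only: mix_simps)+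
  ultimately have "sat UNIV mem (mix e (mix c d)) (Conj (rename f p) (rename g q)) \<longleftrightarrow> P e \<and> Q e" for e
    by (simp add: sat_rename p q)
  then show ?thesis
    unfolding dfn_def by blast
qed

lemma dfn_subst:
  assumes "dfn P" "inj f"
  shows "dfn (\<lambda>e. P (\<lambda>i. e (f i)))"
proof -
  obtain p c where p: "\<And>e. sat UNIV mem (mix e c) p \<longleftrightarrow> P e"
    using assms(1) dfn_def by auto
  define g where "g = mix (\<lambda>i. 2 * f i) (\<lambda>i. Suc (2 * i))"
  have "inj g"
    unfolding g_def using assms(2) by (intro inj_mix) (auto simp: inj_def, presburger)
  moreover have "mix e c (g i) = mix (\<lambda>i. e (f i)) c i" for e i
    unfolding g_def by (cases i rule: nat_parity_cases; simp only: mix_simps)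
  ultimately have "sat UNIV mem (mix e c) (rename g p) \<longleftrightarrow> P (\<lambda>i. e (f i))" for e
    by (simp add: sat_rename p)
  then show ?thesis
    unfolding dfn_def by blast
qed

lemma dfn_ex [dfn_intros]:
  assumes "dfn (\<lambda>e. P (e 0) (\<lambda>i. e (Suc i)))"
  shows "dfn (\<lambda>e. \<exists>x. P x e)"
proof -
  obtain p c where p: "\<And>e. sat UNIV mem (mix e c) p \<longleftrightarrow> P (e 0) (\<lambda>i. e (Suc i))"
    using assms dfn_def by auto
  \<comment> \<open>The bound variable takes index 1, the slot of the first parameter, which the
    shifted parameters in \<open>d\<close> leave free. An even index would overwrite a variable of
    the context.\<close>
  define f where "f = mix (case_nat 1 (\<lambda>i. 2 * i)) (\<lambda>i. Suc (2 * Suc i))"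
  define d where "d = case_nat undefined c"
  have "inj f"
    unfolding f_def by (rule inj_mix) (auto simp: inj_def split: nat.splits, presburger+)
  moreover have "((mix e d)(1 := x)) (f i) = mix (case_nat x e) c i" for e x i
  proof (cases i rule: nat_parity_cases)
    case (1 j)
    then show ?thesis
      by (cases j) (simp_all only: mix_simps f_def fun_upd_apply nat.case, simp_all)
  next
    case (2 j)
    then have "mix e d (f i) = mix (case_nat x e) c i"
      by (simp only: mix_simps f_def d_def nat.case)
    moreover have "f i \<noteq> 1"
      using 2 by (simp only: mix_simps f_def) simp
    ultimately show ?thesis by simp
  qed
  ultimately have "sat UNIV mem (mix e d) (Exists 1 (rename f p)) \<longleftrightarrow> (\<exists>x. P x e)" for e
    by (simp add: sat_rename p)
  then show ?thesis
    unfolding dfn_def by blast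
qed

lemma dfn_var_eq: "dfn (\<lambda>e. e i = e j)"
  unfolding dfn_def by (rule exI[of _ "Equal (2*i) (2*j)"]) simp

lemma dfn_var_mem: "dfn (\<lambda>e. e i \<epsilon> e j)"
  unfolding dfn_def by (rule exI[of _ "Mem (2*i) (2*j)"]) simp

lemma trm_var [dfn_intros]: "trm (\<lambda>e. e i)"
  unfolding trm_def by (rule dfn_var_eq)

lemma trm_const [dfn_intros]: "trm (\<lambda>e. c)"
  unfolding trm_def dfn_def
  by (rule exI[of _ "Equal 0 1"], rule exI[of _ "\<lambda>_. c"]) (simp add: mix_def)

text \<open>Weakening: the definability rules below apply it once for every binder that a term
  passes under.\<close>

lemma trm_lift:
  assumes "trm t"
  shows "trm (\<lambda>e. t (\<lambda>i. e (Suc i)))"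
proof -
  have "inj (case_nat 0 (\<lambda>i. Suc (Suc i)))"
    by (auto simp: inj_def split: nat.splits)
  from dfn_subst[OF assms[unfolded trm_def] this] show ?thesis
    unfolding trm_def by simp
qed

lemma dfn_let:
  assumes "dfn (\<lambda>e. Q (e 0) (\<lambda>i. e (Suc i)))" "trm t"
  shows "dfn (\<lambda>e. Q (t e) e)"
proof -
  have "dfn (\<lambda>e. \<exists>x. x = t e \<and> Q x e)"
    by (rule dfn_ex, rule dfn_conj[OF assms(2)[unfolded trm_def] assms(1)])
  then show ?thesis by simp
qed

lemma dfn_eq [dfn_intros]:
  assumes "trm t" "trm s"
  shows "dfn (\<lambda>e. t e = s e)"
proof -
  have "dfn (\<lambda>e. e 0 = t (\<lambda>i. e (Suc i)) \<and> (\<exists>y. y = s (\<lambda>i. e (Suc i)) \<and> e 0 = y))"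
    by (rule dfn_conj[OF assms(1)[unfolded trm_def]], rule dfn_ex,
        rule dfn_conj[OF trm_lift[OF assms(2), unfolded trm_def]], rule dfn_var_eq)
  from dfn_ex[where P = "\<lambda>x e. x = t e \<and> (\<exists>y. y = s e \<and> x = y)", OF this]
  show ?thesis by simp
qed

lemma dfn_mem [dfn_intros]:
  assumes "trm t" "trm s"
  shows "dfn (\<lambda>e. t e \<epsilon> s e)"
proof -
  have "dfn (\<lambda>e. e 0 = t (\<lambda>i. e (Suc i)) \<and> (\<exists>y. y = s (\<lambda>i. e (Suc i)) \<and> e 0 \<epsilon> y))"
    by (rule dfn_conj[OF assms(1)[unfolded trm_def]], rule dfn_ex,
        rule dfn_conj[OF trm_lift[OF assms(2), unfolded trm_def]], rule dfn_var_mem)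
  from dfn_ex[where P = "\<lambda>x e. x = t e \<and> (\<exists>y. y = s e \<and> x \<epsilon> y)", OF this]
  show ?thesis by simp
qed

lemma dfn_prop [dfn_intros]: "dfn (\<lambda>e. c)"
proof (cases c)
  case True
  then show ?thesis using dfn_var_eq[of 0 0] by simp
next
  case False
  then show ?thesis using dfn_not[OF dfn_var_eq[of 0 0]] by simp
qed

lemma dfn_disj [dfn_intros]:
  assumes "dfn P" "dfn Q"
  shows "dfn (\<lambda>e. P e \<or> Q e)"
proof -
  have "dfn (\<lambda>e. \<not> (\<not> P e \<and> \<not> Q e))"
    by (intro dfn_not dfn_conj assms)
  then show ?thesis by simp
qed

lemma dfn_imp [dfn_intros]:
  assumes "dfn P" "dfn Q"
  shows "dfn (\<lambda>e. P e \<longrightarrow> Q e)"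
  unfolding imp_conv_disj by (intro dfn_not dfn_disj assms)

lemma dfn_iff [dfn_intros]:
  assumes "dfn P" "dfn Q"
  shows "dfn (\<lambda>e. P e \<longleftrightarrow> Q e)"
  unfolding iff_conv_conj_imp by (intro dfn_imp dfn_conj assms)

lemma dfn_if [dfn_intros]:
  assumes "dfn P" "dfn Q" "dfn R"
  shows "dfn (\<lambda>e. if P e then Q e else R e)"
  unfolding if_bool_eq_conj by (intro dfn_imp dfn_conj dfn_not assms)

lemma dfn_all [dfn_intros]:
  assumes "dfn (\<lambda>e. P (e 0) (\<lambda>i. e (Suc i)))"
  shows "dfn (\<lambda>e. \<forall>x. P x e)"
proof -
  have "dfn (\<lambda>e. \<not> (\<exists>x. \<not> P x e))"
    by (intro dfn_not dfn_ex assms)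
  then show ?thesis by simp
qed

lemma dfn_lift_pred:
  assumes "dfn (\<lambda>e. P (e 0) (\<lambda>i. e (Suc i)))"
  shows "dfn (\<lambda>e. P (e 0) (\<lambda>i. e (Suc (Suc i))))"
proof -
  have "inj (case_nat 0 (\<lambda>i. Suc (Suc i)))"
    by (auto simp: inj_def split: nat.splits)
  from dfn_subst[OF assms this] show ?thesis by simp
qed

lemma dfn_ex1 [dfn_intros]:
  assumes "dfn (\<lambda>e. P (e 0) (\<lambda>i. e (Suc i)))"
  shows "dfn (\<lambda>e. \<exists>!x. P x e)"
  unfolding Ex1_def by (intro dfn_intros assms dfn_lift_pred[OF assms])

lemma dfn_mem_els [dfn_intros]: "trm t \<Longrightarrow> trm s \<Longrightarrow> dfn (\<lambda>e. t e \<in> els (s e))"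
  by (simp add: els_def dfn_mem)

lemma dfn_bex [dfn_intros]:
  assumes "trm t" "dfn (\<lambda>e. P (e 0) (\<lambda>i. e (Suc i)))"
  shows "dfn (\<lambda>e. \<exists>x\<in>els (t e). P x e)"
  unfolding Bex_def by (intro dfn_intros assms trm_lift[OF assms(1)])

lemma dfn_ball [dfn_intros]:
  assumes "trm t" "dfn (\<lambda>e. P (e 0) (\<lambda>i. e (Suc i)))"
  shows "dfn (\<lambda>e. \<forall>x\<in>els (t e). P x e)"
  unfolding Ball_def by (intro dfn_intros assms trm_lift[OF assms(1)])

lemma dfn_els_subset [dfn_intros]:
  assumes "trm t" "trm s"
  shows "dfn (\<lambda>e. els (t e) \<subseteq> els (s e))"
  unfolding subset_eq by (intro dfn_intros assms trm_lift[OF assms(2)])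

lemma trm_if [dfn_intros]:
  assumes "dfn P" "trm t" "trm s"
  shows "trm (\<lambda>e. if P e then t e else s e)"
proof -
  have "dfn (\<lambda>e. P (\<lambda>i. e (Suc i)))"
    using dfn_subst[OF assms(1), of Suc] by simp
  from dfn_if[OF this assms(2,3)[unfolded trm_def]] show ?thesis
    unfolding trm_def if_distrib[of "\<lambda>x. _ = x"] .
qed

text \<open>
  Unlike \<open>THE\<close>, this choice has a definable value also when there is no unique witness.
\<close>

definition the1 :: "('m \<Rightarrow> bool) \<Rightarrow> 'm" where
  "the1 P = (if \<exists>!x. P x then THE x. P x else A)"

lemma the1_eq: "P x \<Longrightarrow> (\<And>y. P y \<Longrightarrow> y = x) \<Longrightarrow> the1 P = x"
  unfolding the1_def by (metis theI)

lemma the1_I: "\<exists>!x. P x \<Longrightarrow> P (the1 P)"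
  unfolding the1_def by (simp add: theI')

lemma trm_the1 [dfn_intros]:
  assumes "dfn (\<lambda>e. P (e 0) (\<lambda>i. e (Suc i)))"
  shows "trm (\<lambda>e. the1 (\<lambda>x. P x e))"
proof -
  \<comment> \<open>The second disjunct covers the absence of a witness and the presence of several
    at once.\<close>
  have "z = the1 Q \<longleftrightarrow> (Q z \<and> (\<forall>x. Q x \<longrightarrow> x = z)) \<or> (\<forall>x. Q x \<longrightarrow> (\<exists>y. Q y \<and> y \<noteq> x)) \<and> z = A"
    for z and Q :: "'m \<Rightarrow> bool"
  proof (cases "\<exists>!x. Q x")
    case True
    then show ?thesis using the1_I[OF True] by metis
  next
    case False
    then show ?thesis unfolding the1_def by metis
  qed
  then show ?thesis
    unfolding trm_def
    by (simp only:, intro dfn_intros assms dfn_lift_pred[OF assms]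
      dfn_lift_pred[OF dfn_lift_pred[OF assms]])
qed

section \<open>Set theory inside the model\<close>

lemma els_iff [simp]: "x \<in> els y \<longleftrightarrow> x \<epsilon> y"
  by (simp add: els_def)

lemma ball_els [simp]: "(\<forall>x\<in>els X. P x) \<longleftrightarrow> (\<forall>x. x \<epsilon> X \<longrightarrow> P x)"
  by (simp add: Ball_def)

lemma bex_els [simp]: "(\<exists>x\<in>els X. P x) \<longleftrightarrow> (\<exists>x. x \<epsilon> X \<and> P x)"
  by (simp add: Bex_def)

lemma axioms:
  "ax_atoms" "ax_empty" "ax_extensionality" "ax_pairing" "ax_union" "ax_power"
  "ax_infinity" "ax_foundation" "ax_separation" "ax_replacement" "ax_choice"
  using model unfolding ZFA_AC_def ZFA_def by auto

lemma atom_empty: "x \<epsilon> A \<Longrightarrow> \<not> z \<epsilon> x"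
  using axioms(1) els_iff[of z x] unfolding ax_atoms_def by auto

lemma is_setI: "z \<epsilon> x \<Longrightarrow> is_set x"
  using atom_empty unfolding is_set_def by auto

lemma set_eqI: "is_set x \<Longrightarrow> is_set y \<Longrightarrow> (\<And>z. z \<epsilon> x \<longleftrightarrow> z \<epsilon> y) \<Longrightarrow> x = y"
  using axioms(3) unfolding ax_extensionality_def els_def by auto

lemma foundation: "y \<epsilon> x \<Longrightarrow> \<exists>y. y \<epsilon> x \<and> (\<forall>z. z \<epsilon> y \<longrightarrow> \<not> z \<epsilon> x)"
  using axioms(8)[unfolded ax_foundation_def, rule_format, of x] by (auto simp: els_def)

lemma separation:
  assumes "dfn (\<lambda>e. P (e 0))"
  shows "\<exists>y. is_set y \<and> (\<forall>z. z \<epsilon> y \<longleftrightarrow> z \<epsilon> x \<and> P z)"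
proof -
  obtain p c where p: "\<And>e. sat UNIV mem (mix e c) p \<longleftrightarrow> P (e 0)"
    using assms dfn_def by auto
  obtain y where "is_set y"
    "els y = {z \<in> els x. sat UNIV mem ((mix (\<lambda>_. x) c)(0 := z)) p}"
    using axioms(9) unfolding ax_separation_def by blast
  then show ?thesis
    unfolding mix_upd p by (intro exI[of _ y]) (auto simp: els_def)
qed

lemma replacement:
  assumes "trm (\<lambda>e. F (e 0))"
  shows "\<exists>y. is_set y \<and> (\<forall>z. z \<epsilon> y \<longleftrightarrow> (\<exists>u. u \<epsilon> x \<and> z = F u))"
proof -
  obtain p c where p: "\<And>e. sat UNIV mem (mix e c) p \<longleftrightarrow> e 0 = F (e 1)"
    using assms dfn_def trm_def by auto
  \<comment> \<open>The axiom has the argument in variable 0 and the value in variable 1, whereas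
    the graph of \<open>F\<close> has them in the context places 1 and 0. The parameters move up to
    leave index 1 free.\<close>
  define f where "f = mix (\<lambda>i. if i = 0 then 1 else if i = 1 then 0 else 2 * i) (\<lambda>i. Suc (2 * Suc i))"
  define e where "e = mix (\<lambda>_. x) (case_nat x c)"
  have f: "inj f"
    unfolding f_def by (rule inj_mix) (auto simp: inj_def split: if_splits, presburger+)
  have e: "(e(0 := u, 1 := v)) (f i) = mix (\<lambda>i. if i = 0 then v else if i = 1 then u else x) c i" for i u v
  proof (cases i rule: nat_parity_cases)
    case (1 j)
    then have "f i = (if j = 0 then 1 else if j = 1 then 0 else 2 * j)"
      unfolding f_def by (simp only: mix_simps)
    moreover have "e (2 * j) = x"
      by (simp add: e_def)
    ultimately show ?thesis
      by (simp only: 1 mix_simps) auto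
  next
    case (2 j)
    then have "f i = Suc (2 * Suc j)"
      unfolding f_def by (simp only: mix_simps)
    moreover have "e (Suc (2 * Suc j)) = c j"
      by (simp only: e_def mix_simps nat.case)
    ultimately show ?thesis
      by (simp only: 2 mix_simps) auto
  qed
  have sat: "sat UNIV mem (e(0 := u, 1 := v)) (rename f p) \<longleftrightarrow> v = F u" for u v
    unfolding sat_rename[OF f] e p by simp
  have "\<exists>y. is_set y \<and> els y = {v. \<exists>u\<in>els x. sat UNIV mem (e(0 := u, 1 := v)) (rename f p)}"
    using axioms(10)[unfolded ax_replacement_def, rule_format, of x e "rename f p"] unfolding sat by auto
  then show ?thesis
    unfolding sat by (auto simp: els_def set_eq_iff)
qed

text \<open>These constructions go through \<open>the1\<close> so as to be definable terms
  themselves. Not being in \<open>A\<close> separates the empty set from the atoms, which have no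
  elements either.\<close>

definition Col :: "'m \<Rightarrow> ('m \<Rightarrow> bool) \<Rightarrow> 'm" where
  "Col X P = the1 (\<lambda>y. \<not> y \<epsilon> A \<and> (\<forall>z. z \<epsilon> y \<longleftrightarrow> z \<epsilon> X \<and> P z))"

definition Img :: "'m \<Rightarrow> ('m \<Rightarrow> 'm) \<Rightarrow> 'm" where
  "Img X F = the1 (\<lambda>y. \<not> y \<epsilon> A \<and> (\<forall>z. z \<epsilon> y \<longleftrightarrow> (\<exists>u. u \<epsilon> X \<and> z = F u)))"

definition big_union :: "'m \<Rightarrow> 'm" where
  "big_union X = the1 (\<lambda>y. \<not> y \<epsilon> A \<and> (\<forall>z. z \<epsilon> y \<longleftrightarrow> (\<exists>u. u \<epsilon> X \<and> z \<epsilon> u)))"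

definition Power :: "'m \<Rightarrow> 'm" where
  "Power X = the1 (\<lambda>y. \<not> y \<epsilon> A \<and> (\<forall>z. z \<epsilon> y \<longleftrightarrow> \<not> z \<epsilon> A \<and> (\<forall>u. u \<epsilon> z \<longrightarrow> u \<epsilon> X)))"

definition upair :: "'m \<Rightarrow> 'm \<Rightarrow> 'm" where
  "upair x y = the1 (\<lambda>z. \<forall>u. u \<epsilon> z \<longleftrightarrow> u = x \<or> u = y)"

definition opair :: "'m \<Rightarrow> 'm \<Rightarrow> 'm" where
  "opair x y = upair (upair x x) (upair x y)"

text \<open>Total and definable counterpart of \<open>app\<close>; on the domain of a function the
  two agree (\<open>app_eq_ap\<close>).\<close>

definition ap :: "'m \<Rightarrow> 'm \<Rightarrow> 'm" where
  "ap f x = the1 (\<lambda>y. opair x y \<epsilon> f)"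

definition Lam :: "'m \<Rightarrow> ('m \<Rightarrow> 'm) \<Rightarrow> 'm" where
  "Lam X F = Img X (\<lambda>x. opair x (F x))"

lemma trm_Col [dfn_intros]:
  assumes "trm t" "dfn (\<lambda>e. P (e 0) (\<lambda>i. e (Suc i)))"
  shows "trm (\<lambda>e. Col (t e) (\<lambda>x. P x e))"
  unfolding Col_def
  by (intro dfn_intros dfn_lift_pred[OF assms(2)] trm_lift[OF trm_lift[OF assms(1)]])

lemma trm_lift_fun:
  assumes "trm (\<lambda>e. F (e 0) (\<lambda>i. e (Suc i)))"
  shows "trm (\<lambda>e. F (e 0) (\<lambda>i. e (Suc (Suc i))))"
proof -
  have "inj (case_nat 0 (case_nat 1 (\<lambda>i. Suc (Suc (Suc i)))))"
    by (auto simp: inj_def split: nat.splits)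
  from dfn_subst[OF assms[unfolded trm_def] this] show ?thesis
    unfolding trm_def by simp
qed

lemma trm_let:
  assumes "trm (\<lambda>e. F (e 0) (\<lambda>i. e (Suc i)))" "trm t"
  shows "trm (\<lambda>e. F (t e) e)"
proof -
  have "inj (case_nat 1 (case_nat 0 (\<lambda>i. Suc (Suc i))))"
    by (auto simp: inj_def split: nat.splits)
  from dfn_subst[OF assms(1)[unfolded trm_def] this]
  have "dfn (\<lambda>e. (\<lambda>x e. e 0 = F x (\<lambda>i. e (Suc i))) (e 0) (\<lambda>i. e (Suc i)))"
    by simp
  from dfn_let[OF this trm_lift[OF assms(2)]] show ?thesis
    unfolding trm_def .
qed

lemma trm_comp:
  assumes "trm (\<lambda>e. F (e 0))" "trm t"
  shows "trm (\<lambda>e. F (t e))"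
  using trm_let[of "\<lambda>x e. F x"] assms by simp

lemma trm_Img [dfn_intros]:
  assumes "trm t" "trm (\<lambda>e. F (e 0) (\<lambda>i. e (Suc i)))"
  shows "trm (\<lambda>e. Img (t e) (\<lambda>x. F x e))"
  unfolding Img_def
  by (intro dfn_intros trm_lift[OF trm_lift[OF trm_lift[OF assms(1)]]]
      trm_lift_fun[OF trm_lift_fun[OF assms(2)]])

lemma trm_big_union [dfn_intros]: assumes "trm t" shows "trm (\<lambda>e. big_union (t e))"
  unfolding big_union_def by (intro dfn_intros trm_lift[OF trm_lift[OF trm_lift[OF assms(1)]]])

lemma trm_upair [dfn_intros]:
  assumes "trm t" "trm s" shows "trm (\<lambda>e. upair (t e) (s e))"
  unfolding upair_def
  by (intro dfn_intros trm_lift[OF trm_lift[OF assms(1)]] trm_lift[OF trm_lift[OF assms(2)]])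

lemma trm_opair [dfn_intros]: "trm t \<Longrightarrow> trm s \<Longrightarrow> trm (\<lambda>e. opair (t e) (s e))"
  unfolding opair_def by (intro dfn_intros)

lemma trm_ap [dfn_intros]:
  assumes "trm t" "trm s" shows "trm (\<lambda>e. ap (t e) (s e))"
  unfolding ap_def by (intro dfn_intros trm_lift[OF assms(1)] trm_lift[OF assms(2)])

lemma trm_Lam [dfn_intros]:
  assumes "trm t" "trm (\<lambda>e. F (e 0) (\<lambda>i. e (Suc i)))"
  shows "trm (\<lambda>e. Lam (t e) (\<lambda>x. F x e))"
  unfolding Lam_def by (intro dfn_intros assms)

lemma dfn_is_set [dfn_intros]: "trm t \<Longrightarrow> dfn (\<lambda>e. is_set (t e))"
  unfolding is_set_def by (intro dfn_intros)

lemma ex1_set: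
  assumes "\<exists>y. is_set y \<and> (\<forall>z. z \<epsilon> y \<longleftrightarrow> P z)"
  shows "\<exists>!y. \<not> y \<epsilon> A \<and> (\<forall>z. z \<epsilon> y \<longleftrightarrow> P z)"
  using assms set_eqI unfolding is_set_def by (metis (no_types, lifting))

lemma
  assumes "dfn (\<lambda>e. P (e 0))"
  shows mem_Col [simp]: "z \<epsilon> Col X P \<longleftrightarrow> z \<epsilon> X \<and> P z"
    and is_set_Col [simp]: "is_set (Col X P)"
  using the1_I[OF ex1_set[OF separation[OF assms]], of X] unfolding Col_def is_set_def by auto

lemma
  assumes "trm (\<lambda>e. F (e 0))"
  shows mem_Img [simp]: "z \<epsilon> Img X F \<longleftrightarrow> (\<exists>u. u \<epsilon> X \<and> z = F u)"
    and is_set_Img [simp]: "is_set (Img X F)"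
  using the1_I[OF ex1_set[OF replacement[OF assms]], of X] unfolding Img_def is_set_def by auto

lemma
  shows mem_big_union [simp]: "z \<epsilon> big_union X \<longleftrightarrow> (\<exists>u. u \<epsilon> X \<and> z \<epsilon> u)"
    and is_set_big_union [simp]: "is_set (big_union X)"
proof -
  have "\<exists>y. is_set y \<and> (\<forall>z. z \<epsilon> y \<longleftrightarrow> (\<exists>u. u \<epsilon> X \<and> z \<epsilon> u))"
    using axioms(5)[unfolded ax_union_def, rule_format, of X]
    by (simp add: set_eq_iff Bex_def)
  from the1_I[OF ex1_set[OF this]] show "z \<epsilon> big_union X \<longleftrightarrow> (\<exists>u. u \<epsilon> X \<and> z \<epsilon> u)" "is_set (big_union X)"
    unfolding big_union_def is_set_def by auto
qed

lemma
  shows mem_Power [simp]: "z \<epsilon> Power X \<longleftrightarrow> is_set z \<and> els z \<subseteq> els X"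
    and is_set_Power [simp]: "is_set (Power X)"
proof -
  have "\<exists>y. is_set y \<and> (\<forall>z. z \<epsilon> y \<longleftrightarrow> \<not> z \<epsilon> A \<and> (\<forall>u. u \<epsilon> z \<longrightarrow> u \<epsilon> X))"
    using axioms(6)[unfolded ax_power_def, rule_format, of X]
    by (simp add: set_eq_iff is_set_def subset_eq Ball_def)
  from the1_I[OF ex1_set[OF this]]
  show "z \<epsilon> Power X \<longleftrightarrow> is_set z \<and> els z \<subseteq> els X" "is_set (Power X)"
    unfolding Power_def is_set_def by auto
qed

lemma mem_upair [simp]: "z \<epsilon> upair x y \<longleftrightarrow> z = x \<or> z = y"
proof -
  obtain u where u: "\<And>w. w \<epsilon> u \<longleftrightarrow> w = x \<or> w = y"
    using axioms(4)[unfolded ax_pairing_def, rule_format, of x y] by (auto simp: set_eq_iff)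
  then have "upair x y = u"
    unfolding upair_def
    by (intro the1_eq allI set_eqI) (use u is_setI[of x] in auto)
  then show ?thesis using u by simp
qed

lemma is_set_upair [simp]: "is_set (upair x y)"
  by (rule is_setI[of x]) simp

lemma els_upair [simp]: "els (upair x y) = {x, y}"
  by (auto simp: set_eq_iff)

lemma upair_eqI:
  assumes "els z = {x, y}"
  shows "z = upair x y"
proof (rule set_eqI)
  have *: "u \<epsilon> z \<longleftrightarrow> u = x \<or> u = y" for u
    using assms by (auto simp: set_eq_iff)
  then show "is_set z"
    using is_setI[of x z] by simp
  show "u \<epsilon> z \<longleftrightarrow> u \<epsilon> upair x y" for u
    using * by simp
qed simp

lemma upair_eq_iff: "upair x y = upair u v \<longleftrightarrow> x = u \<and> y = v \<or> x = v \<and> y = u"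
proof -
  have "upair x y = upair y x" for x y
    by (rule upair_eqI) auto
  moreover have "{x, y} = {u, v}" if "upair x y = upair u v"
    using that els_upair by metis
  ultimately show ?thesis
    unfolding doubleton_eq_iff by auto
qed

lemma opair_eq_iff [simp]: "opair x y = opair u v \<longleftrightarrow> x = u \<and> y = v"
  unfolding opair_def upair_eq_iff by auto

lemma is_opair_iff [simp]: "is_opair p x y \<longleftrightarrow> p = opair x y"
proof
  assume "is_opair p x y"
  then show "p = opair x y"
    unfolding is_opair_def opair_def by (metis insert_absorb2 upair_eqI)
next
  assume "p = opair x y"
  then show "is_opair p x y"
    unfolding is_opair_def opair_def by (metis UNIV_I els_upair insert_absorb2)
qed

lemma maps_to_iff [simp]: "maps_to f x y \<longleftrightarrow> opair x y \<epsilon> f"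
  unfolding maps_to_def by auto

lemma ap_eq:
  assumes "opair x y \<epsilon> f" "\<And>z. opair x z \<epsilon> f \<Longrightarrow> z = y"
  shows "ap f x = y" "app f x = y"
proof -
  show "ap f x = y"
    unfolding ap_def using assms by (rule the1_eq)
  show "app f x = y"
    unfolding app_def by (rule the_equality, simp add: assms(1), rule assms(2), simp)
qed

lemma is_function_iff:
  "is_function f X Y \<longleftrightarrow> is_set f \<and> (\<forall>p. p \<epsilon> f \<longleftrightarrow> (\<exists>x. x \<epsilon> X \<and> p = opair x (ap f x))) \<and>
     (\<forall>x. x \<epsilon> X \<longrightarrow> ap f x \<epsilon> Y)" (is "_ \<longleftrightarrow> ?R")
proof
  assume f: "is_function f X Y"
  have sub: "\<exists>x y. x \<epsilon> X \<and> y \<epsilon> Y \<and> p = opair x y" if "p \<epsilon> f" for p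
    using f that unfolding is_function_def by auto
  have ap: "opair x (ap f x) \<epsilon> f \<and> ap f x \<epsilon> Y" "\<And>y. opair x y \<epsilon> f \<Longrightarrow> y = ap f x" if x: "x \<epsilon> X" for x
  proof -
    have ex1: "\<exists>!y. y \<epsilon> Y \<and> opair x y \<epsilon> f"
      using f x unfolding is_function_def by simp
    then obtain y where y: "y \<epsilon> Y" "opair x y \<epsilon> f"
      by blast
    have eq: "z = y" if "opair x z \<epsilon> f" for z
    proof -
      have "z \<epsilon> Y"
        using sub[OF that] by auto
      then show ?thesis
        using ex1 y that by blast
    qed
    have "ap f x = y"
      by (rule ap_eq(1)[OF y(2) eq])
    then show "opair x (ap f x) \<epsilon> f \<and> ap f x \<epsilon> Y"
      using y by simp
    show "z = ap f x" if "opair x z \<epsilon> f" for z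
      unfolding \<open>ap f x = y\<close> using that by (rule eq)
  qed
  have "p \<epsilon> f \<longleftrightarrow> (\<exists>x. x \<epsilon> X \<and> p = opair x (ap f x))" for p
    using sub[of p] ap by blast
  then show ?R
    using f ap(1) unfolding is_function_def by simp
next
  assume R: ?R
  have mem: "p \<epsilon> f \<longleftrightarrow> (\<exists>x. x \<epsilon> X \<and> p = opair x (ap f x))" for p
    using R by (elim conjE) (erule spec)
  have "\<exists>!y. y \<epsilon> Y \<and> opair x y \<epsilon> f" if "x \<epsilon> X" for x
    by (rule ex1I[of _ "ap f x"]) (use that R in \<open>simp_all add: mem\<close>)
  then show "is_function f X Y"
    using R unfolding is_function_def by (simp add: mem) blast
qed

lemma dfn_is_opair [dfn_intros]: "trm p \<Longrightarrow> trm x \<Longrightarrow> trm y \<Longrightarrow> dfn (\<lambda>e. is_opair (p e) (x e) (y e))"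
  unfolding is_opair_iff by (intro dfn_intros)

lemma dfn_maps_to [dfn_intros]: "trm p \<Longrightarrow> trm x \<Longrightarrow> trm y \<Longrightarrow> dfn (\<lambda>e. maps_to (p e) (x e) (y e))"
  unfolding maps_to_iff by (intro dfn_intros)

lemma dfn_is_function [dfn_intros]:
  assumes "trm f" "trm X" "trm Y"
  shows "dfn (\<lambda>e. is_function (f e) (X e) (Y e))"
  unfolding is_function_def
  by (intro dfn_intros assms trm_lift[OF assms(1)] trm_lift[OF assms(2)] trm_lift[OF assms(3)]
     trm_lift[OF trm_lift[OF assms(1)]]
     trm_lift[OF trm_lift[OF assms(3)]])

lemma
  assumes "is_function f X Y"
  shows function_is_set: "is_set f"
    and function_mem_iff: "p \<epsilon> f \<longleftrightarrow> (\<exists>x. x \<epsilon> X \<and> p = opair x (ap f x))"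
    and ap_in: "x \<epsilon> X \<Longrightarrow> ap f x \<epsilon> Y"
proof -
  note f = assms[unfolded is_function_iff]
  show "is_set f"
    using f by (rule conjunct1)
  show "p \<epsilon> f \<longleftrightarrow> (\<exists>x. x \<epsilon> X \<and> p = opair x (ap f x))"
    by (rule f[THEN conjunct2, THEN conjunct1, THEN spec])
  show "x \<epsilon> X \<Longrightarrow> ap f x \<epsilon> Y"
    by (rule f[THEN conjunct2, THEN conjunct2, rule_format])
qed

lemma opair_mem_function:
  assumes "is_function f X Y"
  shows "opair x y \<epsilon> f \<longleftrightarrow> x \<epsilon> X \<and> y = ap f x"
  unfolding function_mem_iff[OF assms] by auto

lemma app_eq_ap:
  assumes "is_function f X Y" "x \<epsilon> X"
  shows "app f x = ap f x"
  by (rule ap_eq(2)) (simp_all add: opair_mem_function[OF assms(1)] assms(2))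

lemma function_eqI:
  assumes "is_function f X Y" "is_function g X Z" "\<And>x. x \<epsilon> X \<Longrightarrow> ap f x = ap g x"
  shows "f = g"
  by (rule set_eqI)
    (auto simp: function_is_set[OF assms(1)] function_is_set[OF assms(2)]
       function_mem_iff[OF assms(1)] function_mem_iff[OF assms(2)] assms(3))

lemma
  assumes "trm (\<lambda>e. F (e 0))"
  shows mem_Lam [simp]: "p \<epsilon> Lam X F \<longleftrightarrow> (\<exists>x. x \<epsilon> X \<and> p = opair x (F x))"
    and is_set_Lam [simp]: "is_set (Lam X F)"
    and ap_Lam [simp]: "x \<epsilon> X \<Longrightarrow> ap (Lam X F) x = F x"
    and app_Lam [simp]: "x \<epsilon> X \<Longrightarrow> app (Lam X F) x = F x"
    and is_function_Lam: "(\<And>x. x \<epsilon> X \<Longrightarrow> F x \<epsilon> Y) \<Longrightarrow> is_function (Lam X F) X Y"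
proof -
  have t: "trm (\<lambda>e. opair (e 0) (F (e 0)))"
    by (intro dfn_intros assms)
  show mem: "p \<epsilon> Lam X F \<longleftrightarrow> (\<exists>x. x \<epsilon> X \<and> p = opair x (F x))" for p
    unfolding Lam_def mem_Img[OF t] ..
  show s: "is_set (Lam X F)"
    unfolding Lam_def using is_set_Img[OF t] .
  show ap: "x \<epsilon> X \<Longrightarrow> ap (Lam X F) x = F x" for x
    by (rule ap_eq) (auto simp: mem)
  show "x \<epsilon> X \<Longrightarrow> app (Lam X F) x = F x"
    by (rule ap_eq) (auto simp: mem)
  show "is_function (Lam X F) X Y" if "\<And>x. x \<epsilon> X \<Longrightarrow> F x \<epsilon> Y"
    unfolding is_function_iff mem using s ap that by auto
qed

section \<open>The natural numbers of the model: induction, order, recursion\<close>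

lemma zero_props: "is_set zero" "\<not> x \<epsilon> zero"
proof -
  obtain z where z: "is_set z" "els z = {}"
    using axioms(2) unfolding ax_empty_def by auto
  have "zero = z"
    unfolding zero_def
  proof (rule the_equality)
    show "y = z" if "y \<in> UNIV \<and> is_set y \<and> els y = {}" for y
      using that z by (intro set_eqI) (auto simp: els_def)
  qed (use z in simp)
  then show "is_set zero" "\<not> x \<epsilon> zero"
    using z by (auto simp: els_def)
qed

lemma not_mem_zero [simp]: "\<not> x \<epsilon> zero"
  by (rule zero_props)

definition suc :: "'m \<Rightarrow> 'm" where
  "suc n = big_union (upair n (upair n n))"

lemma mem_suc [simp]: "x \<epsilon> suc n \<longleftrightarrow> x \<epsilon> n \<or> x = n"
  unfolding suc_def by auto

lemma trm_suc [dfn_intros]: "trm t \<Longrightarrow> trm (\<lambda>e. suc (t e))"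
  unfolding suc_def by (intro dfn_intros)

lemma suc_eqI:
  assumes "els s = insert n (els n)"
  shows "s = suc n"
proof -
  have *: "x \<epsilon> s \<longleftrightarrow> x \<epsilon> n \<or> x = n" for x
    using assms by (auto simp: set_eq_iff)
  then show ?thesis
    using is_setI[of n s] is_setI[of n "suc n"] by (intro set_eqI) auto
qed

lemma is_inductive_iff: "is_inductive w \<longleftrightarrow> zero \<epsilon> w \<and> (\<forall>n. n \<epsilon> w \<longrightarrow> suc n \<epsilon> w)"
proof -
  have "is_set e \<and> els e = {} \<longleftrightarrow> e = zero" for e
    using zero_props by (auto intro: set_eqI simp: set_eq_iff)
  moreover have "els s = insert n (els n) \<longleftrightarrow> s = suc n" for s n
    using suc_eqI[of s n] by (auto simp: set_eq_iff)
  ultimately show ?thesis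
    unfolding is_inductive_def by simp
qed

text \<open>The intersection of all inductive sets is cut out of one of them by separation, and
  extensionality makes it unique.\<close>

lemma omega_least: "is_inductive omega \<and> (\<forall>v. is_inductive v \<longrightarrow> els omega \<subseteq> els v)"
proof -
  obtain w where w: "is_inductive w"
    using axioms(7) unfolding ax_infinity_def by auto
  define W where "W = Col w (\<lambda>n. \<forall>v. zero \<epsilon> v \<and> (\<forall>n. n \<epsilon> v \<longrightarrow> suc n \<epsilon> v) \<longrightarrow> n \<epsilon> v)"
  have d: "dfn (\<lambda>e. \<forall>v. zero \<epsilon> v \<and> (\<forall>n. n \<epsilon> v \<longrightarrow> suc n \<epsilon> v) \<longrightarrow> e 0 \<epsilon> v)"
    by (intro dfn_intros)
  have W: "is_inductive W \<and> (\<forall>v. is_inductive v \<longrightarrow> els W \<subseteq> els v)"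
    using w unfolding W_def is_inductive_iff by (auto simp: d)
  have "\<exists>!W. W \<in> UNIV \<and> is_inductive W \<and> (\<forall>v\<in>UNIV. is_inductive v \<longrightarrow> els W \<subseteq> els v)"
  proof (rule ex1I)
    show "W \<in> UNIV \<and> is_inductive W \<and> (\<forall>v\<in>UNIV. is_inductive v \<longrightarrow> els W \<subseteq> els v)"
      using W by simp
    fix V assume V: "V \<in> UNIV \<and> is_inductive V \<and> (\<forall>v\<in>UNIV. is_inductive v \<longrightarrow> els V \<subseteq> els v)"
    have "els V = els W"
      using V W by blast
    moreover have "is_set V" "is_set W"
      using V W is_setI unfolding is_inductive_iff by blast+
    ultimately show "V = W"
      by (intro set_eqI) (auto simp: set_eq_iff)
  qed
  from theI'[OF this] show ?thesis
    unfolding omega_def by simp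
qed

lemma zero_omega [simp]: "zero \<epsilon> omega" and suc_omega [simp]: "n \<epsilon> omega \<Longrightarrow> suc n \<epsilon> omega"
  using omega_least unfolding is_inductive_iff by auto

text \<open>The numbers satisfying \<open>P\<close> must form a set of the model, hence the
  restriction to definable \<open>P\<close>. For a nonstandard \<open>omega\<close> unrestricted
  induction is false.\<close>

lemma omega_induct [consumes 1, case_names dfn zero suc]:
  assumes "n \<epsilon> omega" "dfn (\<lambda>e. P (e 0))" "P zero" "\<And>n. n \<epsilon> omega \<Longrightarrow> P n \<Longrightarrow> P (suc n)"
  shows "P n"
proof -
  have "is_inductive (Col omega P)"
    unfolding is_inductive_iff using assms by simp
  then have "els omega \<subseteq> els (Col omega P)"
    using omega_least by blast
  then show ?thesis
    using assms(1,2) by auto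
qed

lemma omega_trans:
  assumes "n \<epsilon> omega" "x \<epsilon> n"
  shows "x \<epsilon> omega"
proof -
  have "\<forall>x. x \<epsilon> n \<longrightarrow> x \<epsilon> omega"
    using assms(1) by (induction n rule: omega_induct) (auto intro!: dfn_intros)
  then show ?thesis using assms(2) by blast
qed

lemma nat_trans:
  assumes "n \<epsilon> omega" "m \<epsilon> n" "x \<epsilon> m"
  shows "x \<epsilon> n"
proof -
  have "\<forall>m x. m \<epsilon> n \<longrightarrow> x \<epsilon> m \<longrightarrow> x \<epsilon> n"
    using assms(1) by (induction n rule: omega_induct) (auto intro!: dfn_intros)
  then show ?thesis using assms(2,3) by blast
qed

lemma mem_irrefl [simp]: "\<not> x \<epsilon> x"
  using foundation[of x "upair x x"] by auto

lemma mem_asym: "x \<epsilon> y \<Longrightarrow> \<not> y \<epsilon> x"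
  using foundation[of x "upair x y"] by auto

lemma zero_mem: "n \<epsilon> omega \<Longrightarrow> n = zero \<or> zero \<epsilon> n"
  by (induction n rule: omega_induct) (auto intro!: dfn_intros)

lemma suc_mem_suc:
  assumes "n \<epsilon> omega" "m \<epsilon> n"
  shows "suc m \<epsilon> suc n"
proof -
  have "\<forall>m. m \<epsilon> n \<longrightarrow> suc m \<epsilon> suc n"
    using assms(1) by (induction n rule: omega_induct) (auto intro!: dfn_intros)
  then show ?thesis using assms(2) by blast
qed

lemma trichotomy: "m \<epsilon> omega \<Longrightarrow> n \<epsilon> omega \<Longrightarrow> m \<epsilon> n \<or> m = n \<or> n \<epsilon> m"
proof (induction m rule: omega_induct)
  case zero
  then show ?case using zero_mem[of n] by auto
next
  case (suc m)
  then show ?case using suc_mem_suc[of n m] by auto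
qed (intro dfn_intros)

lemma suc_inj: "suc m = suc n \<Longrightarrow> m = n"
  by (metis mem_suc mem_asym)

lemma suc_neq_zero [simp]: "suc n \<noteq> zero" "zero \<noteq> suc n"
  using mem_suc[of n n] by (metis not_mem_zero)+

lemma suc_neq [simp]: "suc n \<noteq> n" "n \<noteq> suc n"
  using mem_suc[of n n] by (metis mem_irrefl)+

text \<open>\<open>big_union\<close> thus serves as the predecessor in \<open>next_pair\<close> and
  \<open>hotel\<close>.\<close>

lemma big_union_suc: "n \<epsilon> omega \<Longrightarrow> big_union (suc n) = n"
proof (rule set_eqI)
  assume n: "n \<epsilon> omega"
  then show "is_set n"
    using zero_mem[of n] zero_props(1) is_setI by auto
  show "z \<epsilon> big_union (suc n) \<longleftrightarrow> z \<epsilon> n" for z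
    using n nat_trans by auto
qed simp

lemma omega_cases:
  assumes "n \<epsilon> omega"
  obtains "n = zero" | m where "m \<epsilon> omega" "n = suc m"
proof -
  have "n = zero \<or> (\<exists>m. m \<epsilon> omega \<and> n = suc m)"
    using assms by (induction n rule: omega_induct) (auto intro!: dfn_intros)
  then show thesis using that by auto
qed

lemma least_nat:
  assumes "dfn (\<lambda>e. P (e 0))" "n \<epsilon> omega" "P n"
  shows "\<exists>m. m \<epsilon> omega \<and> P m \<and> (\<forall>k. k \<epsilon> m \<longrightarrow> \<not> P k)"
  using foundation[of n "Col omega P"] assms omega_trans by auto

text \<open>The approximations \<open>f\<close> range over all elements of the model: as
  \<open>ap\<close> is total, only its values matter, and no domain has to be mentioned.\<close>

definition rec :: "'m \<Rightarrow> ('m \<Rightarrow> 'm) \<Rightarrow> 'm \<Rightarrow> 'm" where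
  "rec a F n = the1 (\<lambda>y. \<exists>f. ap f zero = a \<and> (\<forall>m. m \<epsilon> n \<longrightarrow> ap f (suc m) = F (ap f m)) \<and> y = ap f n)"

lemma trm_rec [dfn_intros]:
  assumes "trm a" "trm (\<lambda>e. F (e 0) (\<lambda>i. e (Suc i)))" "trm n"
  shows "trm (\<lambda>e. rec (a e) (\<lambda>x. F x e) (n e))"
proof -
  have "trm (\<lambda>e. F (ap (e (Suc 0)) (e 0)) (\<lambda>i. e (Suc (Suc (Suc i)))))"
    by (rule trm_let[OF trm_lift_fun[OF trm_lift_fun[OF trm_lift_fun[OF assms(2)]]]]) (intro dfn_intros)
  then show ?thesis
    unfolding rec_def
    by (intro dfn_intros trm_lift[OF trm_lift[OF assms(1)]] trm_lift[OF trm_lift[OF assms(3)]]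
        trm_lift[OF trm_lift[OF trm_lift[OF assms(3)]]])
qed

lemma
  assumes F: "trm (\<lambda>e. F (e 0))"
  shows rec_zero [simp]: "rec a F zero = a"
    and rec_suc [simp]: "n \<epsilon> omega \<Longrightarrow> rec a F (suc n) = F (rec a F n)"
proof -
  define att where "att f n \<longleftrightarrow> ap f zero = a \<and> (\<forall>m. m \<epsilon> n \<longrightarrow> ap f (suc m) = F (ap f m))" for f n
  have unique: "ap f n = ap g n" if "n \<epsilon> omega" "att f n" "att g n" for f g n
  proof -
    have "m \<epsilon> suc n \<longrightarrow> ap f m = ap g m" if "m \<epsilon> omega" for m
      using that
    proof (induction m rule: omega_induct)
      case (suc m)
      have "m \<epsilon> n" if "suc m \<epsilon> suc n"
        using that nat_trans[OF suc_omega[OF \<open>n \<epsilon> omega\<close>], of "suc m" m] \<open>n \<epsilon> omega\<close>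
          mem_asym[of n "suc m"] by (auto dest: nat_trans)
      then show ?case
        using suc \<open>att f n\<close> \<open>att g n\<close> unfolding att_def by auto
    qed (use that att_def \<open>att f n\<close> \<open>att g n\<close> in \<open>auto intro!: dfn_intros\<close>)
    then show ?thesis using \<open>n \<epsilon> omega\<close> by simp
  qed
  have dfn_att: "dfn (\<lambda>e. \<exists>f. att f (e 0))"
    unfolding att_def by (intro dfn_intros trm_comp[OF F])
  have ex: "\<exists>f. att f n" if "n \<epsilon> omega" for n
    using that
  proof (induction n rule: omega_induct)
    case zero
    have "ap (Lam (suc zero) (\<lambda>_. a)) zero = a"
      by (rule ap_Lam) (auto intro: dfn_intros)
    then show ?case
      unfolding att_def by auto
  next
    case (suc n)
    then obtain f where f: "att f n" by blast
    define g where "g = Lam (suc (suc n)) (\<lambda>m. if m = suc n then F (ap f n) else ap f m)"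
    have t: "trm (\<lambda>e. if e 0 = suc n then F (ap f n) else ap f (e 0))"
      by (intro dfn_intros)
    have g: "ap g m = (if m = suc n then F (ap f n) else ap f m)" if "m \<epsilon> suc (suc n)" for m
      unfolding g_def using ap_Lam[OF t that] by simp
    have "zero \<epsilon> suc (suc n)"
      using zero_mem[of "suc (suc n)"] suc by auto
    then have "ap g zero = a"
      using g[of zero] f unfolding att_def by simp
    moreover have "ap g (suc m) = F (ap g m)" if m: "m \<epsilon> suc n" for m
    proof (cases "m = n")
      case True
      then show ?thesis using g[of "suc n"] g[of n] mem_irrefl[of n] by (auto simp: mem_irrefl)
    next
      case False
      then have "m \<epsilon> n" using m by simp
      then have "suc m \<epsilon> suc n" "m \<noteq> suc n" "suc m \<noteq> suc n"
        using suc_mem_suc suc(1) mem_asym[of m n] mem_irrefl[of n] False suc_inj by auto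
      then show ?thesis
        using g[of "suc m"] g[of m] m f \<open>m \<epsilon> n\<close> unfolding att_def by auto
    qed
    ultimately show ?case
      unfolding att_def by blast
  qed (rule dfn_att)
  have rec: "rec a F n = ap f n" if "n \<epsilon> omega" "att f n" for f n
    unfolding rec_def
  proof (rule the1_eq)
    show "\<exists>g. ap g zero = a \<and> (\<forall>m. m \<epsilon> n \<longrightarrow> ap g (suc m) = F (ap g m)) \<and> ap f n = ap g n"
      using that(2) unfolding att_def by blast
    fix y assume "\<exists>g. ap g zero = a \<and> (\<forall>m. m \<epsilon> n \<longrightarrow> ap g (suc m) = F (ap g m)) \<and> y = ap g n"
    then obtain g where g: "att g n" "y = ap g n"
      unfolding att_def by blast
    show "y = ap f n"
      unfolding g(2) by (rule unique[OF that(1) g(1) that(2)])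
  qed
  show "rec a F zero = a"
    using ex[of zero] rec[of zero] unfolding att_def by auto
  show "rec a F (suc n) = F (rec a F n)" if n: "n \<epsilon> omega"
  proof -
    obtain f where f: "att f (suc n)"
      using ex[of "suc n"] n by auto
    then have "att f n"
      unfolding att_def by simp
    have "rec a F (suc n) = ap f (suc n)" "rec a F n = ap f n"
      using rec[of "suc n", OF _ f] rec[OF n \<open>att f n\<close>] n by auto
    then show ?thesis
      using f unfolding att_def by simp
  qed
qed

text \<open>The union operation is iterated along \<open>omega\<close>: the elements of a member of
  one stage belong to the next stage.\<close>

lemma transitive_superset: "\<exists>T. transitive T \<and> els x \<subseteq> els T"
proof -
  define T where "T = big_union (Img omega (rec x big_union))"
  have t: "trm (\<lambda>e. big_union (e 0))" "trm (\<lambda>e. rec x big_union (e 0))"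
    by (intro dfn_intros)+
  have T: "z \<epsilon> T \<longleftrightarrow> (\<exists>n. n \<epsilon> omega \<and> z \<epsilon> rec x big_union n)" for z
    unfolding T_def by (auto simp: t)
  have "w \<epsilon> T" if "z \<epsilon> T" "w \<epsilon> z" for w z
  proof -
    obtain n where "n \<epsilon> omega" "z \<epsilon> rec x big_union n"
      using T[of z] \<open>z \<epsilon> T\<close> by blast
    then have "w \<epsilon> rec x big_union (suc n)"
      using that rec_suc[OF t(1)] by auto
    then show ?thesis
      using T \<open>n \<epsilon> omega\<close> suc_omega by blast
  qed
  moreover have "z \<epsilon> T" if "z \<epsilon> x" for z
    unfolding T by (rule exI[of _ zero]) (simp add: rec_zero[OF t(1)] that)
  moreover have "is_set T"
    unfolding T_def by simp
  ultimately show ?thesis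
    unfolding transitive_def by (intro exI[of _ T]) (simp add: subset_eq)
qed

text \<open>Foundation speaks about sets, not classes; so a minimal counterexample is taken inside a
  transitive set that contains \<open>x\<close>.\<close>

lemma eps_induct [case_names dfn eps]:
  assumes "dfn (\<lambda>e. P (e 0))" "\<And>x. (\<And>y. y \<epsilon> x \<Longrightarrow> P y) \<Longrightarrow> P x"
  shows "P x"
proof (rule ccontr)
  assume x: "\<not> P x"
  obtain T where T: "transitive T" "els (upair x x) \<subseteq> els T"
    using transitive_superset by blast
  have d: "dfn (\<lambda>e. \<not> P (e 0))"
    by (intro dfn_intros assms(1))
  obtain y where "y \<epsilon> T" "\<not> P y" "\<And>z. z \<epsilon> y \<Longrightarrow> \<not> (z \<epsilon> T \<and> \<not> P z)"
    using foundation[of x "Col T (\<lambda>x. \<not> P x)"] x T(2) by (auto simp: mem_Col[OF d])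
  then show False
    using assms(2) T(1) unfolding transitive_def by fastforce
qed

lemma choice:
  assumes "dfn (\<lambda>e. Q (e 1) (e 0))" "\<And>x. x \<epsilon> X \<Longrightarrow> \<exists>y. y \<epsilon> Y \<and> Q x y"
  shows "\<exists>c. \<forall>x. x \<epsilon> X \<longrightarrow> ap c x \<epsilon> Y \<and> Q x (ap c x)"
proof -
  \<comment> \<open>Tagging the candidates with \<open>x\<close> makes the fibres pairwise disjoint,
    as \<open>ax_choice\<close> requires.\<close>
  define S where "S x = Img (Col Y (Q x)) (opair x)" for x
  have d: "dfn (\<lambda>e. Q (e (Suc 0)) (e 0))" "dfn (\<lambda>e. Q x (e 0))" for x
  proof -
    show d1: "dfn (\<lambda>e. Q (e (Suc 0)) (e 0))" using assms(1) by simp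
    have "inj (case_nat 1 (case_nat 0 (\<lambda>i. Suc (Suc i))))"
      by (auto simp: inj_def split: nat.splits)
    from dfn_subst[OF d1 this]
    have "dfn (\<lambda>e. (\<lambda>x e. Q x (e 0)) (e 0) (\<lambda>i. e (Suc i)))" by simp
    from dfn_let[OF this trm_const] show "dfn (\<lambda>e. Q x (e 0))" .
  qed
  have tS: "trm (\<lambda>e. S (e 0))"
    unfolding S_def by (intro dfn_intros d)
  have to: "trm (\<lambda>e. opair x (e 0))" for x
    by (intro dfn_intros)
  have S: "p \<epsilon> S x \<longleftrightarrow> (\<exists>y. y \<epsilon> Y \<and> Q x y \<and> p = opair x y)" for p x
    unfolding S_def mem_Img[OF to] mem_Col[OF d(2)] by auto
  define Z where "Z = Img X S"
  have Z: "z \<epsilon> Z \<longleftrightarrow> (\<exists>x. x \<epsilon> X \<and> z = S x)" for z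
    unfolding Z_def mem_Img[OF tS] ..
  have 1: "els y \<noteq> {}" if "y \<epsilon> Z" for y
    using that assms(2) unfolding Z els_def set_eq_iff by (auto simp: S)
  have 2: "els y \<inter> els z = {}" if "y \<epsilon> Z" "z \<epsilon> Z" "y \<noteq> z" for y z
    using that unfolding Z els_def by (auto simp: S)
  obtain c where c: "\<And>y. y \<epsilon> Z \<Longrightarrow> \<exists>!z. z \<epsilon> c \<and> z \<epsilon> y"
    using axioms(11)[unfolded ax_choice_def, rule_format, of Z] 1 2 by auto
  \<comment> \<open>The selector \<open>c\<close> may have further elements. Only those in the
    fibres are kept, so that \<open>ap f x\<close> is unambiguous.\<close>
  define f where "f = Col c (\<lambda>p. \<exists>z. z \<epsilon> Z \<and> p \<epsilon> z)"
  have df: "dfn (\<lambda>e. \<exists>z. z \<epsilon> Z \<and> e 0 \<epsilon> z)"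
    by (intro dfn_intros)
  have f: "p \<epsilon> f \<longleftrightarrow> p \<epsilon> c \<and> (\<exists>x. x \<epsilon> X \<and> p \<epsilon> S x)" for p
    unfolding f_def mem_Col[OF df] by (auto simp: Z)
  have "ap f x \<epsilon> Y \<and> Q x (ap f x)" if x: "x \<epsilon> X" for x
  proof -
    have "S x \<epsilon> Z" using x Z by auto
    from c[OF this] obtain p where p: "p \<epsilon> c" "p \<epsilon> S x" "\<And>q. q \<epsilon> c \<Longrightarrow> q \<epsilon> S x \<Longrightarrow> q = p"
      by blast
    obtain y where y: "y \<epsilon> Y" "Q x y" "p = opair x y"
      using p(2) S by blast
    have "ap f x = y"
    proof (rule ap_eq)
      show "opair x y \<epsilon> f"
        using f p(1,2) x y(3) by blast
      show "z = y" if "opair x z \<epsilon> f" for z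
      proof -
        have "opair x z \<epsilon> c" "opair x z \<epsilon> S x"
          using that f S by auto
        from p(3)[OF this] y(3) show ?thesis by simp
      qed
    qed
    then show ?thesis using y by simp
  qed
  then show ?thesis by blast
qed

section \<open>Countable sets of the model\<close>

lemma at_most_countable_iff:
  "at_most_countable X \<longleftrightarrow> (\<exists>f. (\<forall>x. x \<epsilon> X \<longrightarrow> ap f x \<epsilon> omega) \<and>
     (\<forall>x y. x \<epsilon> X \<longrightarrow> y \<epsilon> X \<longrightarrow> ap f x = ap f y \<longrightarrow> x = y))" (is "_ \<longleftrightarrow> ?R")
proof
  assume "at_most_countable X"
  then obtain f where f: "is_function f X omega" "inj_on (app f) (els X)"
    unfolding at_most_countable_def is_injection_def by auto
  then have "inj_on (ap f) (els X)"
    by (subst inj_on_cong[of _ _ "app f"]) (auto simp: app_eq_ap)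
  then show ?R
    using f(1) by (intro exI[of _ f]) (auto simp: ap_in inj_on_def)
next
  assume ?R
  then obtain f where f: "\<And>x. x \<epsilon> X \<Longrightarrow> ap f x \<epsilon> omega"
    "\<And>x y. x \<epsilon> X \<Longrightarrow> y \<epsilon> X \<Longrightarrow> ap f x = ap f y \<Longrightarrow> x = y"
    by blast
  have t: "trm (\<lambda>e. ap f (e 0))"
    by (intro dfn_intros)
  have "is_function (Lam X (ap f)) X omega"
    by (rule is_function_Lam[OF t f(1)])
  moreover have "inj_on (app (Lam X (ap f))) (els X)"
    using f(2) by (auto simp: inj_on_def app_Lam[OF t])
  ultimately show "at_most_countable X"
    unfolding at_most_countable_def is_injection_def by auto
qed

lemma dfn_at_most_countable [dfn_intros]:
  assumes "trm t"
  shows "dfn (\<lambda>e. at_most_countable (t e))"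
  unfolding at_most_countable_iff
  by (intro dfn_intros trm_lift[OF trm_lift[OF assms]] trm_lift[OF trm_lift[OF trm_lift[OF assms]]])

lemma countableI:
  assumes "trm (\<lambda>e. F (e 0))" "\<And>x. x \<epsilon> X \<Longrightarrow> F x \<epsilon> omega"
    "\<And>x y. x \<epsilon> X \<Longrightarrow> y \<epsilon> X \<Longrightarrow> F x = F y \<Longrightarrow> x = y"
  shows "at_most_countable X"
  unfolding at_most_countable_iff
  by (rule exI[of _ "Lam X F"]) (simp add: ap_Lam[OF assms(1)] assms(2,3))

lemma countableE:
  assumes "at_most_countable X"
  obtains f where "\<And>x. x \<epsilon> X \<Longrightarrow> ap f x \<epsilon> omega"
    "\<And>x y. x \<epsilon> X \<Longrightarrow> y \<epsilon> X \<Longrightarrow> ap f x = ap f y \<Longrightarrow> x = y"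
  using assms unfolding at_most_countable_iff by blast

lemma countable_subset:
  assumes "at_most_countable Y" "els X \<subseteq> els Y"
  shows "at_most_countable X"
proof -
  have "x \<epsilon> X \<Longrightarrow> x \<epsilon> Y" for x
    using assms(2) by (auto simp: els_def)
  then show ?thesis
    using assms(1) unfolding at_most_countable_iff by meson
qed

definition first :: "'m \<Rightarrow> 'm" where
  "first p = the1 (\<lambda>x. \<exists>y. p = opair x y)"

definition second :: "'m \<Rightarrow> 'm" where
  "second p = the1 (\<lambda>y. \<exists>x. p = opair x y)"

lemma first_opair [simp]: "first (opair x y) = x"
  unfolding first_def by (rule the1_eq) auto

lemma second_opair [simp]: "second (opair x y) = y"
  unfolding second_def by (rule the1_eq) auto

lemma trm_first [dfn_intros]: assumes "trm t" shows "trm (\<lambda>e. first (t e))"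
  unfolding first_def by (intro dfn_intros trm_lift[OF trm_lift[OF assms]])

lemma trm_second [dfn_intros]: assumes "trm t" shows "trm (\<lambda>e. second (t e))"
  unfolding second_def by (intro dfn_intros trm_lift[OF trm_lift[OF assms]])

text \<open>
  The pairs of natural numbers are enumerated along the shells \<open>max i j = m\<close>, each traversed
  from \<open>(0, m)\<close> to \<open>(m, m)\<close> to \<open>(m, 0)\<close>; this avoids arithmetic on \<open>\<omega>\<close>.
\<close>

definition next_pair :: "'m \<Rightarrow> 'm" where
  "next_pair p = (if first p \<epsilon> second p then opair (suc (first p)) (second p)
     else if second p = zero then opair zero (suc (first p))
     else opair (first p) (big_union (second p)))"

lemma pairs_enumerated:
  assumes "i \<epsilon> omega" "j \<epsilon> omega"
  shows "\<exists>n. n \<epsilon> omega \<and> rec (opair zero zero) next_pair n = opair i j"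
proof -
  have t: "trm (\<lambda>e. next_pair (e 0))"
    unfolding next_pair_def by (intro dfn_intros)
  define R where "R p \<longleftrightarrow> (\<exists>n. n \<epsilon> omega \<and> rec (opair zero zero) next_pair n = p)" for p
  have R0: "R (opair zero zero)"
    unfolding R_def using rec_zero[OF t] zero_omega by blast
  have step: "R (next_pair p)" if "R p" for p
    using that rec_suc[OF t] suc_omega unfolding R_def by metis
  have dR: "dfn (\<lambda>e. R (opair (t e) (s e)))" if "trm t" "trm s" for t s
    unfolding R_def next_pair_def
    by (intro dfn_intros trm_lift[OF that(1)] trm_lift[OF that(2)])
  have up: "R (opair i m)" if "R (opair zero m)" "m \<epsilon> omega" "i \<epsilon> suc m" for i m
  proof -
    have "i \<epsilon> omega"
      using that omega_trans suc_omega by blast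
    then have "i \<epsilon> suc m \<longrightarrow> R (opair i m)"
    proof (induction i rule: omega_induct)
      case (suc i)
      have "i \<epsilon> m" if "suc i \<epsilon> suc m"
        using that nat_trans[of m "suc i" i] \<open>m \<epsilon> omega\<close> by auto
      then show ?case
        using suc(2) step[of "opair i m"] by (auto simp: next_pair_def)
    qed (use that in \<open>auto intro!: dfn_intros dR\<close>)
    then show ?thesis using that by blast
  qed
  have down: "R (opair m j)" if "R (opair m m)" "m \<epsilon> omega" "j \<epsilon> suc m" for j m
  proof (rule ccontr)
    assume j: "\<not> R (opair m j)"
    \<comment> \<open>Descent from \<open>(m, m)\<close> is turned into an upward induction: if
      \<open>(m, j)\<close> is missed, then so is every \<open>(m, k)\<close> with
      \<open>j \<le> k \<le> m\<close>.\<close>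
    have "k \<epsilon> suc m \<and> j \<epsilon> suc k \<longrightarrow> \<not> R (opair m k)" if "k \<epsilon> omega" for k
      using that
    proof (induction k rule: omega_induct)
      case zero
      then show ?case using j by auto
    next
      case (suc k)
      show ?case
      proof (intro impI notI)
        assume k: "suc k \<epsilon> suc m \<and> j \<epsilon> suc (suc k)" and R: "R (opair m (suc k))"
        have "k \<epsilon> m"
          using k nat_trans[of m "suc k" k] \<open>m \<epsilon> omega\<close> by auto
        have "\<not> m \<epsilon> suc k"
          using k mem_asym[of m "suc k"] mem_asym[of k "suc k"] by auto
        then have "R (opair m k)"
          using step[OF R] big_union_suc[OF suc(1)] by (auto simp: next_pair_def)
        moreover have "j \<noteq> suc k"
          using R j by auto
        ultimately show False
          using suc(2) k \<open>k \<epsilon> m\<close> by auto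
      qed
    qed (intro dfn_intros dR)
    from this[OF that(2)] show False using that by auto
  qed
  have shell: "R (opair zero m)" if "m \<epsilon> omega" for m
    using that
  proof (induction m rule: omega_induct)
    case (suc m)
    have "R (opair m zero)"
      using down[OF up[OF suc(2,1)] suc(1)] zero_mem[OF suc(1)] suc(1) by auto
    from step[OF this] show ?case
      by (auto simp: next_pair_def)
  qed (auto intro!: R0 dR dfn_intros)
  have "R (opair i j)"
  proof (cases "i \<epsilon> suc j")
    case True
    then show ?thesis using up[OF shell] assms by blast
  next
    case False
    then have "j \<epsilon> suc i"
      using trichotomy[OF assms] by auto
    then show ?thesis using down[OF up[OF shell]] assms by auto
  qed
  then show ?thesis unfolding R_def .
qed

text \<open>Taking the least index spares a proof that the enumeration of pairs has no repetitions;
  injectivity is immediate because the pair is recovered from its index.\<close>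

definition code :: "'m \<Rightarrow> 'm \<Rightarrow> 'm" where
  "code i j = the1 (\<lambda>n. n \<epsilon> omega \<and> rec (opair zero zero) next_pair n = opair i j \<and>
     (\<forall>m. m \<epsilon> n \<longrightarrow> rec (opair zero zero) next_pair m \<noteq> opair i j))"

lemma trm_code [dfn_intros]:
  assumes "trm t" "trm s"
  shows "trm (\<lambda>e. code (t e) (s e))"
  unfolding code_def next_pair_def
  by (intro dfn_intros trm_lift[OF assms(1)] trm_lift[OF assms(2)]
      trm_lift[OF trm_lift[OF assms(1)]] trm_lift[OF trm_lift[OF assms(2)]])

lemma code_props:
  assumes "i \<epsilon> omega" "j \<epsilon> omega"
  shows "code i j \<epsilon> omega \<and> rec (opair zero zero) next_pair (code i j) = opair i j"
proof -
  let ?P = "\<lambda>n. rec (opair zero zero) next_pair n = opair i j"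
  have "dfn (\<lambda>e. ?P (e 0))"
    unfolding next_pair_def by (intro dfn_intros)
  from pairs_enumerated[OF assms] least_nat[OF this]
  obtain n where n: "n \<epsilon> omega" "?P n" "\<And>m. m \<epsilon> n \<Longrightarrow> \<not> ?P m"
    by blast
  have "code i j = n"
    unfolding code_def
  proof (rule the1_eq)
    show "m = n" if "m \<epsilon> omega \<and> ?P m \<and> (\<forall>k. k \<epsilon> m \<longrightarrow> \<not> ?P k)" for m
      using that n trichotomy by blast
  qed (use n in blast)
  then show ?thesis using n by simp
qed

lemma code_inj:
  assumes "i \<epsilon> omega" "j \<epsilon> omega" "i' \<epsilon> omega" "j' \<epsilon> omega" "code i j = code i' j'"
  shows "i = i' \<and> j = j'"
proof -
  have "opair i j = opair i' j'"
    using code_props[OF assms(1,2), THEN conjunct2] code_props[OF assms(3,4), THEN conjunct2]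
    unfolding assms(5) by (rule trans[OF sym])
  then show ?thesis by simp
qed

definition Prod :: "'m \<Rightarrow> 'm \<Rightarrow> 'm" where
  "Prod X Y = big_union (Img X (\<lambda>x. Img Y (opair x)))"

lemma mem_Prod [simp]: "p \<epsilon> Prod X Y \<longleftrightarrow> (\<exists>x y. x \<epsilon> X \<and> y \<epsilon> Y \<and> p = opair x y)"
proof -
  have t: "trm (\<lambda>e. opair x (e 0))" "trm (\<lambda>e. Img Y (opair (e 0)))" for x
    by (intro dfn_intros)+
  show ?thesis
    unfolding Prod_def by (auto simp: mem_Img[OF t(1)] mem_Img[OF t(2)])
qed

lemma countable_UN:
  assumes S: "trm (\<lambda>e. S (e 0))" and C: "at_most_countable C"
    and SC: "\<And>v. v \<epsilon> C \<Longrightarrow> at_most_countable (S v)"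
  shows "at_most_countable (big_union (Img C S))"
proof -
  define U where "U = big_union (Img C S)"
  have U: "w \<epsilon> U \<longleftrightarrow> (\<exists>v. v \<epsilon> C \<and> w \<epsilon> S v)" for w
    unfolding U_def by (auto simp: mem_Img[OF S])
  have "dfn (\<lambda>e. e 1 \<epsilon> S (e 0))"
    by (intro dfn_intros S)
  moreover have "\<exists>v. v \<epsilon> C \<and> w \<epsilon> S v" if "w \<epsilon> U" for w
    using that U by blast
  ultimately obtain c where c: "\<And>w. w \<epsilon> U \<Longrightarrow> ap c w \<epsilon> C \<and> w \<epsilon> S (ap c w)"
    using choice[of "\<lambda>w v. w \<epsilon> S v" U C] by metis
  define Q where "Q v h \<longleftrightarrow> (\<forall>w. w \<epsilon> S v \<longrightarrow> ap h w \<epsilon> omega) \<and>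
    (\<forall>w z. w \<epsilon> S v \<longrightarrow> z \<epsilon> S v \<longrightarrow> ap h w = ap h z \<longrightarrow> w = z)" for v h
  have "dfn (\<lambda>e. Q (e 1) (e 0))"
    unfolding Q_def by (intro dfn_intros trm_comp[OF S])
  \<comment> \<open>The injections are to be chosen from one set. Restricted to \<open>S v\<close>,
    they all lie in the power set of \<open>Prod U omega\<close>.\<close>
  moreover have "\<exists>h. h \<epsilon> Power (Prod U omega) \<and> Q v h" if v: "v \<epsilon> C" for v
  proof -
    obtain f where f: "\<And>w. w \<epsilon> S v \<Longrightarrow> ap f w \<epsilon> omega"
      "\<And>w z. w \<epsilon> S v \<Longrightarrow> z \<epsilon> S v \<Longrightarrow> ap f w = ap f z \<Longrightarrow> w = z"
      using countableE[OF SC[OF v]] by blast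
    have t: "trm (\<lambda>e. ap f (e 0))"
      by (intro dfn_intros)
    have "Lam (S v) (ap f) \<epsilon> Power (Prod U omega)"
      by (auto simp: mem_Lam[OF t] is_set_Lam[OF t] U) (use f(1) v in blast)+
    moreover have "Q v (Lam (S v) (ap f))"
      unfolding Q_def using f by (simp add: ap_Lam[OF t])
    ultimately show ?thesis by blast
  qed
  ultimately obtain h where h: "\<And>v. v \<epsilon> C \<Longrightarrow> Q v (ap h v)"
    using choice[of Q C "Power (Prod U omega)"] by blast
  obtain g where g: "\<And>v. v \<epsilon> C \<Longrightarrow> ap g v \<epsilon> omega"
      "\<And>v u. v \<epsilon> C \<Longrightarrow> u \<epsilon> C \<Longrightarrow> ap g v = ap g u \<Longrightarrow> v = u"
    using countableE[OF C] by blast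
  have "at_most_countable U"
  proof (rule countableI)
    let ?F = "\<lambda>w. code (ap g (ap c w)) (ap (ap h (ap c w)) w)"
    show "trm (\<lambda>e. ?F (e 0))"
      by (intro dfn_intros)
    have 1: "ap g (ap c w) \<epsilon> omega" "ap (ap h (ap c w)) w \<epsilon> omega" if "w \<epsilon> U" for w
      using c[OF that] g h[of "ap c w"] unfolding Q_def by blast+
    then show "?F w \<epsilon> omega" if "w \<epsilon> U" for w
      using code_props that by blast
    show "w = z" if w: "w \<epsilon> U" and z: "z \<epsilon> U" and eq: "?F w = ?F z" for w z
    proof -
      have "ap g (ap c w) = ap g (ap c z)" and 2: "ap (ap h (ap c w)) w = ap (ap h (ap c z)) z"
        using code_inj[OF 1[OF w] 1[OF z] eq] by auto
      then have "ap c w = ap c z"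
        using g(2) c w z by blast
      then show ?thesis
        using 2 c[OF w] c[OF z] h[of "ap c z"] unfolding Q_def by metis
    qed
  qed
  then show ?thesis unfolding U_def .
qed

section \<open>Uncountable graphs in the ground model\<close>

definition chain :: "'m \<Rightarrow> bool" where
  "chain L \<longleftrightarrow> (\<forall>x y. x \<epsilon> L \<longrightarrow> y \<epsilon> L \<longrightarrow> els x \<subseteq> els y \<or> els y \<subseteq> els x)"

lemma dfn_chain [dfn_intros]: assumes "trm t" shows "dfn (\<lambda>e. chain (t e))"
  unfolding chain_def by (intro dfn_intros trm_lift[OF trm_lift[OF assms]])

definition ins :: "'m \<Rightarrow> 'm \<Rightarrow> 'm" where
  "ins w M = big_union (upair M (upair w w))"

lemma mem_ins [simp]: "z \<epsilon> ins w M \<longleftrightarrow> z \<epsilon> M \<or> z = w"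
  unfolding ins_def by auto

lemma is_set_ins [simp]: "is_set (ins w M)"
  unfolding ins_def by simp

lemma trm_ins [dfn_intros]: "trm t \<Longrightarrow> trm s \<Longrightarrow> trm (\<lambda>e. ins (t e) (s e))"
  unfolding ins_def by (intro dfn_intros)

lemma els_subset_iff: "els x \<subseteq> els y \<longleftrightarrow> (\<forall>z. z \<epsilon> x \<longrightarrow> z \<epsilon> y)"
  by (auto simp: els_def)

text \<open>The tower argument, without ordinals. If every member of \<open>X\<close> had a
  one-point extension in \<open>X\<close>, choice would give an operation \<open>ext\<close>. The
  least family \<open>T\<close> closed under \<open>ext\<close> and under unions of chains is itself
  a chain, so its union belongs to \<open>T\<close>, yet could be extended properly.\<close>

lemma zorn:
  assumes P: "dfn (\<lambda>e. P (e 0))"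
    and chains: "\<And>L. chain L \<Longrightarrow> (\<And>x. x \<epsilon> L \<Longrightarrow> P x) \<Longrightarrow> P (big_union L)"
  shows "\<exists>M. is_set M \<and> els M \<subseteq> els W \<and> P M \<and> (\<forall>w. w \<epsilon> W \<and> \<not> w \<epsilon> M \<longrightarrow> \<not> P (ins w M))"
proof (rule ccontr)
  assume no: "\<not> ?thesis"
  define X where "X = Col (Power W) P"
  have X: "M \<epsilon> X \<longleftrightarrow> is_set M \<and> els M \<subseteq> els W \<and> P M" for M
    unfolding X_def mem_Col[OF P] by auto
  have Pt: "dfn (\<lambda>e. P (t e))" if "trm t" for t
    using dfn_let[of "\<lambda>x e. P x", OF P that] .
  have d: "dfn (\<lambda>e. \<not> e 0 \<epsilon> e 1 \<and> P (ins (e 0) (e 1)))"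
    by (intro dfn_intros Pt)
  have ex: "\<exists>w. w \<epsilon> W \<and> \<not> w \<epsilon> M \<and> P (ins w M)" if "M \<epsilon> X" for M
    using no that X by blast
  obtain c where c: "\<And>M. M \<epsilon> X \<Longrightarrow> ap c M \<epsilon> W \<and> \<not> ap c M \<epsilon> M \<and> P (ins (ap c M) M)"
    using choice[where Q = "\<lambda>M w. \<not> w \<epsilon> M \<and> P (ins w M)" and X = X and Y = W, OF d ex] by blast
  define ext where "ext M = ins (ap c M) M" for M
  define closed where "closed K \<longleftrightarrow> (\<forall>M. M \<epsilon> K \<longrightarrow> ext M \<epsilon> K) \<and>
    (\<forall>L. els L \<subseteq> els K \<and> chain L \<longrightarrow> big_union L \<epsilon> K)" for K
  have t_ext: "trm (\<lambda>e. ext (t e))" if "trm t" for t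
    unfolding ext_def by (intro dfn_intros that)
  have "ext M \<epsilon> X" if "M \<epsilon> X" for M
    using c[OF that] that unfolding X ext_def els_subset_iff by auto
  moreover have "big_union L \<epsilon> X" if "els L \<subseteq> els X" "chain L" for L
  proof -
    have L: "x \<epsilon> X" if "x \<epsilon> L" for x
      using that \<open>els L \<subseteq> els X\<close> by (auto simp: els_subset_iff)
    then have "P (big_union L)"
      using chains[OF that(2)] X by blast
    moreover have "els (big_union L) \<subseteq> els W"
      using L X by (auto simp: els_subset_iff)
    ultimately show ?thesis
      using X by simp
  qed
  ultimately have X_closed: "closed X"
    unfolding closed_def by blast
  define T where "T = Col X (\<lambda>M. \<forall>K. closed K \<longrightarrow> M \<epsilon> K)"
  have "dfn (\<lambda>e. \<forall>K. closed K \<longrightarrow> e 0 \<epsilon> K)"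
    unfolding closed_def by (intro dfn_intros t_ext)
  then have T: "M \<epsilon> T \<longleftrightarrow> (\<forall>K. closed K \<longrightarrow> M \<epsilon> K)" for M
    unfolding T_def using X_closed by (auto simp: mem_Col)
  have "ext M \<epsilon> K" if "closed K" "M \<epsilon> T" for M K
    using that T unfolding closed_def by blast
  moreover have "big_union L \<epsilon> K" if "closed K" "els L \<subseteq> els T" "chain L" for L K
  proof -
    have "els L \<subseteq> els K"
      using that(1,2) T unfolding els_subset_iff by blast
    then show ?thesis
      using that unfolding closed_def by blast
  qed
  ultimately have T_closed: "closed T"
    using T unfolding closed_def[of T] by blast
  have TX: "M \<epsilon> X" if "M \<epsilon> T" for M
    using that T X_closed by blast
  have T_induct: "Q M" if "M \<epsilon> T" and dQ: "dfn (\<lambda>e. Q (e 0))"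
    and 1: "\<And>M. M \<epsilon> T \<Longrightarrow> Q M \<Longrightarrow> Q (ext M)"
    and 2: "\<And>L. els L \<subseteq> els T \<Longrightarrow> (\<And>x. x \<epsilon> L \<Longrightarrow> Q x) \<Longrightarrow> Q (big_union L)" for Q M
  proof -
    have "closed (Col T Q)"
      using T_closed 1 2 unfolding closed_def by (simp add: mem_Col[OF dQ] els_subset_iff)
    then show ?thesis
      using that(1) T mem_Col[OF dQ] by blast
  qed
  have ext_T: "ext M \<epsilon> T" if "M \<epsilon> T" for M
    using T_closed that unfolding closed_def by blast
  have sub_ext: "els M \<subseteq> els (ext M)" for M
    unfolding ext_def els_subset_iff by simp
  define cmp where "cmp M \<longleftrightarrow> (\<forall>t. t \<epsilon> T \<longrightarrow> els t \<subseteq> els M \<or> els M \<subseteq> els t)" for M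
  \<comment> \<open>No member of \<open>T\<close> lies strictly between a comparable
    \<open>M\<close> and its extension, because \<open>ext M\<close> has only one new
    element.\<close>
  have step: "els t \<subseteq> els M \<or> els (ext M) \<subseteq> els t" if M: "M \<epsilon> T" "cmp M" and t: "t \<epsilon> T" for M t
    using t
  proof (rule T_induct)
    show "dfn (\<lambda>e. els (e 0) \<subseteq> els M \<or> els (ext M) \<subseteq> els (e 0))"
      by (intro dfn_intros)
    show "els (ext s) \<subseteq> els M \<or> els (ext M) \<subseteq> els (ext s)"
      if s: "s \<epsilon> T" and IH: "els s \<subseteq> els M \<or> els (ext M) \<subseteq> els s" for s
    proof (cases "els s \<subseteq> els M")
      case True
      show ?thesis
      proof (cases "els M \<subseteq> els s")
        case True
        then have "M = s"
          using \<open>els s \<subseteq> els M\<close> TX[OF s] TX[OF M(1)] X by (intro set_eqI) (auto simp: els_subset_iff)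
        then show ?thesis by simp
      next
        case False
        have "els (ext s) \<subseteq> els M \<or> els M \<subseteq> els (ext s)"
          using M(2) ext_T[OF s] unfolding cmp_def by blast
        then show ?thesis
          using False \<open>els s \<subseteq> els M\<close> unfolding ext_def els_subset_iff by auto
      qed
    next
      case False
      then show ?thesis using IH sub_ext[of s] by blast
    qed
    show "els (big_union L) \<subseteq> els M \<or> els (ext M) \<subseteq> els (big_union L)"
      if "els L \<subseteq> els T" "\<And>x. x \<epsilon> L \<Longrightarrow> els x \<subseteq> els M \<or> els (ext M) \<subseteq> els x" for L
      using that(2) unfolding els_subset_iff by (simp, blast)
  qed
  have cmp: "cmp M" if "M \<epsilon> T" for M
    using that
  proof (rule T_induct)
    show "dfn (\<lambda>e. cmp (e 0))"
      unfolding cmp_def by (intro dfn_intros)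
    show "cmp (ext M)" if "M \<epsilon> T" "cmp M" for M
      using step[OF that] sub_ext[of M] unfolding cmp_def by blast
    show "cmp (big_union L)" if "els L \<subseteq> els T" "\<And>x. x \<epsilon> L \<Longrightarrow> cmp x" for L
      using that(2) unfolding cmp_def els_subset_iff by (simp, blast)
  qed
  define U where "U = big_union T"
  have "chain T"
    using cmp unfolding chain_def cmp_def by blast
  then have "U \<epsilon> T"
    using T_closed unfolding closed_def U_def by blast
  \<comment> \<open>\<open>ext U\<close> belongs to \<open>T\<close> and is therefore contained in
    the union \<open>U\<close>.\<close>
  then have "ap c U \<epsilon> U"
    using ext_T[of U] unfolding U_def ext_def by (auto intro: exI[of _ "ext U"])
  then show False
    using c TX[OF \<open>U \<epsilon> T\<close>] by blast
qed

lemma upair_commute: "upair x y = upair y x"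
  by (simp add: upair_eq_iff)

lemma countable_insert:
  assumes "at_most_countable Y" "\<And>x. x \<epsilon> X \<Longrightarrow> x = v \<or> x \<epsilon> Y"
  shows "at_most_countable X"
proof -
  obtain f where f: "\<And>x. x \<epsilon> Y \<Longrightarrow> ap f x \<epsilon> omega"
    "\<And>x y. x \<epsilon> Y \<Longrightarrow> y \<epsilon> Y \<Longrightarrow> ap f x = ap f y \<Longrightarrow> x = y"
    using countableE[OF assms(1)] by blast
  show ?thesis
  proof (rule countableI)
    \<comment> \<open>The old values are shifted by one to free \<open>zero\<close> for
      \<open>v\<close>.\<close>
    show "trm (\<lambda>e. if e 0 = v then zero else suc (ap f (e 0)))"
      by (intro dfn_intros)
    show "(if x = v then zero else suc (ap f x)) \<epsilon> omega" if "x \<epsilon> X" for x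
      using assms(2)[OF that] f(1) by auto
    show "x = y" if "x \<epsilon> X" "y \<epsilon> X"
      "(if x = v then zero else suc (ap f x)) = (if y = v then zero else suc (ap f y))" for x y
    proof (cases "x = v \<or> y = v")
      case True
      then show ?thesis using that(3) by (auto split: if_splits)
    next
      case False
      then show ?thesis
        using that f(2)[of x y] assms(2) suc_inj[of "ap f x" "ap f y"] by auto
    qed
  qed
qed

definition non_nbrs :: "'m \<Rightarrow> 'm \<Rightarrow> 'm \<Rightarrow> 'm" where
  "non_nbrs E W v = Col W (\<lambda>w. w \<noteq> v \<and> \<not> upair v w \<epsilon> E)"

lemma mem_non_nbrs [simp]: "w \<epsilon> non_nbrs E W v \<longleftrightarrow> w \<epsilon> W \<and> w \<noteq> v \<and> \<not> upair v w \<epsilon> E"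
proof -
  have "dfn (\<lambda>e. e 0 \<noteq> v \<and> \<not> upair v (e 0) \<epsilon> E)"
    by (intro dfn_intros)
  then show ?thesis
    unfolding non_nbrs_def by (auto simp: mem_Col)
qed

lemma trm_non_nbrs [dfn_intros]:
  assumes "trm s" "trm t" "trm u"
  shows "trm (\<lambda>e. non_nbrs (s e) (t e) (u e))"
  unfolding non_nbrs_def by (intro dfn_intros assms trm_lift[OF assms(1)] trm_lift[OF assms(3)])

text \<open>
  If all cliques were countable, the vertices outside a clique \<open>C\<close> that are adjacent to all of \<open>C\<close>
  would exhaust all but countably many vertices, so \<open>C\<close> would not be maximal.
\<close>

lemma uncountable_clique:
  assumes "\<not> at_most_countable W" "\<And>v. v \<epsilon> W \<Longrightarrow> at_most_countable (non_nbrs E W v)"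
  shows "\<exists>C. is_set C \<and> els C \<subseteq> els W \<and> (\<forall>x y. x \<epsilon> C \<longrightarrow> y \<epsilon> C \<longrightarrow> x \<noteq> y \<longrightarrow> upair x y \<epsilon> E) \<and>
    \<not> at_most_countable C"
proof -
  define P where "P C \<longleftrightarrow> (\<forall>x y. x \<epsilon> C \<longrightarrow> y \<epsilon> C \<longrightarrow> x \<noteq> y \<longrightarrow> upair x y \<epsilon> E)" for C
  have "dfn (\<lambda>e. P (e 0))"
    unfolding P_def by (intro dfn_intros)
  moreover have "P (big_union L)" if "chain L" "\<And>x. x \<epsilon> L \<Longrightarrow> P x" for L
    using that unfolding P_def chain_def els_subset_iff by (simp, blast)
  ultimately obtain C where C: "is_set C" "els C \<subseteq> els W" "P C"
    "\<And>w. w \<epsilon> W \<Longrightarrow> \<not> w \<epsilon> C \<Longrightarrow> \<not> P (ins w C)"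
    using zorn[of P W] by blast
  have "\<not> at_most_countable C"
  proof
    assume "at_most_countable C"
    \<comment> \<open>Adding \<open>v\<close> itself makes the sets \<open>S v\<close> cover the
      members of \<open>C\<close> as well.\<close>
    define S where "S v = ins v (non_nbrs E W v)" for v
    have tS: "trm (\<lambda>e. S (e 0))"
      unfolding S_def by (intro dfn_intros)
    have "at_most_countable (S v)" if "v \<epsilon> C" for v
      using countable_insert[OF assms(2), of v "S v" v] that C(2)
      unfolding S_def els_subset_iff by (auto simp: S_def)
    then have "at_most_countable (big_union (Img C S))"
      by (rule countable_UN[OF tS \<open>at_most_countable C\<close>])
    moreover have "w \<epsilon> big_union (Img C S)" if w: "w \<epsilon> W" for w
    proof (cases "w \<epsilon> C")
      case True
      then have "w \<epsilon> S w" unfolding S_def by simp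
      then show ?thesis using True by (auto simp: mem_Img[OF tS])
    next
      case False
      then obtain v where "v \<epsilon> C" "\<not> upair v w \<epsilon> E"
        using C(4)[OF w] C(3) upair_commute unfolding P_def by auto
      then have "w \<epsilon> S v"
        unfolding S_def using w by auto
      then show ?thesis using \<open>v \<epsilon> C\<close> by (auto simp: mem_Img[OF tS])
    qed
    ultimately show False
      using assms(1) countable_subset unfolding els_subset_iff by blast
  qed
  then show ?thesis
    using C(1-3) unfolding P_def by blast
qed

text \<open>
  Choose \<open>v\<close> as in the hypothesis, pass from \<open>W\<close> to its non-neighbours, and repeat.
\<close>

lemma infinite_independent:
  assumes V: "is_set V" "\<not> at_most_countable V"
    and step: "\<And>W. els W \<subseteq> els V \<Longrightarrow> \<not> at_most_countable W \<Longrightarrow>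
      \<exists>v. v \<epsilon> W \<and> \<not> at_most_countable (non_nbrs E W v)"
  shows "\<exists>F. trm (\<lambda>e. F (e 0)) \<and> (\<forall>n. n \<epsilon> omega \<longrightarrow> F n \<epsilon> V) \<and>
    (\<forall>m n. m \<epsilon> omega \<longrightarrow> n \<epsilon> omega \<longrightarrow> m \<noteq> n \<longrightarrow> F m \<noteq> F n \<and> \<not> upair (F m) (F n) \<epsilon> E)"
proof -
  define X where "X = Col (Power V) (\<lambda>W. \<not> at_most_countable W)"
  have "dfn (\<lambda>e. \<not> at_most_countable (e 0))"
    by (intro dfn_intros)
  then have X: "W \<epsilon> X \<longleftrightarrow> is_set W \<and> els W \<subseteq> els V \<and> \<not> at_most_countable W" for W
    unfolding X_def by (auto simp: mem_Col)
  have d: "dfn (\<lambda>e. e 0 \<epsilon> e 1 \<and> \<not> at_most_countable (non_nbrs E (e 1) (e 0)))"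
    by (intro dfn_intros)
  have ex: "\<exists>v. v \<epsilon> V \<and> v \<epsilon> W \<and> \<not> at_most_countable (non_nbrs E W v)" if "W \<epsilon> X" for W
    using step[of W] that unfolding X els_subset_iff by blast
  obtain c where c: "\<And>W. W \<epsilon> X \<Longrightarrow> ap c W \<epsilon> V \<and> ap c W \<epsilon> W \<and>
      \<not> at_most_countable (non_nbrs E W (ap c W))"
    using choice[where Q = "\<lambda>W v. v \<epsilon> W \<and> \<not> at_most_countable (non_nbrs E W v)" and X = X and Y = V, OF d ex]
    by blast
  define S where "S = rec V (\<lambda>W. non_nbrs E W (ap c W))"
  have t: "trm (\<lambda>e. non_nbrs E (e 0) (ap c (e 0)))"
    by (intro dfn_intros)
  have tS: "trm (\<lambda>e. S (t e))" if "trm t" for t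
    unfolding S_def by (intro dfn_intros that)
  have S0: "S zero = V" and Ss: "n \<epsilon> omega \<Longrightarrow> S (suc n) = non_nbrs E (S n) (ap c (S n))" for n
    unfolding S_def using rec_zero[OF t] rec_suc[OF t] by auto
  have SX: "S n \<epsilon> X" if "n \<epsilon> omega" for n
    using that
  proof (induction n rule: omega_induct)
    case zero
    then show ?case using V by (simp add: S0 X)
  next
    case (suc n)
    have "is_set (non_nbrs E (S n) (ap c (S n)))"
    proof -
      have "dfn (\<lambda>e. e 0 \<noteq> v \<and> \<not> upair v (e 0) \<epsilon> E)" for v
        by (intro dfn_intros)
      then show ?thesis unfolding non_nbrs_def by (rule is_set_Col)
    qed
    then show ?case
      using suc c[OF suc(2)] unfolding X els_subset_iff by (simp add: Ss)
  qed (intro dfn_intros tS)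
  \<comment> \<open>All later stages consist of non-neighbours of the vertex chosen at stage
    \<open>m\<close>.\<close>
  have mono: "m \<epsilon> n \<Longrightarrow> els (S n) \<subseteq> els (S (suc m))" if "n \<epsilon> omega" for m n
  proof -
    have "\<forall>m. m \<epsilon> n \<longrightarrow> els (S n) \<subseteq> els (S (suc m))"
      using that
    proof (induction n rule: omega_induct)
      case (suc n)
      have "els (S (suc n)) \<subseteq> els (S n)"
        unfolding Ss[OF suc(1)] els_subset_iff by simp
      then show ?case
        using suc(2) by auto
    qed (auto intro!: dfn_intros tS)
    then show "m \<epsilon> n \<Longrightarrow> els (S n) \<subseteq> els (S (suc m))" by blast
  qed
  define F where "F n = ap c (S n)" for n
  have F: "F n \<noteq> F m \<and> \<not> upair (F m) (F n) \<epsilon> E" if "m \<epsilon> n" "n \<epsilon> omega" for m n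
  proof -
    have "F n \<epsilon> S n"
      using c SX[OF that(2)] unfolding F_def by blast
    then have "F n \<epsilon> S (suc m)"
      using mono[OF that(2,1)] unfolding els_subset_iff by blast
    then show ?thesis
      using Ss[OF omega_trans[OF that(2,1)]] unfolding F_def by simp
  qed
  have "F m \<noteq> F n \<and> \<not> upair (F m) (F n) \<epsilon> E" if "m \<epsilon> omega" "n \<epsilon> omega" "m \<noteq> n" for m n
    using trichotomy[OF that(1,2)] that(3) F[of m n] F[of n m] that(1,2) upair_commute[of "F m" "F n"]
    by auto
  moreover have "F n \<epsilon> V" if "n \<epsilon> omega" for n
    using c SX[OF that] unfolding F_def by blast
  moreover have "trm (\<lambda>e. F (e 0))"
    unfolding F_def by (intro dfn_intros tS)
  ultimately show ?thesis by blast
qed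

section \<open>The action of permutations of the atoms\<close>

text \<open>
  \<open>actR\<close> and \<open>act'\<close> are \<open>act\<close> with \<open>app\<close> replaced by the total \<open>ap\<close>, hence definable in
  all arguments.
\<close>

definition actR :: "'m \<Rightarrow> 'm \<Rightarrow> 'm \<Rightarrow> bool" where
  "actR f x y \<longleftrightarrow> (\<exists>T Y F. transitive T \<and> x \<epsilon> T \<and> is_function F T Y \<and>
     (\<forall>z. z \<epsilon> T \<longrightarrow> (if z \<epsilon> A then ap F z = ap f z
        else \<not> ap F z \<epsilon> A \<and> (\<forall>w. w \<epsilon> ap F z \<longleftrightarrow> (\<exists>u. u \<epsilon> z \<and> w = ap F u)))) \<and>
     y = ap F x)"

definition act' :: "'m \<Rightarrow> 'm \<Rightarrow> 'm" where
  "act' f x = the1 (actR f x)"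

lemma dfn_transitive [dfn_intros]: assumes "trm t" shows "dfn (\<lambda>e. transitive (t e))"
  unfolding transitive_def by (intro dfn_intros assms trm_lift[OF assms])

lemma dfn_actR [dfn_intros]:
  assumes "trm f" "trm x" "trm y"
  shows "dfn (\<lambda>e. actR (f e) (x e) (y e))"
proof -
  have 1: "trm (\<lambda>e. f (\<lambda>i. e (Suc (Suc (Suc i)))))" "trm (\<lambda>e. x (\<lambda>i. e (Suc (Suc (Suc i)))))"
    "trm (\<lambda>e. y (\<lambda>i. e (Suc (Suc (Suc i)))))" "trm (\<lambda>e. f (\<lambda>i. e (Suc (Suc (Suc (Suc i))))))"
    using trm_lift[OF trm_lift[OF trm_lift[OF assms(1)]]] trm_lift[OF trm_lift[OF trm_lift[OF assms(2)]]]
     trm_lift[OF trm_lift[OF trm_lift[OF assms(3)]]] trm_lift[OF trm_lift[OF trm_lift[OF trm_lift[OF assms(1)]]]]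
    by blast+
  show ?thesis
    unfolding actR_def by (intro dfn_intros 1)
qed

lemma trm_act' [dfn_intros]:
  assumes "trm f" "trm x"
  shows "trm (\<lambda>e. act' (f e) (x e))"
  unfolding act'_def by (intro dfn_intros trm_lift[OF assms(1)] trm_lift[OF assms(2)])

lemma transitiveD: "transitive T \<Longrightarrow> x \<epsilon> T \<Longrightarrow> y \<epsilon> x \<Longrightarrow> y \<epsilon> T"
  unfolding transitive_def els_subset_iff by simp

lemma actR_unique:
  assumes "actR f x y" "actR f x y'"
  shows "y = y'"
proof -
  obtain T Y F where F: "transitive T" "x \<epsilon> T"
     "\<And>z. z \<epsilon> T \<Longrightarrow> (if z \<epsilon> A then ap F z = ap f z
        else \<not> ap F z \<epsilon> A \<and> (\<forall>w. w \<epsilon> ap F z \<longleftrightarrow> (\<exists>u. u \<epsilon> z \<and> w = ap F u)))" "y = ap F x"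
    using assms(1) unfolding actR_def by blast
  obtain T' Y' F' where F': "transitive T'" "x \<epsilon> T'"
     "\<And>z. z \<epsilon> T' \<Longrightarrow> (if z \<epsilon> A then ap F' z = ap f z
        else \<not> ap F' z \<epsilon> A \<and> (\<forall>w. w \<epsilon> ap F' z \<longleftrightarrow> (\<exists>u. u \<epsilon> z \<and> w = ap F' u)))" "y' = ap F' x"
    using assms(2) unfolding actR_def by blast
  have "z \<epsilon> T \<longrightarrow> z \<epsilon> T' \<longrightarrow> ap F z = ap F' z" for z
  proof (induction z rule: eps_induct)
    case (eps z)
    show ?case
    proof (intro impI)
      assume z: "z \<epsilon> T" "z \<epsilon> T'"
      show "ap F z = ap F' z"
      proof (cases "z \<epsilon> A")
        case True
        then show ?thesis using F(3)[OF z(1)] F'(3)[OF z(2)] by simp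
      next
        case False
        have "ap F u = ap F' u" if "u \<epsilon> z" for u
          using eps[OF that] transitiveD[OF F(1) z(1) that] transitiveD[OF F'(1) z(2) that] by blast
        then have "(\<exists>u. u \<epsilon> z \<and> w = ap F u) \<longleftrightarrow> (\<exists>u. u \<epsilon> z \<and> w = ap F' u)" for w
          by metis
        then show ?thesis
          using False F(3)[OF z(1)] F'(3)[OF z(2)] by (intro set_eqI) (simp_all add: is_set_def)
      qed
    qed
  qed (intro dfn_intros)
  then show ?thesis
    using F(2,4) F'(2,4) by blast
qed

lemma act'_eq: "actR f x y \<Longrightarrow> act' f x = y"
  unfolding act'_def using actR_unique by (intro the1_eq)

lemma actR_step:
  assumes "actR f x y"
  shows "u \<epsilon> x \<Longrightarrow> actR f u (act' f u)"
    and "if x \<epsilon> A then y = ap f x else \<not> y \<epsilon> A \<and> (\<forall>w. w \<epsilon> y \<longleftrightarrow> (\<exists>u. u \<epsilon> x \<and> w = act' f u))"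
proof -
  obtain T Y F where F: "transitive T" "x \<epsilon> T" "is_function F T Y"
     "\<forall>z. z \<epsilon> T \<longrightarrow> (if z \<epsilon> A then ap F z = ap f z
        else \<not> ap F z \<epsilon> A \<and> (\<forall>w. w \<epsilon> ap F z \<longleftrightarrow> (\<exists>u. u \<epsilon> z \<and> w = ap F u)))" "y = ap F x"
    using assms unfolding actR_def by blast
  have *: "actR f u (ap F u)" if "u \<epsilon> x" for u
    unfolding actR_def
    by (rule exI[of _ T], rule exI[of _ Y], rule exI[of _ F])
       (use F transitiveD[OF F(1,2) that] in blast)
  then have eq: "act' f u = ap F u" if "u \<epsilon> x" for u
    using act'_eq that by blast
  then show "u \<epsilon> x \<Longrightarrow> actR f u (act' f u)"
    using * by simp
  have "(\<exists>u. u \<epsilon> x \<and> w = ap F u) \<longleftrightarrow> (\<exists>u. u \<epsilon> x \<and> w = act' f u)" for w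
    using eq by metis
  then show "if x \<epsilon> A then y = ap f x else \<not> y \<epsilon> A \<and> (\<forall>w. w \<epsilon> y \<longleftrightarrow> (\<exists>u. u \<epsilon> x \<and> w = act' f u))"
    using F(4)[THEN spec, of x] F(2,5) by simp
qed

text \<open>The induction hypothesis gives a value at each element of \<open>x\<close>, but through
  different functions. By uniqueness they fit together to \<open>act'\<close>, which is tabulated on
  one transitive set.\<close>

lemma actR_total: "\<exists>y. actR f x y"
proof (induction x rule: eps_induct)
  case (eps x)
  show ?case
  proof (rule ccontr)
    assume x: "\<nexists>y. actR f x y"
    obtain T where T: "transitive T" "els (upair x x) \<subseteq> els T"
      using transitive_superset by blast
    have d: "dfn (\<lambda>e. e 0 = x \<or> (\<exists>w. actR f (e 0) w))"
      by (intro dfn_intros)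
    \<comment> \<open>Only points at which a value already exists are kept, besides \<open>x\<close>
      itself; \<open>actR_step\<close> and the induction hypothesis make \<open>T'\<close>
      transitive.\<close>
    define T' where "T' = Col T (\<lambda>z. z = x \<or> (\<exists>w. actR f z w))"
    have T': "z \<epsilon> T' \<longleftrightarrow> z \<epsilon> T \<and> (z = x \<or> (\<exists>w. actR f z w))" for z
      unfolding T'_def mem_Col[OF d] ..
    have "x \<epsilon> T'"
      using T' T(2) by (simp add: els_subset_iff)
    have "transitive T'"
      unfolding transitive_def els_subset_iff
    proof (intro conjI ballI allI impI)
      show "is_set T'"
        unfolding T'_def by (rule is_set_Col[OF d])
      show "u \<epsilon> T'" if "z \<in> els T'" "u \<epsilon> z" for z u
        using that T' transitiveD[OF T(1)] eps actR_step(1) by (metis els_iff)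
    qed
    define G where "G z = (if z = x then if x \<epsilon> A then ap f x else Img x (act' f) else act' f z)" for z
    have tG: "trm (\<lambda>e. G (e 0))" and ta: "trm (\<lambda>e. act' f (e 0))"
      unfolding G_def by (intro dfn_intros)+
    define F where "F = Lam T' G"
    have F: "ap F z = G z" if "z \<epsilon> T'" for z
      unfolding F_def by (rule ap_Lam[OF tG that])
    have "is_function F T' (Img T' G)"
      unfolding F_def by (rule is_function_Lam[OF tG]) (auto simp: mem_Img[OF tG])
    moreover have "if z \<epsilon> A then ap F z = ap f z
        else \<not> ap F z \<epsilon> A \<and> (\<forall>w. w \<epsilon> ap F z \<longleftrightarrow> (\<exists>u. u \<epsilon> z \<and> w = ap F u))" if z: "z \<epsilon> T'" for z
    proof -
      have u: "ap F u = act' f u" if "u \<epsilon> z" for u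
      proof -
        have "u \<noteq> x"
        proof
          assume "u = x"
          then have "z \<noteq> x" using that by auto
          then show False
            using z T' x actR_step(1) that \<open>u = x\<close> by blast
        qed
        then show ?thesis
          using F[OF transitiveD[OF \<open>transitive T'\<close> z that]] unfolding G_def by simp
      qed
      then have eq: "(\<exists>u. u \<epsilon> z \<and> w = ap F u) \<longleftrightarrow> (\<exists>u. u \<epsilon> z \<and> w = act' f u)" for w
        by metis
      show ?thesis
      proof (cases "z = x")
        case True
        then show ?thesis
          unfolding eq using F[OF z] is_set_Img[OF ta] unfolding G_def is_set_def
          by (simp add: mem_Img[OF ta])
      next
        case False
        then obtain y where "actR f z y" using z T' by blast
        then show ?thesis
          unfolding eq using F[OF z] False actR_step(2)[of f z y] act'_eq[of f z y] unfolding G_def by simp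
      qed
    qed
    ultimately have "actR f x (ap F x)"
      unfolding actR_def using \<open>transitive T'\<close> \<open>x \<epsilon> T'\<close> by blast
    then show False using x by blast
  qed
qed (intro dfn_intros)

lemma actR_act': "actR f x (act' f x)"
  using actR_total[of f x] act'_eq by metis

text \<open>At the atoms the two recursions use \<open>app f\<close> and \<open>ap f\<close>, which
  agree when \<open>f\<close> is a function on \<open>A\<close>.\<close>

lemma act_eq_act':
  assumes "is_function f A B"
  shows "act f x = act' f x"
proof -
  have "(\<exists>T\<in>UNIV. \<exists>Y\<in>UNIV. \<exists>F\<in>UNIV. transitive T \<and> x \<in> els T \<and> is_function F T Y \<and>
        (\<forall>z \<in> els T. if z \<in> els A then app F z = app f z
           else is_set (app F z) \<and> els (app F z) = app F ` els z) \<and> y = app F x) \<longleftrightarrow> actR f x y" for y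
  proof -
    have "(transitive T \<and> x \<in> els T \<and> is_function F T Y \<and>
        (\<forall>z \<in> els T. if z \<in> els A then app F z = app f z
           else is_set (app F z) \<and> els (app F z) = app F ` els z) \<and> y = app F x) \<longleftrightarrow>
        (transitive T \<and> x \<epsilon> T \<and> is_function F T Y \<and>
        (\<forall>z. z \<epsilon> T \<longrightarrow> (if z \<epsilon> A then ap F z = ap f z
        else \<not> ap F z \<epsilon> A \<and> (\<forall>w. w \<epsilon> ap F z \<longleftrightarrow> (\<exists>u. u \<epsilon> z \<and> w = ap F u)))) \<and>
        y = ap F x)" for T Y F
    proof (cases "transitive T \<and> x \<epsilon> T \<and> is_function F T Y")
      case True
      then have F: "is_function F T Y" and T: "transitive T" and x: "x \<epsilon> T" by auto
      have "(if z \<in> els A then app F z = app f z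
           else is_set (app F z) \<and> els (app F z) = app F ` els z) \<longleftrightarrow>
         (if z \<epsilon> A then ap F z = ap f z
        else \<not> ap F z \<epsilon> A \<and> (\<forall>w. w \<epsilon> ap F z \<longleftrightarrow> (\<exists>u. u \<epsilon> z \<and> w = ap F u)))" if z: "z \<epsilon> T" for z
      proof -
        have "app F ` els z = {w. \<exists>u. u \<epsilon> z \<and> w = ap F u}"
          using app_eq_ap[OF F transitiveD[OF T z]] by (auto simp: image_iff)
        then show ?thesis
          using app_eq_ap[OF F z] app_eq_ap[OF assms, of z] by (auto simp: is_set_def els_def)
      qed
      then show ?thesis
        using True app_eq_ap[OF F x] by simp
    next
      case False
      then show ?thesis by auto
    qed
    then show ?thesis
      unfolding actR_def by simp
  qed
  then have "act f x = (THE y. y \<in> UNIV \<and> actR f x y)"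
    unfolding act_def by presburger
  also have "\<dots> = act' f x"
    using actR_act' actR_unique by (intro the_equality) auto
  finally show ?thesis .
qed

lemma act'_atom: "a \<epsilon> A \<Longrightarrow> act' f a = ap f a"
  using actR_step(2)[OF actR_act', of a f] by simp

lemma act'_set: "\<not> x \<epsilon> A \<Longrightarrow> \<not> act' f x \<epsilon> A"
  using actR_step(2)[OF actR_act', of x f] by simp

lemma mem_act'_set: "\<not> x \<epsilon> A \<Longrightarrow> w \<epsilon> act' f x \<longleftrightarrow> (\<exists>u. u \<epsilon> x \<and> w = act' f u)"
  using actR_step(2)[OF actR_act', of x f] by simp

section \<open>Permutations of the atoms inside the model\<close>

definition atom_perm :: "'m \<Rightarrow> bool" where
  "atom_perm f \<longleftrightarrow> is_function f A A \<and> (\<forall>a a'. a \<epsilon> A \<longrightarrow> a' \<epsilon> A \<longrightarrow> ap f a = ap f a' \<longrightarrow> a = a') \<and>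
     (\<forall>a. a \<epsilon> A \<longrightarrow> (\<exists>a'. a' \<epsilon> A \<and> ap f a' = a))"

lemma dfn_atom_perm [dfn_intros]: assumes "trm t" shows "dfn (\<lambda>e. atom_perm (t e))"
  unfolding atom_perm_def
  by (intro dfn_intros assms trm_lift[OF trm_lift[OF assms]])

lemma is_bijection_iff: "is_bijection f A A \<longleftrightarrow> atom_perm f"
proof -
  have "bij_betw (app f) (els A) (els A) \<longleftrightarrow> bij_betw (ap f) (els A) (els A)" if "is_function f A A"
    using app_eq_ap[OF that] by (intro bij_betw_cong) simp
  moreover have "bij_betw (ap f) (els A) (els A) \<longleftrightarrow>
     (\<forall>a a'. a \<epsilon> A \<longrightarrow> a' \<epsilon> A \<longrightarrow> ap f a = ap f a' \<longrightarrow> a = a') \<and>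
     (\<forall>a. a \<epsilon> A \<longrightarrow> (\<exists>a'. a' \<epsilon> A \<and> ap f a' = a))" if "is_function f A A"
    using ap_in[OF that] unfolding bij_betw_def inj_on_def by (auto simp: image_iff set_eq_iff) metis
  ultimately show ?thesis
    unfolding is_bijection_def atom_perm_def by blast
qed

lemma
  assumes "atom_perm f"
  shows perm_function: "is_function f A A"
    and perm_in: "a \<epsilon> A \<Longrightarrow> ap f a \<epsilon> A"
    and perm_inj: "a \<epsilon> A \<Longrightarrow> a' \<epsilon> A \<Longrightarrow> ap f a = ap f a' \<Longrightarrow> a = a'"
    and perm_surj: "a \<epsilon> A \<Longrightarrow> \<exists>a'. a' \<epsilon> A \<and> ap f a' = a"
  using assms ap_in[of f A A] unfolding atom_perm_def by blast+

lemma mem_act':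
  assumes "atom_perm f"
  shows "w \<epsilon> act' f x \<longleftrightarrow> (\<exists>u. u \<epsilon> x \<and> w = act' f u)"
proof (cases "x \<epsilon> A")
  case True
  then show ?thesis
    using act'_atom[OF True] perm_in[OF assms True] atom_empty by metis
next
  case False
  then show ?thesis by (rule mem_act'_set)
qed

lemma act'_is_atom: "atom_perm f \<Longrightarrow> act' f x \<epsilon> A \<longleftrightarrow> x \<epsilon> A"
  using act'_atom perm_in act'_set by metis

text \<open>The recursion equations determine the action, so the composition and identity laws only
  require checking them for a definable \<open>H\<close>.\<close>

lemma act'_unique:
  assumes H: "trm (\<lambda>e. H (e 0))" and "\<And>a. a \<epsilon> A \<Longrightarrow> H a = ap f a"
    and "\<And>x. \<not> x \<epsilon> A \<Longrightarrow> \<not> H x \<epsilon> A"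
    and "\<And>x w. \<not> x \<epsilon> A \<Longrightarrow> w \<epsilon> H x \<longleftrightarrow> (\<exists>u. u \<epsilon> x \<and> w = H u)"
  shows "H x = act' f x"
proof (induction x rule: eps_induct)
  case (eps x)
  show ?case
  proof (cases "x \<epsilon> A")
    case True
    then show ?thesis using assms(2) act'_atom by simp
  next
    case False
    have "w \<epsilon> H x \<longleftrightarrow> w \<epsilon> act' f x" for w
      unfolding assms(4)[OF False] mem_act'_set[OF False] using eps by metis
    then show ?thesis
      using False assms(3) act'_set by (intro set_eqI) (auto simp: is_set_def)
  qed
qed (intro dfn_intros H)

lemma act'_comp:
  assumes "atom_perm f" "atom_perm g" "\<And>a. a \<epsilon> A \<Longrightarrow> ap h a = ap f (ap g a)"
  shows "act' h x = act' f (act' g x)"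
proof (rule act'_unique[symmetric])
  show "trm (\<lambda>e. act' f (act' g (e 0)))"
    by (intro dfn_intros)
  show "act' f (act' g a) = ap h a" if "a \<epsilon> A" for a
    using that assms(3) act'_atom perm_in[OF assms(2)] by simp
  show "w \<epsilon> act' f (act' g x) \<longleftrightarrow> (\<exists>u. u \<epsilon> x \<and> w = act' f (act' g u))" for x w
    unfolding mem_act'[OF assms(1)] mem_act'[OF assms(2)] by blast
qed (use act'_set in blast)

lemma act'_id:
  assumes "\<And>a. a \<epsilon> A \<Longrightarrow> ap h a = a"
  shows "act' h x = x"
  by (rule act'_unique[symmetric]) (use assms in \<open>auto intro: dfn_intros\<close>)

definition compose_perm :: "'m \<Rightarrow> 'm \<Rightarrow> 'm" where
  "compose_perm f g = Lam A (\<lambda>a. ap f (ap g a))"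

definition inverse_perm :: "'m \<Rightarrow> 'm" where
  "inverse_perm f = Lam A (\<lambda>a. the1 (\<lambda>c. c \<epsilon> A \<and> ap f c = a))"

lemma perm_Lam:
  assumes F: "trm (\<lambda>e. F (e 0))" "\<And>a. a \<epsilon> A \<Longrightarrow> F a \<epsilon> A"
    "\<And>a c. a \<epsilon> A \<Longrightarrow> c \<epsilon> A \<Longrightarrow> F a = F c \<Longrightarrow> a = c" "\<And>a. a \<epsilon> A \<Longrightarrow> \<exists>c. c \<epsilon> A \<and> F c = a"
  shows "atom_perm (Lam A F)"
  unfolding atom_perm_def
proof (intro conjI allI impI)
  show "is_function (Lam A F) A A"
    by (rule is_function_Lam[OF F(1,2)])
  show "a = a'" if "a \<epsilon> A" "a' \<epsilon> A" "ap (Lam A F) a = ap (Lam A F) a'" for a a'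
    using that F(3) ap_Lam[OF F(1)] by simp
  show "\<exists>a'. a' \<epsilon> A \<and> ap (Lam A F) a' = a" if "a \<epsilon> A" for a
    using F(4)[OF that] ap_Lam[OF F(1)] by metis
qed

lemma ap_comp: "a \<epsilon> A \<Longrightarrow> ap (compose_perm f g) a = ap f (ap g a)"
  unfolding compose_perm_def by (rule ap_Lam) (intro dfn_intros)

lemma
  assumes "atom_perm f"
  shows ap_inverse: "a \<epsilon> A \<Longrightarrow> ap f (ap (inverse_perm f) a) = a"
    and inverse_ap: "a \<epsilon> A \<Longrightarrow> ap (inverse_perm f) (ap f a) = a"
    and inverse_in: "a \<epsilon> A \<Longrightarrow> ap (inverse_perm f) a \<epsilon> A"
    and perm_inverse: "atom_perm (inverse_perm f)"
proof -
  let ?F = "\<lambda>a. the1 (\<lambda>c. c \<epsilon> A \<and> ap f c = a)"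
  have t: "trm (\<lambda>e. ?F (e 0))"
    by (intro dfn_intros)
  have ap: "ap (inverse_perm f) a = ?F a" if "a \<epsilon> A" for a
    unfolding inverse_perm_def by (rule ap_Lam[OF t that])
  have F: "?F a \<epsilon> A \<and> ap f (?F a) = a" if "a \<epsilon> A" for a
    by (rule the1_I) (use perm_surj[OF assms that] perm_inj[OF assms] in blast)
  have F2: "?F (ap f a) = a" if "a \<epsilon> A" for a
    by (rule the1_eq) (use that perm_inj[OF assms] in blast)+
  show "a \<epsilon> A \<Longrightarrow> ap f (ap (inverse_perm f) a) = a" "a \<epsilon> A \<Longrightarrow> ap (inverse_perm f) a \<epsilon> A"
    using ap F by auto
  show "a \<epsilon> A \<Longrightarrow> ap (inverse_perm f) (ap f a) = a"
    using ap F2 perm_in[OF assms] by simp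
  show "atom_perm (inverse_perm f)"
    unfolding inverse_perm_def
    by (rule perm_Lam[OF t]) (use F F2 perm_in[OF assms] in metis)+
qed

lemma perm_comp:
  assumes "atom_perm f" "atom_perm g"
  shows "atom_perm (compose_perm f g)"
  unfolding compose_perm_def
proof (rule perm_Lam)
  show "trm (\<lambda>e. ap f (ap g (e 0)))"
    by (intro dfn_intros)
  show "\<exists>c. c \<epsilon> A \<and> ap f (ap g c) = a" if "a \<epsilon> A" for a
    using perm_surj[OF assms(1) that] perm_surj[OF assms(2)] by blast
  show "ap f (ap g a) \<epsilon> A" if "a \<epsilon> A" for a
    using perm_in[OF assms(1)] perm_in[OF assms(2)] that by blast
  show "a = c" if "a \<epsilon> A" "c \<epsilon> A" "ap f (ap g a) = ap f (ap g c)" for a c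
    using that perm_inj[OF assms(1)] perm_inj[OF assms(2)] perm_in[OF assms(2)] by blast
qed

lemma act'_comp': "atom_perm f \<Longrightarrow> atom_perm g \<Longrightarrow> act' (compose_perm f g) x = act' f (act' g x)"
  using act'_comp ap_comp by blast

lemma act'_inverse: "atom_perm f \<Longrightarrow> act' (inverse_perm f) (act' f x) = x"
  using act'_comp[of "inverse_perm f" f "compose_perm (inverse_perm f) f" x] act'_id[of "compose_perm (inverse_perm f) f" x]
    ap_comp perm_inverse inverse_ap by simp

lemma act'_inverse2: "atom_perm f \<Longrightarrow> act' f (act' (inverse_perm f) x) = x"
  using act'_comp[of f "inverse_perm f" "compose_perm f (inverse_perm f)" x] act'_id[of "compose_perm f (inverse_perm f)" x]
    ap_comp perm_inverse ap_inverse by simp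

lemma act'_inj: "atom_perm f \<Longrightarrow> act' f x = act' f y \<Longrightarrow> x = y"
  using act'_inverse by metis

lemma mem_act'_iff: "atom_perm f \<Longrightarrow> act' f x \<epsilon> act' f y \<longleftrightarrow> x \<epsilon> y"
  using mem_act' act'_inj by blast

lemma act'_upair:
  assumes "atom_perm f"
  shows "act' f (upair x y) = upair (act' f x) (act' f y)"
proof (rule set_eqI)
  show "is_set (act' f (upair x y))"
    using act'_is_atom[OF assms] is_set_upair unfolding is_set_def by simp
qed (auto simp: mem_act'[OF assms])

lemma act'_opair: "atom_perm f \<Longrightarrow> act' f (opair x y) = opair (act' f x) (act' f y)"
  unfolding opair_def by (simp add: act'_upair)

lemma act'_fix:
  assumes "atom_perm f" "is_set x" "\<And>u. u \<epsilon> x \<Longrightarrow> act' f u = u"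
  shows "act' f x = x"
proof (rule set_eqI)
  show "is_set (act' f x)"
    using act'_is_atom[OF assms(1)] assms(2) unfolding is_set_def by simp
  show "z \<epsilon> act' f x \<longleftrightarrow> z \<epsilon> x" for z
    unfolding mem_act'[OF assms(1)] using assms(3) by metis
qed (rule assms(2))

lemma act'_nat:
  assumes "atom_perm f" "n \<epsilon> omega"
  shows "act' f n = n"
proof -
  have "n \<epsilon> omega \<longrightarrow> act' f n = n"
  proof (induction n rule: eps_induct)
    case (eps n)
    show ?case
    proof
      assume n: "n \<epsilon> omega"
      then have "is_set n"
        using zero_mem[OF n] zero_props(1) is_setI by blast
      then show "act' f n = n"
      proof (rule act'_fix[OF assms(1)])
        show "act' f u = u" if "u \<epsilon> n" for u
          using eps[OF that] omega_trans[OF n that] by blast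
      qed
    qed
  qed (intro dfn_intros)
  then show ?thesis using assms(2) by blast
qed

lemma act'_omega: "atom_perm f \<Longrightarrow> act' f omega = omega"
  by (rule act'_fix[OF _ is_setI[OF zero_omega] act'_nat])

section \<open>Transitive closures\<close>

lemma trans_closure_iff: "y \<in> trans_closure x \<longleftrightarrow> (\<forall>T. transitive T \<and> els x \<subseteq> els T \<longrightarrow> y \<epsilon> T)"
  unfolding trans_closure_def by simp

lemma trans_closure_base: "y \<epsilon> x \<Longrightarrow> y \<in> trans_closure x"
  unfolding trans_closure_iff els_subset_iff by blast

lemma trans_closure_step: "z \<epsilon> y \<Longrightarrow> y \<in> trans_closure x \<Longrightarrow> z \<in> trans_closure x"
  unfolding trans_closure_iff using transitiveD by blast

lemma trans_closure_mono: "y \<epsilon> x \<Longrightarrow> z \<in> trans_closure y \<Longrightarrow> z \<in> trans_closure x"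
  unfolding trans_closure_iff els_subset_iff using transitiveD by blast

text \<open>The elements of \<open>x\<close> together with their transitive closures, cut out of a
  transitive set, again form a transitive set that includes \<open>x\<close>.\<close>

lemma trans_closure_cases:
  assumes "z \<in> trans_closure x"
  shows "z \<epsilon> x \<or> (\<exists>y. y \<epsilon> x \<and> z \<in> trans_closure y)"
proof -
  obtain T where T: "transitive T" "els x \<subseteq> els T"
    using transitive_superset by blast
  define P where "P w \<longleftrightarrow> w \<epsilon> x \<or> (\<exists>y. y \<epsilon> x \<and> w \<in> trans_closure y)" for w
  have P: "dfn (\<lambda>e. P (e 0))"
    unfolding P_def trans_closure_iff by (intro dfn_intros)
  have "P u" if "P w" "u \<epsilon> w" for u w
    using that trans_closure_base trans_closure_step unfolding P_def by blast
  then have "transitive (Col T P)"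
    using T(1) unfolding transitive_def els_subset_iff by (simp add: mem_Col[OF P] is_set_Col[OF P]) blast
  moreover have "els x \<subseteq> els (Col T P)"
    using T(2) unfolding els_subset_iff by (simp add: mem_Col[OF P] P_def)
  ultimately have "z \<epsilon> Col T P"
    using assms unfolding trans_closure_iff[of z x] by blast
  then show ?thesis
    unfolding mem_Col[OF P] P_def by blast
qed

end


section \<open>Atoms as sequences\<close>

sublocale N9_setting \<subseteq> zfa mem A
  by unfold_locales (rule ZFA_AC)

context N9_setting
begin

lemma leq_trans: "k \<epsilon> omega \<Longrightarrow> leq m n \<Longrightarrow> leq n k \<Longrightarrow> leq m k"
  unfolding leq_def using nat_trans by blast

lemma leq_cases: "m \<epsilon> omega \<Longrightarrow> n \<epsilon> omega \<Longrightarrow> leq m n \<or> n \<epsilon> m"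
  unfolding leq_def using trichotomy by blast

lemma not_leq: "n \<epsilon> m \<Longrightarrow> \<not> leq m n"
  unfolding leq_def using mem_asym by auto

lemma upper_bound:
  assumes "m \<epsilon> omega" "n \<epsilon> omega"
  obtains k where "k \<epsilon> omega" "leq m k" "leq n k"
  using leq_cases[OF assms] assms unfolding leq_def by blast

lemma dfn_leq [dfn_intros]: "trm s \<Longrightarrow> trm t \<Longrightarrow> dfn (\<lambda>e. leq (s e) (t e))"
  unfolding leq_def by (intro dfn_intros)

text \<open>Total and definable counterpart of \<open>coord\<close>, in the same way as
  \<open>ap\<close> is one of \<open>app\<close>.\<close>

definition co :: "'m \<Rightarrow> 'm \<Rightarrow> 'm" where
  "co a j = ap (ap b a) j"

lemma trm_co [dfn_intros]: "trm s \<Longrightarrow> trm t \<Longrightarrow> trm (\<lambda>e. co (s e) (t e))"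
  unfolding co_def by (intro dfn_intros)

lemma sequences:
  obtains S where "is_set S" "\<And>s. s \<epsilon> S \<longleftrightarrow> fin_seq s" "is_function b A S" "bij_betw (ap b) (els A) (els S)"
proof -
  obtain S where S: "is_set S" "els S = {s \<in> UNIV. fin_seq s}" "is_bijection b A S"
    using identifies_atoms unfolding identifies_atoms_def by blast
  then have f: "is_function b A S"
    unfolding is_bijection_def by blast
  have "bij_betw (app b) (els A) (els S) = bij_betw (ap b) (els A) (els S)"
    by (rule bij_betw_cong) (simp add: app_eq_ap[OF f])
  then have "bij_betw (ap b) (els A) (els S)"
    using S(3) unfolding is_bijection_def by blast
  moreover have "s \<epsilon> S \<longleftrightarrow> fin_seq s" for s
    using S(2) by (simp add: set_eq_iff)
  ultimately show thesis
    using that S(1) f by blast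
qed

lemma seq_fin_seq:
  assumes "a \<epsilon> A"
  shows "fin_seq (ap b a)"
proof -
  obtain S where "\<And>s. s \<epsilon> S \<longleftrightarrow> fin_seq s" "is_function b A S"
    using sequences by metis
  then show ?thesis using ap_in assms by metis
qed

lemma seq_function: "a \<epsilon> A \<Longrightarrow> is_function (ap b a) omega omega"
  using seq_fin_seq unfolding fin_seq_def by blast

lemma coord_eq: 
  assumes "a \<epsilon> A" "j \<epsilon> omega"
  shows "coord a j = co a j"
proof -
  obtain S where "is_function b A S"
    using sequences by metis
  then show ?thesis
    unfolding coord_def co_def using app_eq_ap assms seq_function by metis
qed

lemma co_omega: "a \<epsilon> A \<Longrightarrow> j \<epsilon> omega \<Longrightarrow> co a j \<epsilon> omega"
  unfolding co_def using ap_in[OF seq_function] by blast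

lemma co_bounded:
  assumes "a \<epsilon> A"
  obtains n where "n \<epsilon> omega" "\<And>j. j \<epsilon> omega \<Longrightarrow> n \<epsilon> j \<Longrightarrow> co a j = zero"
proof -
  obtain n where "n \<epsilon> omega" "\<And>j. j \<epsilon> omega \<Longrightarrow> n \<epsilon> j \<Longrightarrow> app (ap b a) j = zero"
    using seq_fin_seq[OF assms] unfolding fin_seq_def by auto
  then show thesis
    using that app_eq_ap[OF seq_function[OF assms]] unfolding co_def by metis
qed

lemma atom_eqI:
  assumes "a \<epsilon> A" "c \<epsilon> A" "\<And>j. j \<epsilon> omega \<Longrightarrow> co a j = co c j"
  shows "a = c"
proof -
  obtain S where "bij_betw (ap b) (els A) (els S)"
    using sequences by metis
  moreover have "ap b a = ap b c"
    using assms(3) unfolding co_def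
    by (rule function_eqI[OF seq_function[OF assms(1)] seq_function[OF assms(2)]])
  ultimately show ?thesis
    using assms(1,2) unfolding bij_betw_def inj_on_def by simp
qed

text \<open>Surjectivity of \<open>b\<close>; it is the source of the atoms \<open>splice\<close>
  and \<open>unit_atom\<close>.\<close>

lemma atom_exists:
  assumes F: "trm (\<lambda>e. F (e 0))" "\<And>j. j \<epsilon> omega \<Longrightarrow> F j \<epsilon> omega"
    and n: "n \<epsilon> omega" "\<And>j. j \<epsilon> omega \<Longrightarrow> n \<epsilon> j \<Longrightarrow> F j = zero"
  shows "\<exists>a. a \<epsilon> A \<and> (\<forall>j. j \<epsilon> omega \<longrightarrow> co a j = F j)"
proof -
  obtain S where S: "\<And>s. s \<epsilon> S \<longleftrightarrow> fin_seq s" "bij_betw (ap b) (els A) (els S)"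
    using sequences by metis
  define s where "s = Lam omega F"
  have "fin_seq s"
    unfolding fin_seq_def s_def using F n by (auto simp: is_function_Lam app_Lam[OF F(1)])
  then have "s \<in> els S"
    using S by simp
  then have "s \<in> ap b ` els A"
    using S(2) unfolding bij_betw_def by simp
  then obtain a where "a \<epsilon> A" "s = ap b a"
    by auto
  then show ?thesis
    unfolding co_def by (intro exI[of _ a]) (metis s_def ap_Lam[OF F(1)])
qed

text \<open>For atoms \<open>agree n\<close> means having the same \<open>n\<close>-location and
  \<open>tail_eq n\<close> lying in the same \<open>n\<close>-block; unlike \<open>location\<close>
  and \<open>block\<close> these are definable relations.\<close>

definition agree :: "'m \<Rightarrow> 'm \<Rightarrow> 'm \<Rightarrow> bool" where
  "agree n s t \<longleftrightarrow> (\<forall>j. j \<epsilon> n \<longrightarrow> co s j = co t j)"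

definition tail_eq :: "'m \<Rightarrow> 'm \<Rightarrow> 'm \<Rightarrow> bool" where
  "tail_eq n s t \<longleftrightarrow> (\<forall>j. j \<epsilon> omega \<longrightarrow> leq n j \<longrightarrow> co s j = co t j)"

lemma dfn_agree [dfn_intros]:
  assumes "trm n" "trm s" "trm t" shows "dfn (\<lambda>e. agree (n e) (s e) (t e))"
  unfolding agree_def
  by (intro dfn_intros trm_lift[OF assms(1)] trm_lift[OF assms(2)] trm_lift[OF assms(3)])

lemma dfn_tail_eq [dfn_intros]:
  assumes "trm n" "trm s" "trm t" shows "dfn (\<lambda>e. tail_eq (n e) (s e) (t e))"
  unfolding tail_eq_def
  by (intro dfn_intros trm_lift[OF assms(1)] trm_lift[OF assms(2)] trm_lift[OF assms(3)])

lemma tail_eq_refl [simp]: "tail_eq n s s"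
  unfolding tail_eq_def by simp

lemma tail_eq_sym: "tail_eq n s t \<Longrightarrow> tail_eq n t s"
  unfolding tail_eq_def by simp

lemma tail_eq_trans: "tail_eq n s t \<Longrightarrow> tail_eq n t u \<Longrightarrow> tail_eq n s u"
  unfolding tail_eq_def by simp

lemma tail_eq_mono: "m \<epsilon> omega \<Longrightarrow> leq n m \<Longrightarrow> tail_eq n s t \<Longrightarrow> tail_eq m s t"
  unfolding tail_eq_def using leq_trans by blast

lemma agree_refl [simp]: "agree n s s"
  unfolding agree_def by simp

lemma agree_sym: "agree n s t \<Longrightarrow> agree n t s"
  unfolding agree_def by simp

lemma agree_trans: "agree n s t \<Longrightarrow> agree n t u \<Longrightarrow> agree n s u"
  unfolding agree_def by simp

lemma agree_mono: "m \<epsilon> omega \<Longrightarrow> leq n m \<Longrightarrow> agree m s t \<Longrightarrow> agree n s t"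
  unfolding agree_def leq_def using nat_trans by blast

lemma agree_tail_eqI:
  assumes "n \<epsilon> omega" "s \<epsilon> A" "t \<epsilon> A" "agree n s t" "tail_eq n s t"
  shows "s = t"
proof (rule atom_eqI[OF assms(2,3)])
  show "co s j = co t j" if "j \<epsilon> omega" for j
    using leq_cases[OF assms(1) that] assms(4,5) that unfolding agree_def tail_eq_def by blast
qed

text \<open>An atom amounts to an \<open>n\<close>-location together with an \<open>n\<close>-block.
  \<open>splice\<close> is the pairing: the location of \<open>a\<close> in the block of
  \<open>c\<close>.\<close>

definition splice :: "'m \<Rightarrow> 'm \<Rightarrow> 'm \<Rightarrow> 'm" where
  "splice n a c = the1 (\<lambda>t. t \<epsilon> A \<and> agree n t a \<and> tail_eq n t c)"

lemma trm_splice [dfn_intros]: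
  assumes "trm n" "trm s" "trm t" shows "trm (\<lambda>e. splice (n e) (s e) (t e))"
  unfolding splice_def
  by (intro dfn_intros trm_lift[OF assms(1)] trm_lift[OF assms(2)] trm_lift[OF assms(3)])

lemma splice:
  assumes "n \<epsilon> omega" "a \<epsilon> A" "c \<epsilon> A"
  shows splice_in [simp]: "splice n a c \<epsilon> A"
    and splice_agree [simp]: "agree n (splice n a c) a"
    and splice_tail_eq [simp]: "tail_eq n (splice n a c) c"
proof -
  define F where "F j = (if j \<epsilon> n then co a j else co c j)" for j
  have F: "trm (\<lambda>e. F (e 0))"
    unfolding F_def by (intro dfn_intros)
  have F_omega: "F j \<epsilon> omega" if "j \<epsilon> omega" for j
    using that assms co_omega unfolding F_def by simp
  obtain m where m: "m \<epsilon> omega" "\<And>j. j \<epsilon> omega \<Longrightarrow> m \<epsilon> j \<Longrightarrow> co c j = zero"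
    using co_bounded[OF assms(3)] by blast
  obtain k where k: "k \<epsilon> omega" "leq m k" "leq n k"
    using upper_bound[OF m(1) assms(1)] by blast
  have "F j = zero" if "j \<epsilon> omega" "k \<epsilon> j" for j
  proof -
    have "n \<epsilon> j" "m \<epsilon> j"
      using that k nat_trans unfolding leq_def by blast+
    then show ?thesis
      unfolding F_def using m(2)[OF that(1)] mem_asym by auto
  qed
  from atom_exists[of F, OF F F_omega k(1) this]
  obtain t where t: "t \<epsilon> A" "\<And>j. j \<epsilon> omega \<Longrightarrow> co t j = F j"
    by blast
  have t2: "agree n t a" "tail_eq n t c"
    using t(2) omega_trans[OF assms(1)] not_leq unfolding agree_def tail_eq_def F_def by simp_all
  have "splice n a c = t"
    unfolding splice_def
  proof (rule the1_eq)
    show "u = t" if "u \<epsilon> A \<and> agree n u a \<and> tail_eq n u c" for u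
      using that t t2 assms(1) by (meson agree_tail_eqI agree_sym agree_trans tail_eq_sym tail_eq_trans)
  qed (use t t2 in blast)
  then show "splice n a c \<epsilon> A" "agree n (splice n a c) a" "tail_eq n (splice n a c) c"
    using t t2 by auto
qed

lemma splice_eqI:
  assumes "n \<epsilon> omega" "a \<epsilon> A" "c \<epsilon> A" "t \<epsilon> A" "agree n t a" "tail_eq n t c"
  shows "splice n a c = t"
  using splice[OF assms(1-3)] assms
  by (meson agree_tail_eqI agree_sym agree_trans tail_eq_sym tail_eq_trans)

definition unit_atom :: "'m \<Rightarrow> 'm \<Rightarrow> 'm" where
  "unit_atom k i = the1 (\<lambda>t. t \<epsilon> A \<and> (\<forall>j. j \<epsilon> omega \<longrightarrow> co t j = (if j = k then i else zero)))"

lemma trm_unit_atom [dfn_intros]: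
  assumes "trm k" "trm i"
  shows "trm (\<lambda>e. unit_atom (k e) (i e))"
  unfolding unit_atom_def
  by (intro dfn_intros trm_lift[OF trm_lift[OF assms(1)]] trm_lift[OF trm_lift[OF assms(2)]])

lemma unit_atom:
  assumes "k \<epsilon> omega" "i \<epsilon> omega"
  shows unit_atom_in [simp]: "unit_atom k i \<epsilon> A"
    and co_unit_atom: "j \<epsilon> omega \<Longrightarrow> co (unit_atom k i) j = (if j = k then i else zero)"
proof -
  have "trm (\<lambda>e. if e 0 = k then i else zero)"
    by (intro dfn_intros)
  moreover have "(if j = k then i else zero) = zero" if "k \<epsilon> j" for j
    using that by auto
  moreover have "(if j = k then i else zero) \<epsilon> omega" for j
    using assms by simp
  ultimately obtain t where t: "t \<epsilon> A" "\<And>j. j \<epsilon> omega \<Longrightarrow> co t j = (if j = k then i else zero)"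
    using atom_exists[of "\<lambda>j. if j = k then i else zero" k] assms(1) by blast
  have "unit_atom k i = t"
    unfolding unit_atom_def
  proof (rule the1_eq)
    show "u = t" if "u \<epsilon> A \<and> (\<forall>j. j \<epsilon> omega \<longrightarrow> co u j = (if j = k then i else zero))" for u
    proof (rule atom_eqI)
      show "co u j = co t j" if "j \<epsilon> omega" for j
        using \<open>u \<epsilon> A \<and> _\<close> t(2)[OF that] that by simp
    qed (use that t(1) in blast)+
  qed (use t in simp)
  then show "unit_atom k i \<epsilon> A" "j \<epsilon> omega \<Longrightarrow> co (unit_atom k i) j = (if j = k then i else zero)"
    using t by auto
qed

lemma zero_atom: "zero_atom \<epsilon> A \<and> (\<forall>j. j \<epsilon> omega \<longrightarrow> co zero_atom j = zero)"
proof -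
  have "zero_atom = unit_atom zero zero"
    unfolding zero_atom_def
  proof (rule the_equality)
    show "unit_atom zero zero \<in> els A \<and> (\<forall>j\<in>els omega. coord (unit_atom zero zero) j = zero)"
      using unit_atom[OF zero_omega zero_omega] coord_eq by auto
    show "a = unit_atom zero zero" if "a \<in> els A \<and> (\<forall>j\<in>els omega. coord a j = zero)" for a
    proof (rule atom_eqI)
      show "co a j = co (unit_atom zero zero) j" if "j \<epsilon> omega" for j
        using \<open>a \<in> els A \<and> _\<close> that co_unit_atom[OF zero_omega zero_omega that] coord_eq[of a j] by auto
    qed (use that in auto)
  qed
  then show ?thesis
    using unit_atom[OF zero_omega zero_omega] by simp
qed

lemma zero_atom_in [simp]: "zero_atom \<epsilon> A"
  and co_zero_atom [simp]: "j \<epsilon> omega \<Longrightarrow> co zero_atom j = zero"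
  using zero_atom by auto

lemma zero_from_iff: "a \<epsilon> A \<Longrightarrow> zero_from k a \<longleftrightarrow> tail_eq k a zero_atom"
  unfolding zero_from_def tail_eq_def by (auto simp: coord_eq)

lemma atom_tail_zero:
  assumes "a \<epsilon> A"
  obtains k where "k \<epsilon> omega" "tail_eq k a zero_atom"
proof -
  obtain n where n: "n \<epsilon> omega" "\<And>j. j \<epsilon> omega \<Longrightarrow> n \<epsilon> j \<Longrightarrow> co a j = zero"
    using co_bounded[OF assms] by blast
  \<comment> \<open>\<open>fin_seq\<close> lets the coordinates vanish strictly beyond
    \<open>n\<close>, whereas \<open>tail_eq\<close> includes its bound; hence
    \<open>suc n\<close>.\<close>
  have "n \<epsilon> j" if "leq (suc n) j" "j \<epsilon> omega" for j
    using that nat_trans[of j "suc n" n] unfolding leq_def by auto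
  then have "tail_eq (suc n) a zero_atom"
    unfolding tail_eq_def using n by auto
  with suc_omega[OF n(1)] show thesis
    by (rule that)
qed

text \<open>A pseudo length of at most \<open>k\<close> means membership in \<open>A_0^k\<close>, so
  bounded sets are the sets contained in one of these blocks.\<close>

lemma pseudo_length_le:
  assumes "a \<epsilon> A" "k \<epsilon> omega"
  shows "leq (pseudo_length a) k \<longleftrightarrow> tail_eq k a zero_atom"
proof -
  obtain k0 where k0: "k0 \<epsilon> omega" "tail_eq k0 a zero_atom"
    using atom_tail_zero[OF assms(1)] by blast
  have "dfn (\<lambda>e. tail_eq (e 0) a zero_atom)"
    by (intro dfn_intros)
  from least_nat[OF this k0] obtain m where
    m: "m \<epsilon> omega" "tail_eq m a zero_atom" "\<And>i. i \<epsilon> m \<Longrightarrow> \<not> tail_eq i a zero_atom"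
    by blast
  have "pseudo_length a = m"
    unfolding pseudo_length_def
  proof (rule the_equality)
    show "m \<in> els omega \<and> zero_from m a \<and> (\<forall>k'\<in>els omega. zero_from k' a \<longrightarrow> leq m k')"
      using m leq_cases[OF m(1)] zero_from_iff[OF assms(1)] by auto
    show "n = m" if "n \<in> els omega \<and> zero_from n a \<and> (\<forall>k'\<in>els omega. zero_from k' a \<longrightarrow> leq n k')" for n
      using that m zero_from_iff[OF assms(1)] unfolding leq_def by auto
  qed
  then show ?thesis
    using m leq_cases[OF m(1) assms(2)] tail_eq_mono[OF assms(2)] by auto
qed

lemma G_iff: "f \<in> G \<longleftrightarrow> atom_perm f \<and>
    (\<exists>k. k \<epsilon> omega \<and> (\<forall>a. a \<epsilon> A \<longrightarrow> ap f a \<noteq> a \<longrightarrow> tail_eq k a zero_atom))"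
proof (cases "atom_perm f")
  case True
  then have "app f a = ap f a" if "a \<epsilon> A" for a
    using app_eq_ap[OF perm_function] that by blast
  then show ?thesis
    unfolding G_def bounded_def is_bijection_iff using pseudo_length_le by auto
next
  case False
  then show ?thesis
    unfolding G_def is_bijection_iff by simp
qed

lemma block_eq_iff:
  assumes "s \<epsilon> A" "t \<epsilon> A"
  shows "block n s = block n t \<longleftrightarrow> tail_eq n s t"
proof -
  have block: "block n s = {t. t \<epsilon> A \<and> tail_eq n t s}" if "s \<epsilon> A" for s
    using that unfolding block_def tail_eq_def by (auto simp: coord_eq)
  show ?thesis
    unfolding block[OF assms(1)] block[OF assms(2)] using assms
    by (auto simp: set_eq_iff intro: tail_eq_sym tail_eq_trans)
qed

lemma location_eq_iff:
  assumes "s \<epsilon> A" "t \<epsilon> A" "n \<epsilon> omega"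
  shows "location n s = location n t \<longleftrightarrow> agree n s t"
  using assms omega_trans[OF assms(3)]
  unfolding location_def agree_def by (auto simp: fun_eq_iff restrict_def coord_eq)

lemma Gn_iff:
  assumes "n \<epsilon> omega"
  shows "f \<in> Gn n \<longleftrightarrow> f \<in> G \<and> (\<forall>a. a \<epsilon> A \<longrightarrow> tail_eq n a zero_atom \<longrightarrow> ap f a = a) \<and>
    (\<forall>s t. s \<epsilon> A \<longrightarrow> t \<epsilon> A \<longrightarrow> (tail_eq n s t \<longleftrightarrow> tail_eq n (ap f s) (ap f t))) \<and>
    (\<forall>s. s \<epsilon> A \<longrightarrow> agree n (ap f s) s)"
proof (cases "f \<in> G")
  case True
  then have f: "atom_perm f"
    unfolding G_iff by blast
  then have app: "app f a = ap f a" if "a \<epsilon> A" for a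
    using app_eq_ap[OF perm_function] that by blast
  have "a \<in> block n zero_atom \<longleftrightarrow> a \<epsilon> A \<and> tail_eq n a zero_atom" for a
    unfolding block_def tail_eq_def by (auto simp: coord_eq)
  then show ?thesis
    unfolding Gn_def using True app perm_in[OF f] assms
    by (auto simp: block_eq_iff location_eq_iff)
next
  case False
  then show ?thesis unfolding Gn_def by simp
qed

lemma dfn_G [dfn_intros]: assumes "trm t" shows "dfn (\<lambda>e. t e \<in> G)"
  unfolding G_iff by (intro dfn_intros assms trm_lift[OF trm_lift[OF assms]])

lemma Gn_sub_G: "f \<in> Gn n \<Longrightarrow> f \<in> G"
  unfolding Gn_def by blast

lemma G_perm: "f \<in> G \<Longrightarrow> atom_perm f"
  unfolding G_iff by blast

text \<open>The tail from \<open>n\<close> on consists of the tail from \<open>m\<close> on and of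
  coordinates below \<open>m\<close>, and members of \<open>Gn m\<close> leave the latter
  unchanged.\<close>

lemma Gn_mono:
  assumes "n \<epsilon> omega" "m \<epsilon> omega" "leq n m" "f \<in> Gn m"
  shows "f \<in> Gn n"
proof -
  note f = assms(4)[unfolded Gn_iff[OF assms(2)]]
  have in_A: "ap f s \<epsilon> A" if "s \<epsilon> A" for s
    using perm_in G_perm f that by blast
  have split: "tail_eq n s t \<longleftrightarrow> tail_eq m s t \<and> (\<forall>j. j \<epsilon> m \<longrightarrow> leq n j \<longrightarrow> co s j = co t j)" for s t
  proof
    assume "tail_eq n s t"
    then show "tail_eq m s t \<and> (\<forall>j. j \<epsilon> m \<longrightarrow> leq n j \<longrightarrow> co s j = co t j)"
      using tail_eq_mono[OF assms(2,3)] omega_trans[OF assms(2)] unfolding tail_eq_def by blast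
  next
    assume *: "tail_eq m s t \<and> (\<forall>j. j \<epsilon> m \<longrightarrow> leq n j \<longrightarrow> co s j = co t j)"
    show "tail_eq n s t"
      unfolding tail_eq_def
    proof (intro allI impI)
      show "co s j = co t j" if "j \<epsilon> omega" "leq n j" for j
        using leq_cases[OF assms(2) that(1)] * that unfolding tail_eq_def by blast
    qed
  qed
  show ?thesis
    unfolding Gn_iff[OF assms(1)]
  proof (intro conjI allI impI)
    show "ap f a = a" if "a \<epsilon> A" "tail_eq n a zero_atom" for a
      using f that tail_eq_mono[OF assms(2,3)] by blast
    show "agree n (ap f s) s" if "s \<epsilon> A" for s
      using f that agree_mono[OF assms(2,3)] by blast
    show "tail_eq n s t \<longleftrightarrow> tail_eq n (ap f s) (ap f t)" if "s \<epsilon> A" "t \<epsilon> A" for s t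
    proof -
      have "co (ap f s) j = co s j" "co (ap f t) j = co t j" if "j \<epsilon> m" for j
        using f \<open>s \<epsilon> A\<close> \<open>t \<epsilon> A\<close> that unfolding agree_def by blast+
      moreover have "tail_eq m s t \<longleftrightarrow> tail_eq m (ap f s) (ap f t)"
        using f that by blast
      ultimately show ?thesis
        unfolding split by simp
    qed
  qed (use f in blast)
qed

section \<open>Hereditarily symmetric elements\<close>

lemma G_comp:
  assumes "f \<in> G" "g \<in> G"
  shows "compose_perm f g \<in> G"
proof -
  obtain k where k: "k \<epsilon> omega" "\<And>a. a \<epsilon> A \<Longrightarrow> ap f a \<noteq> a \<Longrightarrow> tail_eq k a zero_atom"
    using assms(1) unfolding G_iff by blast
  obtain m where m: "m \<epsilon> omega" "\<And>a. a \<epsilon> A \<Longrightarrow> ap g a \<noteq> a \<Longrightarrow> tail_eq m a zero_atom"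
    using assms(2) unfolding G_iff by blast
  obtain l where l: "l \<epsilon> omega" "leq k l" "leq m l"
    using upper_bound[OF k(1) m(1)] by blast
  have "tail_eq l a zero_atom" if "a \<epsilon> A" "ap (compose_perm f g) a \<noteq> a" for a
  proof (cases "ap g a = a")
    case True
    then show ?thesis
      using that ap_comp k(2) tail_eq_mono[OF l(1,2)] by simp
  next
    case False
    then show ?thesis
      using that m(2) tail_eq_mono[OF l(1,3)] by blast
  qed
  then show ?thesis
    using l(1) perm_comp[OF G_perm G_perm] assms unfolding G_iff by blast
qed

lemma G_inverse:
  assumes "f \<in> G"
  shows "inverse_perm f \<in> G"
proof -
  note p = G_perm[OF assms]
  have "ap f a \<noteq> a" if "a \<epsilon> A" "ap (inverse_perm f) a \<noteq> a" for a
    using that inverse_ap[OF p] by metis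
  then show ?thesis
    using assms perm_inverse[OF p] unfolding G_iff by blast
qed

lemma identity_G: "Lam A (\<lambda>a. a) \<in> G"
proof -
  have t: "trm (\<lambda>e. e 0)"
    by (intro dfn_intros)
  have "atom_perm (Lam A (\<lambda>a. a))"
    by (rule perm_Lam[OF t]) auto
  then show ?thesis
    unfolding G_iff using ap_Lam[OF t] zero_omega by blast
qed

lemma Gn_comp:
  assumes n: "n \<epsilon> omega" and f: "f \<in> Gn n" and g: "g \<in> Gn n"
  shows "compose_perm f g \<in> Gn n"
proof -
  note f' = f[unfolded Gn_iff[OF n]] and g' = g[unfolded Gn_iff[OF n]]
  have in_A: "a \<epsilon> A \<Longrightarrow> ap g a \<epsilon> A" for a
    using perm_in G_perm g' by blast
  show ?thesis
    unfolding Gn_iff[OF n]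
  proof (intro conjI allI impI)
    show "compose_perm f g \<in> G"
      using f' g' G_comp by blast
    show "ap (compose_perm f g) a = a" if "a \<epsilon> A" "tail_eq n a zero_atom" for a
    proof -
      have "ap g a = a" "ap f a = a"
        using f' g' that by blast+
      then show ?thesis using that ap_comp by simp
    qed
    show "tail_eq n s t \<longleftrightarrow> tail_eq n (ap (compose_perm f g) s) (ap (compose_perm f g) t)" if "s \<epsilon> A" "t \<epsilon> A" for s t
    proof -
      have "tail_eq n s t \<longleftrightarrow> tail_eq n (ap g s) (ap g t)"
        using g' that by blast
      also have "\<dots> \<longleftrightarrow> tail_eq n (ap f (ap g s)) (ap f (ap g t))"
        using f' in_A that by blast
      finally show ?thesis using ap_comp that by simp
    qed
    show "agree n (ap (compose_perm f g) s) s" if "s \<epsilon> A" for s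
    proof -
      have "agree n (ap f (ap g s)) (ap g s)" "agree n (ap g s) s"
        using f' g' in_A that by blast+
      then show ?thesis
        using agree_trans ap_comp that by simp
    qed
  qed
qed

lemma Gn_inverse:
  assumes n: "n \<epsilon> omega" and f: "f \<in> Gn n"
  shows "inverse_perm f \<in> Gn n"
proof -
  note f' = f[unfolded Gn_iff[OF n]]
  have p: "atom_perm f"
    using G_perm f' by blast
  show ?thesis
    unfolding Gn_iff[OF n]
  proof (intro conjI allI impI)
    show "inverse_perm f \<in> G"
      using f' G_inverse by blast
    show "ap (inverse_perm f) a = a" if "a \<epsilon> A" "tail_eq n a zero_atom" for a
    proof -
      have "ap f a = a"
        using f' that by blast
      then show ?thesis using inverse_ap[OF p that(1)] by simp
    qed
    show "tail_eq n s t \<longleftrightarrow> tail_eq n (ap (inverse_perm f) s) (ap (inverse_perm f) t)" if "s \<epsilon> A" "t \<epsilon> A" for s t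
    proof -
      have "tail_eq n (ap (inverse_perm f) s) (ap (inverse_perm f) t) \<longleftrightarrow>
          tail_eq n (ap f (ap (inverse_perm f) s)) (ap f (ap (inverse_perm f) t))"
        using f' inverse_in[OF p] that by blast
      then show ?thesis using ap_inverse[OF p] that by simp
    qed
    show "agree n (ap (inverse_perm f) s) s" if "s \<epsilon> A" for s
    proof -
      have "agree n (ap f (ap (inverse_perm f) s)) (ap (inverse_perm f) s)"
        using f' inverse_in[OF p that] by blast
      then show ?thesis
        using ap_inverse[OF p that] agree_sym by simp
    qed
  qed
qed

definition supports :: "'m \<Rightarrow> 'm \<Rightarrow> bool" where
  "supports n x \<longleftrightarrow> n \<epsilon> omega \<and> (\<forall>f\<in>Gn n. act' f x = x)"

lemma supports_mono: "supports n x \<Longrightarrow> m \<epsilon> omega \<Longrightarrow> leq n m \<Longrightarrow> supports m x"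
  unfolding supports_def using Gn_mono by blast

lemma common_support:
  assumes "supports n x" "supports m y"
  obtains k where "supports k x" "supports k y"
proof -
  have "n \<epsilon> omega" "m \<epsilon> omega"
    using assms unfolding supports_def by auto
  then obtain k where "k \<epsilon> omega" "leq n k" "leq m k"
    by (rule upper_bound)
  with assms show thesis
    using that supports_mono by blast
qed

lemma Gn_perm: "f \<in> Gn n \<Longrightarrow> atom_perm f"
  using Gn_sub_G G_perm by blast

text \<open>Invariance in one direction is enough, because \<open>Gn n\<close> is closed under
  inverses.\<close>

lemma supports_setI:
  assumes "n \<epsilon> omega" "is_set x" "\<And>f u. f \<in> Gn n \<Longrightarrow> u \<epsilon> x \<Longrightarrow> act' f u \<epsilon> x"
  shows "supports n x"
  unfolding supports_def
proof (intro conjI ballI)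
  fix f assume f: "f \<in> Gn n"
  note p = Gn_perm[OF f]
  show "act' f x = x"
  proof (rule set_eqI)
    show "is_set (act' f x)"
      using act'_is_atom[OF p] assms(2) unfolding is_set_def by simp
    show "z \<epsilon> act' f x \<longleftrightarrow> z \<epsilon> x" for z
    proof
      assume "z \<epsilon> act' f x"
      then show "z \<epsilon> x"
        unfolding mem_act'[OF p] using assms(3)[OF f] by blast
    next
      assume "z \<epsilon> x"
      then have "act' (inverse_perm f) z \<epsilon> x"
        using assms(3) Gn_inverse[OF assms(1) f] by blast
      then show "z \<epsilon> act' f x"
        unfolding mem_act'[OF p] using act'_inverse2[OF p] by metis
    qed
  qed (rule assms(2))
qed (rule assms(1))

lemma Sym_eq: "Sym G x = {f \<in> G. act' f x = x}"
  unfolding Sym_def using act_eq_act'[OF perm_function[OF G_perm]] by auto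

lemma perm_eq: "atom_perm f \<Longrightarrow> perm f = restrict (ap f) (els A)"
  unfolding perm_def using app_eq_ap[OF perm_function] by (intro restrict_ext) simp

lemma perm_Bij:
  assumes "atom_perm f"
  shows "perm f \<in> Bij (els A)"
proof -
  have "bij_betw (ap f) (els A) (els A)"
    using perm_in[OF assms] perm_inj[OF assms] perm_surj[OF assms]
    unfolding bij_betw_def inj_on_def by (auto simp: image_iff) metis
  then show ?thesis
    unfolding Bij_def perm_eq[OF assms] by (simp add: bij_betw_restrict_eq)
qed

text \<open>\<open>\<Gamma>\<close> refers to actual permutations of \<open>els A\<close>; the
  products and inverses of \<open>BijGroup\<close> are therefore matched with
  \<open>compose_perm\<close> and \<open>inverse_perm\<close>.\<close>

lemma subgroup_Sym: "subgroup (perm ` Sym G x) (BijGroup (els A))"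
proof -
  interpret group "BijGroup (els A)"
    by (rule group_BijGroup)
  have mult: "perm f \<otimes>\<^bsub>BijGroup (els A)\<^esub> perm g = perm (compose_perm f g)" if "atom_perm f" "atom_perm g" for f g
  proof -
    have "perm f \<otimes>\<^bsub>BijGroup (els A)\<^esub> perm g = compose (els A) (perm f) (perm g)"
      using perm_Bij that by (simp add: BijGroup_def)
    also have "\<dots> = perm (compose_perm f g)"
      unfolding perm_eq[OF that(1)] perm_eq[OF that(2)] perm_eq[OF perm_comp[OF that]]
      using perm_in[OF that(2)] by (simp add: compose_def restrict_def fun_eq_iff ap_comp)
    finally show ?thesis .
  qed
  have one: "perm f = \<one>\<^bsub>BijGroup (els A)\<^esub>" if "atom_perm f" "\<And>a. a \<epsilon> A \<Longrightarrow> ap f a = a" for f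
    unfolding perm_eq[OF that(1)] BijGroup_def using that(2) by (simp add: restrict_def fun_eq_iff)
  have inv: "inv\<^bsub>BijGroup (els A)\<^esub> perm f = perm (inverse_perm f)" if "atom_perm f" for f
  proof (rule inv_equality)
    have "perm (inverse_perm f) \<otimes>\<^bsub>BijGroup (els A)\<^esub> perm f = perm (compose_perm (inverse_perm f) f)"
      using mult perm_inverse that by blast
    also have "\<dots> = \<one>\<^bsub>BijGroup (els A)\<^esub>"
      using one perm_comp perm_inverse that ap_comp inverse_ap by simp
    finally show "perm (inverse_perm f) \<otimes>\<^bsub>BijGroup (els A)\<^esub> perm f = \<one>\<^bsub>BijGroup (els A)\<^esub>" .
  qed (use perm_Bij perm_inverse that in \<open>simp_all add: BijGroup_def\<close>)
  have t: "trm (\<lambda>e. e 0)"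
    by (intro dfn_intros)
  note id = identity_G ap_Lam[OF t]
  show ?thesis
  proof (rule subgroup.intro)
    show "perm ` Sym G x \<subseteq> carrier (BijGroup (els A))"
      using perm_Bij G_perm by (auto simp: Sym_eq BijGroup_def)
    show "p \<otimes>\<^bsub>BijGroup (els A)\<^esub> q \<in> perm ` Sym G x" if "p \<in> perm ` Sym G x" "q \<in> perm ` Sym G x" for p q
    proof -
      obtain f g where fg: "f \<in> G" "act' f x = x" "g \<in> G" "act' g x = x" "p = perm f" "q = perm g"
        using \<open>p \<in> perm ` Sym G x\<close> \<open>q \<in> perm ` Sym G x\<close> unfolding Sym_eq by auto
      have "compose_perm f g \<in> Sym G x"
        unfolding Sym_eq using fg G_comp act'_comp' G_perm by simp
      then show ?thesis
        unfolding fg(5,6) using mult G_perm fg(1,3) by simp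
    qed
    show "\<one>\<^bsub>BijGroup (els A)\<^esub> \<in> perm ` Sym G x"
    proof
      show "Lam A (\<lambda>a. a) \<in> Sym G x"
        unfolding Sym_eq using id act'_id by simp
      show "\<one>\<^bsub>BijGroup (els A)\<^esub> = perm (Lam A (\<lambda>a. a))"
        using one id G_perm by simp
    qed
    show "inv\<^bsub>BijGroup (els A)\<^esub> p \<in> perm ` Sym G x" if "p \<in> perm ` Sym G x" for p
    proof -
      obtain f where f: "f \<in> G" "act' f x = x" "p = perm f"
        using \<open>p \<in> perm ` Sym G x\<close> unfolding Sym_eq by auto
      have "act' (inverse_perm f) x = x"
        using act'_inverse[OF G_perm[OF f(1)], of x] f(2) by simp
      then have "inverse_perm f \<in> Sym G x"
        unfolding Sym_eq using f G_inverse by simp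
      then show ?thesis
        unfolding f(3) using inv G_perm f(1) by simp
    qed
  qed
qed

text \<open>For the converse direction the stabilizer must be an element of the model:
  \<open>G\<close> and the action are definable, and all members of \<open>G\<close> lie in the
  power set of \<open>Prod A A\<close>.\<close>

lemma Sym_in_Gamma: "(\<exists>h\<in>\<Gamma>. els h = Sym G x) \<longleftrightarrow> (\<exists>n. supports n x)"
proof
  assume "\<exists>h\<in>\<Gamma>. els h = Sym G x"
  then obtain n where "n \<epsilon> omega" "Gn n \<subseteq> Sym G x"
    unfolding \<Gamma>_def by auto
  then show "\<exists>n. supports n x"
    unfolding supports_def Sym_eq by blast
next
  assume "\<exists>n. supports n x"
  then obtain n where n: "n \<epsilon> omega" "Gn n \<subseteq> Sym G x"
    unfolding supports_def Sym_eq using Gn_sub_G by blast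
  define h where "h = Col (Power (Prod A A)) (\<lambda>f. f \<in> G \<and> act' f x = x)"
  have d: "dfn (\<lambda>e. e 0 \<in> G \<and> act' (e 0) x = x)"
    by (intro dfn_intros)
  have "f \<epsilon> Power (Prod A A)" if "f \<in> G" for f
  proof -
    note f = perm_function[OF G_perm[OF that]]
    have "p \<epsilon> Prod A A" if "p \<epsilon> f" for p
      using that ap_in[OF f] unfolding function_mem_iff[OF f] by auto
    then show ?thesis
      using function_is_set[OF f] unfolding mem_Power els_subset_iff by blast
  qed
  then have els: "els h = Sym G x"
    unfolding Sym_eq h_def by (auto simp: mem_Col[OF d] els_def)
  moreover have "h \<in> \<Gamma>"
    unfolding \<Gamma>_def using els n subgroup_Sym is_set_Col[OF d] Sym_eq unfolding h_def by auto
  ultimately show "\<exists>h\<in>\<Gamma>. els h = Sym G x"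
    by blast
qed

lemma N9_eq: "x \<in> N9 \<longleftrightarrow> (\<forall>y\<in>insert x (trans_closure x). \<exists>n. supports n y)"
  unfolding N9_def FM_def Sym_in_Gamma by simp

lemma N9_iff: "x \<in> N9 \<longleftrightarrow> (\<exists>n. supports n x) \<and> (\<forall>y. y \<epsilon> x \<longrightarrow> y \<in> N9)"
  unfolding N9_eq using trans_closure_base trans_closure_mono trans_closure_cases[of _ x] by blast

lemma N9_trans: "x \<in> N9 \<Longrightarrow> y \<epsilon> x \<Longrightarrow> y \<in> N9"
  using N9_iff by blast

lemma N9_subset: "V \<in> N9 \<Longrightarrow> els x \<subseteq> els V \<Longrightarrow> supports n x \<Longrightarrow> x \<in> N9"
  using N9_iff[of x] N9_iff[of V] unfolding els_subset_iff by blast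

lemma supports_upair: "supports n x \<Longrightarrow> supports n y \<Longrightarrow> supports n (upair x y)"
  unfolding supports_def using act'_upair Gn_perm by simp

lemma supports_opair: "supports n x \<Longrightarrow> supports n y \<Longrightarrow> supports n (opair x y)"
  unfolding opair_def by (intro supports_upair)

lemma upair_N9: "upair x y \<in> N9 \<longleftrightarrow> x \<in> N9 \<and> y \<in> N9"
proof
  assume "upair x y \<in> N9"
  then show "x \<in> N9 \<and> y \<in> N9"
    using N9_trans mem_upair by blast
next
  assume *: "x \<in> N9 \<and> y \<in> N9"
  then obtain n m where "supports n x" "supports m y"
    using N9_iff by meson
  then obtain k where "supports k x" "supports k y"
    by (rule common_support)
  then have "supports k (upair x y)"
    by (rule supports_upair)
  then show "upair x y \<in> N9"
    using * N9_iff[of "upair x y"] by auto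
qed

lemma opair_N9: "opair x y \<in> N9 \<longleftrightarrow> x \<in> N9 \<and> y \<in> N9"
  unfolding opair_def by (auto simp: upair_N9)

lemma supports_nat: "n \<epsilon> omega \<Longrightarrow> i \<epsilon> omega \<Longrightarrow> supports n i"
  unfolding supports_def using act'_nat Gn_perm by blast

lemma omega_N9: "omega \<in> N9"
proof -
  have "is_set omega"
    using is_setI[OF zero_omega] .
  then have "transitive omega"
    unfolding transitive_def els_subset_iff using omega_trans by simp
  then have "trans_closure omega \<subseteq> els omega"
    unfolding trans_closure_iff[abs_def] subset_eq by (auto simp: trans_closure_iff)
  moreover have "supports zero omega"
    unfolding supports_def using act'_omega Gn_perm zero_omega by blast
  ultimately show ?thesis
    unfolding N9_eq using supports_nat[OF zero_omega] els_iff by blast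
qed

text \<open>A common support of all arguments and values fixes every pair of the graph, hence the
  graph.\<close>

lemma function_N9:
  assumes f: "is_function f X Y" and X: "X \<in> N9" "\<And>x. x \<epsilon> X \<Longrightarrow> ap f x \<in> N9"
    and n: "n \<epsilon> omega" "\<And>x. x \<epsilon> X \<Longrightarrow> supports n x" "\<And>x. x \<epsilon> X \<Longrightarrow> supports n (ap f x)"
  shows "f \<in> N9"
proof -
  have "supports n f"
  proof (rule supports_setI[OF n(1) function_is_set[OF f]])
    fix g u assume g: "g \<in> Gn n" and u: "u \<epsilon> f"
    then obtain x where x: "x \<epsilon> X" "u = opair x (ap f x)"
      unfolding function_mem_iff[OF f] by blast
    then have "supports n u"
      using supports_opair n(2,3) by blast
    then show "act' g u \<epsilon> f"
      using g u unfolding supports_def by simp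
  qed
  moreover have "p \<in> N9" if "p \<epsilon> f" for p
    using that X N9_trans opair_N9 unfolding function_mem_iff[OF f] by blast
  ultimately show ?thesis
    using N9_iff by blast
qed

section \<open>Absoluteness between the ground model and \<open>N9\<close>\<close>

interpretation n9: eps_structure N9 mem A .

text \<open>\<open>N9\<close> is a transitive class, so sets keep all their elements, and the
  bounded notions below are absolute. Countability is different: the injection itself has to lie in
  \<open>N9\<close>.\<close>

lemma n9_els: "x \<in> N9 \<Longrightarrow> n9.els x = els x"
  unfolding n9.els_def els_def using N9_trans by auto

lemma n9_is_opair:
  assumes "p \<in> N9"
  shows "n9.is_opair p x y \<longleftrightarrow> p = opair x y"
proof
  assume "n9.is_opair p x y"
  then show "p = opair x y"
    unfolding is_opair_iff[symmetric] n9.is_opair_def is_opair_def using n9_els assms by auto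
next
  assume p: "p = opair x y"
  then have "upair x x \<in> N9" "upair x y \<in> N9"
    using assms unfolding opair_def by (auto simp: upair_N9)
  then show "n9.is_opair p x y"
    unfolding n9.is_opair_def using n9_els assms p by (metis els_upair insert_absorb2 opair_def)
qed

lemma n9_maps_to:
  assumes "f \<in> N9"
  shows "n9.maps_to f x y \<longleftrightarrow> maps_to f x y"
  unfolding n9.maps_to_def maps_to_def n9_els[OF assms]
  using n9_is_opair N9_trans[OF assms] by auto

lemma n9_app:
  assumes "f \<in> N9"
  shows "n9.app f x = app f x"
proof -
  have "y \<in> N9 \<and> maps_to f x y \<longleftrightarrow> y \<in> UNIV \<and> maps_to f x y" for y
    using assms N9_trans opair_N9 by auto
  then show ?thesis
    unfolding n9.app_def app_def n9_maps_to[OF assms] by simp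
qed

lemma n9_is_function:
  assumes "f \<in> N9" "X \<in> N9" "Y \<in> N9"
  shows "n9.is_function f X Y \<longleftrightarrow> is_function f X Y"
  unfolding n9.is_function_def is_function_def n9_maps_to[OF assms(1)]
    n9_els[OF assms(1)] n9_els[OF assms(2)] n9_els[OF assms(3)]
  using n9_is_opair N9_trans[OF assms(1)] by simp

lemma n9_is_injection:
  assumes "f \<in> N9" "X \<in> N9" "Y \<in> N9"
  shows "n9.is_injection f X Y \<longleftrightarrow> is_injection f X Y"
  unfolding n9.is_injection_def is_injection_def n9_is_function[OF assms] n9_els[OF assms(2)]
  using n9_app[OF assms(1)] by (simp add: inj_on_def)

lemma n9_is_inductive:
  assumes "w \<in> N9"
  shows "n9.is_inductive w \<longleftrightarrow> is_inductive w"
proof -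
  have "n \<epsilon> w \<Longrightarrow> n9.els n = els n" for n
    using n9_els N9_trans assms by blast
  then show ?thesis
    unfolding n9.is_inductive_def is_inductive_def n9_els[OF assms]
    by (auto; metis)
qed

lemma n9_omega: "n9.omega = omega"
  unfolding n9.omega_def
proof (rule the_equality)
  have "els omega \<subseteq> n9.els v" if "v \<in> N9" "n9.is_inductive v" for v
    using that omega_least n9_is_inductive n9_els by simp
  then show 1: "omega \<in> N9 \<and> n9.is_inductive omega \<and> (\<forall>v\<in>N9. n9.is_inductive v \<longrightarrow> n9.els omega \<subseteq> n9.els v)"
    using omega_N9 n9_els n9_is_inductive omega_least by simp
  show "w = omega" if w: "w \<in> N9 \<and> n9.is_inductive w \<and> (\<forall>v\<in>N9. n9.is_inductive v \<longrightarrow> n9.els w \<subseteq> n9.els v)" for w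
  proof (rule set_eqI)
    have "n9.els w = n9.els omega"
      using w 1 by blast
    then have "els w = els omega"
      using w omega_N9 n9_els by simp
    then show "z \<epsilon> w \<longleftrightarrow> z \<epsilon> omega" for z
      by (simp add: set_eq_iff)
    then show "is_set w" "is_set omega"
      using is_setI[of zero] zero_omega by blast+
  qed
qed

lemma n9_edge: "E \<in> N9 \<Longrightarrow> n9.edge E x y \<longleftrightarrow> upair x y \<epsilon> E"
  unfolding n9.edge_def using n9_els N9_trans by (metis els_iff els_upair upair_eqI)

lemma n9_is_graph:
  assumes "V \<in> N9" "E \<in> N9"
  shows "n9.is_graph V E \<longleftrightarrow> is_graph V E"
  unfolding n9.is_graph_def is_graph_def n9_els[OF assms(1)] n9_els[OF assms(2)]
  using n9_els N9_trans[OF assms(2)] by simp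

lemma n9_at_most_countable:
  assumes "X \<in> N9"
  shows "n9.at_most_countable X \<longleftrightarrow> (\<exists>f\<in>N9. is_injection f X omega)"
  unfolding n9.at_most_countable_def n9_omega using n9_is_injection[OF _ assms omega_N9] by blast

section \<open>Sufficient conditions for the conclusion of EDM-BG in \<open>N9\<close>\<close>

definition edm_conclusion :: "'m \<Rightarrow> 'm \<Rightarrow> bool" where
  "edm_conclusion V E \<longleftrightarrow>
        (\<exists>I \<in> N9. n9.is_set I \<and> n9.els I \<subseteq> n9.els V \<and>
           (\<forall>x \<in> n9.els I. \<forall>y \<in> n9.els I. x \<noteq> y \<longrightarrow> \<not> n9.edge E x y) \<and>
           (\<exists>f \<in> N9. n9.is_injection f n9.omega I)) \<or>
        (\<exists>V' \<in> N9. \<exists>E' \<in> N9. n9.is_graph V' E' \<and> n9.els V' \<subseteq> n9.els V \<and> n9.els E' \<subseteq> n9.els E \<and>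
           (\<forall>x \<in> n9.els V'. \<forall>y \<in> n9.els V'. x \<noteq> y \<longrightarrow> n9.edge E' x y) \<and>
           \<not> n9.at_most_countable V')"

lemma EDM_BG_N9I:
  assumes "\<And>V E. V \<in> N9 \<Longrightarrow> E \<in> N9 \<Longrightarrow> is_graph V E \<Longrightarrow>
    \<not> (\<exists>f\<in>N9. is_injection f V omega) \<Longrightarrow> edm_conclusion V E"
  shows "n9.EDM_BG"
  unfolding n9.EDM_BG_def using assms unfolding edm_conclusion_def
  by (simp add: n9_is_graph n9_at_most_countable)

text \<open>The support \<open>m\<close> is the same for all members of the sequence; this puts the
  enumeration, and not only the independent set, into \<open>N9\<close>.\<close>

lemma edm_independent:
  assumes V: "V \<in> N9" "E \<in> N9" and F: "trm (\<lambda>e. F (e 0))" "\<And>i. i \<epsilon> omega \<Longrightarrow> F i \<epsilon> V"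
    and indep: "\<And>i j. i \<epsilon> omega \<Longrightarrow> j \<epsilon> omega \<Longrightarrow> i \<noteq> j \<Longrightarrow> F i \<noteq> F j \<and> \<not> upair (F i) (F j) \<epsilon> E"
    and m: "m \<epsilon> omega" "\<And>i. i \<epsilon> omega \<Longrightarrow> supports m (F i)"
  shows "edm_conclusion V E"
proof -
  define I where "I = Img omega F"
  have I: "x \<epsilon> I \<longleftrightarrow> (\<exists>i. i \<epsilon> omega \<and> x = F i)" for x
    unfolding I_def by (rule mem_Img[OF F(1)])
  have I_set: "is_set I"
    unfolding I_def by (rule is_set_Img[OF F(1)])
  have IV: "els I \<subseteq> els V"
    unfolding els_subset_iff by (auto simp: I F(2))
  have "supports m I"
  proof (rule supports_setI[OF m(1) I_set])
    show "act' f u \<epsilon> I" if "f \<in> Gn m" "u \<epsilon> I" for f u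
      using that m(2) unfolding I supports_def by auto
  qed
  then have I_N9: "I \<in> N9"
    by (rule N9_subset[OF V(1) IV])
  define f where "f = Lam omega F"
  have fn: "is_function f omega I"
    unfolding f_def by (rule is_function_Lam[OF F(1)]) (auto simp: I)
  have ap: "ap f i = F i" if "i \<epsilon> omega" for i
    unfolding f_def by (rule ap_Lam[OF F(1) that])
  have f_N9: "f \<in> N9"
  proof (rule function_N9[OF fn omega_N9 _ m(1)])
    show "ap f i \<in> N9" if "i \<epsilon> omega" for i
      using ap that F(2) N9_trans[OF V(1)] by simp
  qed (use ap m supports_nat in auto)
  have "is_injection f omega I"
    unfolding is_injection_def inj_on_def using fn app_eq_ap[OF fn] ap indep by auto
  then have "n9.is_injection f n9.omega I"
    using n9_is_injection[OF f_N9 omega_N9 I_N9] n9_omega by simp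
  moreover have "\<not> n9.edge E x y" if "x \<in> n9.els I" "y \<in> n9.els I" "x \<noteq> y" for x y
    using that indep unfolding n9_els[OF I_N9] n9_edge[OF V(2)] by (auto simp: I)
  ultimately show ?thesis
    unfolding edm_conclusion_def using I_N9 f_N9 I_set IV n9_els[OF I_N9] n9_els[OF V(1)] by blast
qed

lemma edm_clique:
  assumes V: "V \<in> N9" "E \<in> N9" and C: "is_set C" "els C \<subseteq> els V" "supports n C"
    and clique: "\<And>x y. x \<epsilon> C \<Longrightarrow> y \<epsilon> C \<Longrightarrow> x \<noteq> y \<Longrightarrow> upair x y \<epsilon> E"
    and unc: "\<not> (\<exists>f\<in>N9. is_injection f C omega)"
  shows "edm_conclusion V E"
proof -
  \<comment> \<open>All pairs from \<open>C\<close>: by \<open>clique\<close> none is lost when they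
    are cut out of \<open>E\<close>, and their set inherits the support of \<open>C\<close>.\<close>
  define P where "P e \<longleftrightarrow> (\<exists>x y. x \<epsilon> C \<and> y \<epsilon> C \<and> x \<noteq> y \<and> e = upair x y)" for e
  define E' where "E' = Col E P"
  have P: "dfn (\<lambda>e. P (e 0))"
    unfolding P_def by (intro dfn_intros)
  have E': "u \<epsilon> E' \<longleftrightarrow> (\<exists>x y. x \<epsilon> C \<and> y \<epsilon> C \<and> x \<noteq> y \<and> u = upair x y)" for u
    unfolding E'_def mem_Col[OF P] unfolding P_def using clique by blast
  have E'_set: "is_set E'"
    unfolding E'_def by (rule is_set_Col[OF P])
  have "supports n E'"
  proof (rule supports_setI[OF _ E'_set])
    show "n \<epsilon> omega" using C(3) unfolding supports_def by blast
    show "act' f u \<epsilon> E'" if f: "f \<in> Gn n" and u: "u \<epsilon> E'" for f u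
    proof -
      note p = Gn_perm[OF f]
      obtain x y where xy: "x \<epsilon> C" "y \<epsilon> C" "x \<noteq> y" "u = upair x y"
        using u E' by blast
      have "act' f C = C"
        using C(3) f unfolding supports_def by blast
      then have "act' f x \<epsilon> C" "act' f y \<epsilon> C"
        using mem_act'_iff[OF p] xy(1,2) by metis+
      moreover have "act' f x \<noteq> act' f y"
        using act'_inj[OF p] xy(3) by blast
      ultimately show ?thesis
        unfolding E' using act'_upair[OF p] xy(4) by blast
    qed
  qed
  moreover have E'E: "els E' \<subseteq> els E"
    unfolding els_subset_iff E'_def mem_Col[OF P] by blast
  ultimately have E'_N9: "E' \<in> N9"
    using N9_subset[OF V(2)] by blast
  have C_N9: "C \<in> N9"
    by (rule N9_subset[OF V(1) C(2,3)])
  have "is_graph C E'"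
    unfolding is_graph_def using C(1) E'_set E' els_upair by fastforce
  then have "n9.is_graph C E'"
    using n9_is_graph[OF C_N9 E'_N9] by simp
  moreover have "n9.edge E' x y" if "x \<in> n9.els C" "y \<in> n9.els C" "x \<noteq> y" for x y
    using that unfolding n9_els[OF C_N9] n9_edge[OF E'_N9] E' by auto
  moreover have "\<not> n9.at_most_countable C"
    using unc n9_at_most_countable[OF C_N9] by blast
  ultimately show ?thesis
    unfolding edm_conclusion_def
    using C_N9 E'_N9 C(2) E'E n9_els V by blast
qed

lemma edm_well_orderable:
  assumes V: "V \<in> N9" "E \<in> N9" "is_graph V E"
    and unc: "\<not> (\<exists>f\<in>N9. is_injection f V omega)"
    and m: "m \<epsilon> omega" "\<And>v. v \<epsilon> V \<Longrightarrow> supports m v"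
  shows "edm_conclusion V E"
proof -
  have inj_N9: "f \<in> N9" if f: "is_injection f X omega" and X: "els X \<subseteq> els V" "is_set X" for f X
  proof -
    note fn = f[unfolded is_injection_def, THEN conjunct1]
    have XV: "x \<epsilon> V" if "x \<epsilon> X" for x
      using X that unfolding els_subset_iff by blast
    have "supports m X"
    proof (rule supports_setI[OF m(1) X(2)])
      show "act' g u \<epsilon> X" if "g \<in> Gn m" "u \<epsilon> X" for g u
        using m(2)[OF XV[OF that(2)]] that unfolding supports_def by simp
    qed
    then have "X \<in> N9"
      by (rule N9_subset[OF V(1) X(1)])
    note X_N9 = this
    show ?thesis
    proof (rule function_N9[OF fn X_N9 _ m(1)])
      show "ap f x \<in> N9" if "x \<epsilon> X" for x
        using ap_in[OF fn that] by (rule N9_trans[OF omega_N9])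
      show "supports m x" if "x \<epsilon> X" for x
        using XV[OF that] by (rule m(2))
      show "supports m (ap f x)" if "x \<epsilon> X" for x
        using ap_in[OF fn that] by (rule supports_nat[OF m(1)])
    qed
  qed
  have V_set: "is_set V"
    using V(3) unfolding is_graph_def by blast
  have uncV: "\<not> at_most_countable V"
    using unc inj_N9[OF _ _ V_set] unfolding at_most_countable_def by blast
  \<comment> \<open>Either each uncountable set of vertices contains a vertex with uncountably many
    non-neighbours in that set, and an independent sequence can be built, or some uncountable
    \<open>W\<close> violates this and contains the clique.\<close>
  show ?thesis
  proof (cases "\<forall>W. els W \<subseteq> els V \<longrightarrow> \<not> at_most_countable W \<longrightarrow>
      (\<exists>v. v \<epsilon> W \<and> \<not> at_most_countable (non_nbrs E W v))")
    case True
    then obtain F where F: "trm (\<lambda>e. F (e 0))" "\<And>i. i \<epsilon> omega \<Longrightarrow> F i \<epsilon> V"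
      "\<And>i j. i \<epsilon> omega \<Longrightarrow> j \<epsilon> omega \<Longrightarrow> i \<noteq> j \<Longrightarrow> F i \<noteq> F j \<and> \<not> upair (F i) (F j) \<epsilon> E"
      using infinite_independent[OF V_set uncV, of E] by blast
    show ?thesis
      by (rule edm_independent[OF V(1,2) F m(1)]) (use F(2) m(2) in blast)+
  next
    case False
    then obtain W where W: "els W \<subseteq> els V" "\<not> at_most_countable W"
      "\<And>v. v \<epsilon> W \<Longrightarrow> at_most_countable (non_nbrs E W v)"
      by blast
    obtain C where C: "is_set C" "els C \<subseteq> els W"
      "\<And>x y. x \<epsilon> C \<Longrightarrow> y \<epsilon> C \<Longrightarrow> x \<noteq> y \<Longrightarrow> upair x y \<epsilon> E" "\<not> at_most_countable C"
      using uncountable_clique[OF W(2,3)] by blast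
    have CV: "els C \<subseteq> els V"
      using C(2) W(1) by blast
    have "supports m C"
    proof (rule supports_setI[OF m(1) C(1)])
      show "act' g u \<epsilon> C" if "g \<in> Gn m" "u \<epsilon> C" for g u
        using m(2)[of u] CV that unfolding supports_def els_subset_iff by simp
    qed
    moreover have "\<not> (\<exists>f\<in>N9. is_injection f C omega)"
      using C(4) unfolding at_most_countable_def by blast
    ultimately show ?thesis
      using edm_clique[OF V(1,2) C(1) CV] C(3) by blast
  qed
qed

section \<open>Exchanging blocks\<close>

lemma co_splice:
  assumes "n \<epsilon> omega" "a \<epsilon> A" "c \<epsilon> A" "j \<epsilon> omega"
  shows "co (splice n a c) j = (if j \<epsilon> n then co a j else co c j)"
proof (cases "j \<epsilon> n")
  case True
  then show ?thesis
    using splice_agree[OF assms(1-3)] unfolding agree_def by simp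
next
  case False
  then have "leq n j"
    using leq_cases[OF assms(1,4)] by blast
  then show ?thesis
    using splice_tail_eq[OF assms(1-3)] False assms(4) unfolding tail_eq_def by simp
qed

lemma splice_cong:
  assumes "n \<epsilon> omega" "a \<epsilon> A" "c \<epsilon> A" "a' \<epsilon> A" "c' \<epsilon> A" "agree n a a'" "tail_eq n c c'"
  shows "splice n a c = splice n a' c'"
proof (rule splice_eqI[OF assms(1-3)])
  show "splice n a' c' \<epsilon> A"
    using assms by simp
  show "agree n (splice n a' c') a"
    using splice_agree[OF assms(1,4,5)] assms(6) agree_sym agree_trans by blast
  show "tail_eq n (splice n a' c') c"
    using splice_tail_eq[OF assms(1,4,5)] assms(7) tail_eq_sym tail_eq_trans by blast
qed

lemma splice_self: "n \<epsilon> omega \<Longrightarrow> a \<epsilon> A \<Longrightarrow> splice n a a = a"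
  by (rule splice_eqI) auto

lemma splice_eq_left:
  "n \<epsilon> omega \<Longrightarrow> a \<epsilon> A \<Longrightarrow> c \<epsilon> A \<Longrightarrow> tail_eq n a c \<Longrightarrow> splice n a c = a"
  by (rule splice_eqI) auto

lemma splice_splice:
  assumes "n \<epsilon> omega" "a \<epsilon> A" "c \<epsilon> A" "d \<epsilon> A"
  shows "splice n (splice n a c) d = splice n a d"
  by (rule splice_cong) (use assms in auto)

lemma splice_splice_right:
  assumes "n \<epsilon> omega" "a \<epsilon> A" "c \<epsilon> A" "d \<epsilon> A"
  shows "splice n a (splice n c d) = splice n a d"
  by (rule splice_cong) (use assms in auto)

lemma tail_eq_splice:
  assumes "n \<epsilon> omega" "k \<epsilon> omega" "a \<epsilon> A" "c \<epsilon> A" "a' \<epsilon> A" "c' \<epsilon> A" "tail_eq n a a'" "tail_eq k c c'"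
  shows "tail_eq n (splice k a c) (splice k a' c')"
  unfolding tail_eq_def
proof (intro allI impI)
  fix j assume j: "j \<epsilon> omega" "leq n j"
  show "co (splice k a c) j = co (splice k a' c') j"
    using co_splice[OF assms(2) _ _ j(1)] assms j leq_cases[OF assms(2) j(1)]
    unfolding tail_eq_def by auto
qed

lemma tail_eq_cong: "tail_eq n a a' \<Longrightarrow> tail_eq n a c \<longleftrightarrow> tail_eq n a' c"
  using tail_eq_sym tail_eq_trans by blast

lemma agree_splice:
  assumes "n \<epsilon> omega" "k \<epsilon> omega" "leq n k" "a \<epsilon> A" "c \<epsilon> A"
  shows "agree n (splice k a c) a"
  using agree_mono[OF assms(2,3)] splice_agree[OF assms(2,4,5)] by blast

text \<open>The explicit inverse \<open>F'\<close> yields bijectivity as well as the backward half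
  of the block condition.\<close>

lemma Gn_Lam:
  assumes n: "n \<epsilon> omega" and F: "trm (\<lambda>e. F (e 0))"
    and F_in: "\<And>a. a \<epsilon> A \<Longrightarrow> F a \<epsilon> A" "\<And>a. a \<epsilon> A \<Longrightarrow> F' a \<epsilon> A"
    and inv: "\<And>a. a \<epsilon> A \<Longrightarrow> F' (F a) = a" "\<And>a. a \<epsilon> A \<Longrightarrow> F (F' a) = a"
    and agree: "\<And>a. a \<epsilon> A \<Longrightarrow> agree n (F a) a"
    and tail: "\<And>a c. a \<epsilon> A \<Longrightarrow> c \<epsilon> A \<Longrightarrow> tail_eq n a c \<Longrightarrow> tail_eq n (F a) (F c)"
      "\<And>a c. a \<epsilon> A \<Longrightarrow> c \<epsilon> A \<Longrightarrow> tail_eq n a c \<Longrightarrow> tail_eq n (F' a) (F' c)"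
    and zero: "\<And>a. a \<epsilon> A \<Longrightarrow> tail_eq n a zero_atom \<Longrightarrow> F a = a"
    and bound: "k \<epsilon> omega" "\<And>a. a \<epsilon> A \<Longrightarrow> F a \<noteq> a \<Longrightarrow> tail_eq k a zero_atom"
  shows "Lam A F \<in> Gn n"
proof -
  have ap: "ap (Lam A F) a = F a" if "a \<epsilon> A" for a
    by (rule ap_Lam[OF F that])
  have "atom_perm (Lam A F)"
  proof (rule perm_Lam[OF F F_in(1)])
    show "a = c" if "a \<epsilon> A" "c \<epsilon> A" "F a = F c" for a c
      using inv(1)[OF that(1)] inv(1)[OF that(2)] unfolding that(3) by (rule trans[OF sym])
    show "\<exists>c. c \<epsilon> A \<and> F c = a" if "a \<epsilon> A" for a
      using inv(2)[OF that] F_in(2)[OF that] by blast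
  qed
  then have "Lam A F \<in> G"
    unfolding G_iff using ap bound(2) by (intro conjI exI[of _ k] bound(1)) simp_all
  moreover have "tail_eq n a c" if "a \<epsilon> A" "c \<epsilon> A" "tail_eq n (F a) (F c)" for a c
    using tail(2)[OF F_in(1)[OF that(1)] F_in(1)[OF that(2)] that(3)]
    unfolding inv(1)[OF that(1)] inv(1)[OF that(2)] .
  then have "tail_eq n s t \<longleftrightarrow> tail_eq n (ap (Lam A F) s) (ap (Lam A F) t)" if "s \<epsilon> A" "t \<epsilon> A" for s t
    unfolding ap[OF that(1)] ap[OF that(2)] using tail(1)[OF that] that by blast
  moreover have "agree n (ap (Lam A F) s) s" if "s \<epsilon> A" for s
    unfolding ap[OF that] by (rule agree[OF that])
  moreover have "ap (Lam A F) a = a" if "a \<epsilon> A" "tail_eq n a zero_atom" for a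
    unfolding ap[OF that(1)] by (rule zero[OF that])
  ultimately show ?thesis
    unfolding Gn_iff[OF n] by blast
qed

text \<open>With atoms seen as pairs of location and block, an element of \<open>Gn k\<close> acts
  on the block component alone.\<close>

lemma Gn_splice:
  assumes "k \<epsilon> omega" "g \<in> Gn k" "a \<epsilon> A" "c \<epsilon> A"
  shows "ap g (splice k a c) = splice k a (ap g c)"
proof -
  note g = assms(2)[unfolded Gn_iff[OF assms(1)]]
  note p = Gn_perm[OF assms(2)]
  have s: "splice k a c \<epsilon> A"
    using assms by simp
  show ?thesis
  proof (rule splice_eqI[symmetric])
    have "agree k (ap g (splice k a c)) (splice k a c)"
      using g s by blast
    then show "agree k (ap g (splice k a c)) a"
      using splice_agree[OF assms(1,3,4)] agree_trans by blast
    have "tail_eq k (splice k a c) c"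
      using splice_tail_eq[OF assms(1,3,4)] .
    then show "tail_eq k (ap g (splice k a c)) (ap g c)"
      using g s assms(4) by blast
  qed (use assms s perm_in[OF p] in auto)
qed

text \<open>The transposition of two \<open>n\<close>-blocks that keeps locations.\<close>

definition swap :: "'m \<Rightarrow> 'm \<Rightarrow> 'm \<Rightarrow> 'm" where
  "swap n s t = Lam A (\<lambda>a. if tail_eq n a s then splice n a t else if tail_eq n a t then splice n a s else a)"

lemma trm_swap [dfn_intros]:
  assumes "trm n" "trm s" "trm t"
  shows "trm (\<lambda>e. swap (n e) (s e) (t e))"
  unfolding swap_def
  by (intro dfn_intros trm_lift[OF assms(1)] trm_lift[OF assms(2)] trm_lift[OF assms(3)])

text \<open>Representatives, with location \<open>(0, \<dots>, 0)\<close>, of the \<open>k\<close>-blocks other than \<open>A_0^k\<close>.\<close>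

definition reps :: "'m \<Rightarrow> 'm set" where
  "reps k = {s. s \<epsilon> A \<and> agree k s zero_atom \<and> s \<noteq> zero_atom}"

lemma dfn_reps [dfn_intros]: "trm k \<Longrightarrow> trm s \<Longrightarrow> dfn (\<lambda>e. s e \<in> reps (k e))"
  unfolding reps_def mem_Collect_eq by (intro dfn_intros)

lemma reps_in: "s \<in> reps k \<Longrightarrow> s \<epsilon> A"
  unfolding reps_def by blast

lemma reps_tail:
  assumes "k \<epsilon> omega" "s \<in> reps k"
  shows "\<not> tail_eq k s zero_atom"
  using assms agree_tail_eqI[of k s zero_atom] unfolding reps_def by auto

lemma reps_eqI:
  assumes "k \<epsilon> omega" "s \<in> reps k" "t \<in> reps k" "tail_eq k s t"
  shows "s = t"
proof -
  have "agree k s t"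
    using assms(2,3) agree_sym agree_trans unfolding reps_def by blast
  then show ?thesis
    using agree_tail_eqI assms reps_in by blast
qed

lemma reps_splice:
  assumes "k \<epsilon> omega" "s \<in> reps k" "t \<in> reps k"
  shows "splice k s t = t"
proof (rule splice_eqI)
  show "agree k t s"
    using assms(2,3) agree_sym agree_trans unfolding reps_def by blast
qed (use assms reps_in in auto)

lemma reps_mono: "k \<epsilon> omega \<Longrightarrow> m \<epsilon> omega \<Longrightarrow> leq m k \<Longrightarrow> s \<in> reps k \<Longrightarrow> s \<in> reps m"
  unfolding reps_def using agree_mono by blast

lemma unit_atom_reps:
  assumes "k \<epsilon> omega" "i \<epsilon> omega"
  shows "unit_atom k (suc i) \<in> reps k"
proof -
  have co: "co (unit_atom k (suc i)) j = (if j = k then suc i else zero)" if "j \<epsilon> omega" for j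
    using co_unit_atom[OF assms(1) suc_omega[OF assms(2)] that] .
  have "agree k (unit_atom k (suc i)) zero_atom"
    unfolding agree_def using co omega_trans[OF assms(1)] by auto
  moreover have "unit_atom k (suc i) \<noteq> zero_atom"
    using co[OF assms(1)] co_zero_atom[OF assms(1)] by auto
  ultimately show ?thesis
    unfolding reps_def using unit_atom_in[OF assms(1) suc_omega[OF assms(2)]] by blast
qed

lemma unit_atom_inj:
  assumes "k \<epsilon> omega" "i \<epsilon> omega" "j \<epsilon> omega" "unit_atom k i = unit_atom k j"
  shows "i = j"
proof -
  have "i = co (unit_atom k i) k"
    using co_unit_atom[OF assms(1,2,1)] by simp
  also have "\<dots> = j"
    unfolding assms(4) using co_unit_atom[OF assms(1,3,1)] by simp
  finally show ?thesis .
qed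

lemma Gn_reps:
  assumes "k \<epsilon> omega" "g \<in> Gn k" "s \<in> reps k"
  shows "ap g s \<in> reps k"
proof -
  note g = assms(2)[unfolded Gn_iff[OF assms(1)]]
  have "agree k (ap g s) zero_atom"
    using g assms(3) agree_trans unfolding reps_def by blast
  moreover have "ap g zero_atom = zero_atom"
    using g by simp
  then have "ap g s \<noteq> zero_atom"
    using perm_inj[OF Gn_perm[OF assms(2)], of s zero_atom] assms(3) unfolding reps_def by auto
  ultimately show ?thesis
    unfolding reps_def using perm_in[OF Gn_perm[OF assms(2)]] assms(3) reps_in by blast
qed

lemma ap_swap:
  "a \<epsilon> A \<Longrightarrow> ap (swap n s t) a =
    (if tail_eq n a s then splice n a t else if tail_eq n a t then splice n a s else a)"
  unfolding swap_def by (rule ap_Lam) (intro dfn_intros)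

lemma swap_Gn:
  assumes n: "n \<epsilon> omega" and s: "s \<in> reps n" and t: "t \<in> reps n"
  shows "swap n s t \<in> Gn n"
proof -
  let ?F = "\<lambda>a. if tail_eq n a s then splice n a t else if tail_eq n a t then splice n a s else a"
  have sA: "s \<epsilon> A" and tA: "t \<epsilon> A"
    using s t reps_in by blast+
  \<comment> \<open>The bound \<open>k\<close> lies beyond \<open>n\<close> and the bounds of
    \<open>s\<close> and \<open>t\<close>, as every moved point agrees with \<open>s\<close> or
    \<open>t\<close> from \<open>n\<close> on.\<close>
  obtain ks where ks: "ks \<epsilon> omega" "tail_eq ks s zero_atom"
    using atom_tail_zero[OF sA] by blast
  obtain kt where kt: "kt \<epsilon> omega" "tail_eq kt t zero_atom"
    using atom_tail_zero[OF tA] by blast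
  obtain k1 where k1: "k1 \<epsilon> omega" "leq ks k1" "leq kt k1"
    using upper_bound[OF ks(1) kt(1)] by blast
  obtain k where k: "k \<epsilon> omega" "leq k1 k" "leq n k"
    using upper_bound[OF k1(1) n] by blast
  have kz: "tail_eq k s zero_atom" "tail_eq k t zero_atom"
    using ks kt k k1 tail_eq_mono by meson+
  have F_in: "?F a \<epsilon> A" if "a \<epsilon> A" for a
    using n that sA tA by simp
  have inv: "?F (?F a) = a" if a: "a \<epsilon> A" for a
  proof -
    have *: "splice n (splice n a u) u' = a" if "u \<epsilon> A" "u' \<epsilon> A" "tail_eq n a u'" for u u'
      using splice_splice[OF n a that(1,2)] splice_eq_left[OF n a that(2,3)] by simp
    show ?thesis
    proof (cases "tail_eq n a s")
      case True
      show ?thesis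
      proof (cases "tail_eq n t s")
        case True
        then have "s = t" using reps_eqI[OF n s t] tail_eq_sym by blast
        then show ?thesis using \<open>tail_eq n a s\<close> * sA n a by simp
      next
        case False
        have "tail_eq n (splice n a t) t" using n a tA by simp
        then have "\<not> tail_eq n (splice n a t) s"
          using False tail_eq_sym tail_eq_trans by blast
        then show ?thesis using True \<open>tail_eq n (splice n a t) t\<close> * sA tA by simp
      qed
    next
      case False
      have "tail_eq n (splice n a s) s" using n a sA by simp
      then show ?thesis using False * sA tA by simp
    qed
  qed
  have tail: "tail_eq n (?F a) (?F c)" if "a \<epsilon> A" "c \<epsilon> A" "tail_eq n a c" for a c
  proof -
    have "tail_eq n a u \<longleftrightarrow> tail_eq n c u" for u
      using that(3) by (rule tail_eq_cong)
    then show ?thesis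
      using tail_eq_splice[OF n n that(1) _ that(2) _ that(3) tail_eq_refl] sA tA that(3) by simp
  qed
  have dF: "trm (\<lambda>e. ?F (e 0))"
    by (intro dfn_intros)
  show ?thesis
    unfolding swap_def
  proof (rule Gn_Lam[OF n dF F_in F_in inv inv _ tail tail _ k(1)])
    show "agree n (?F a) a" if "a \<epsilon> A" for a
      using n that sA tA by simp
    show "?F a = a" if "a \<epsilon> A" "tail_eq n a zero_atom" for a
      using that(2) reps_tail[OF n s] reps_tail[OF n t] tail_eq_sym tail_eq_trans by metis
    show "tail_eq k a zero_atom" if "a \<epsilon> A" "?F a \<noteq> a" for a
    proof -
      have "tail_eq n a s \<or> tail_eq n a t"
        using that(2) by presburger
      then show ?thesis
        using tail_eq_mono[OF k(1,3)] kz tail_eq_trans by blast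
    qed
  qed
qed

lemma
  assumes "n \<epsilon> omega" "s \<in> reps n" "t \<in> reps n"
  shows swap_left: "ap (swap n s t) s = t"
    and swap_right: "ap (swap n s t) t = s"
    and swap_other: "u \<in> reps n \<Longrightarrow> u \<noteq> s \<Longrightarrow> u \<noteq> t \<Longrightarrow> ap (swap n s t) u = u"
    and act_swap_swap: "act' (swap n s t) (act' (swap n s t) x) = x"
proof -
  have st: "s \<epsilon> A" "t \<epsilon> A"
    using assms reps_in by blast+
  show 1: "ap (swap n s t) s = t"
    using ap_swap[OF st(1)] reps_splice[OF assms] by simp
  show 2: "ap (swap n s t) t = s"
    using ap_swap[OF st(2)] reps_splice[OF assms(1,3,2)] reps_splice[OF assms(1,3,3)]
      reps_eqI[OF assms(1,3,2)] by auto
  show "ap (swap n s t) u = u" if "u \<in> reps n" "u \<noteq> s" "u \<noteq> t"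
    using ap_swap[OF reps_in[OF that(1)]] reps_eqI[OF assms(1) that(1)] assms(2,3) that(2,3) by metis
  have p: "atom_perm (swap n s t)"
    using Gn_perm swap_Gn[OF assms] by blast
  have inv: "ap (swap n s t) (ap (swap n s t) a) = a" if a: "a \<epsilon> A" for a
  proof -
    have *: "splice n (splice n a u) u' = a" if "u \<epsilon> A" "u' \<epsilon> A" "tail_eq n a u'" for u u'
      using splice_splice[OF assms(1) a that(1,2)] splice_eq_left[OF assms(1) a that(2,3)] by simp
    have g: "ap (swap n s t) (splice n a u) = splice n a (ap (swap n s t) u)" if "u \<epsilon> A" for u
      using Gn_splice[OF assms(1) swap_Gn[OF assms] a that] .
    show ?thesis
      unfolding ap_swap[OF a] using g[OF st(1)] g[OF st(2)] 1 2 ap_swap[OF a]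
        splice_eq_left[OF assms(1) a st(1)] splice_eq_left[OF assms(1) a st(2)] by auto
  qed
  show "act' (swap n s t) (act' (swap n s t) x) = x"
    using act'_comp'[OF p p, of x] act'_id[of "compose_perm (swap n s t) (swap n s t)" x] inv ap_comp by simp
qed

text \<open>A transposition fixes all other representatives. So \<open>t1\<close> can be moved to
  any \<open>u\<close> while \<open>s1\<close> stays, and then \<open>s1\<close> to any
  \<open>s\<close> while \<open>u\<close> stays; symmetry covers the pairs with \<open>s1\<close> in
  second place.\<close>

lemma reps_pairs:
  assumes k: "k \<epsilon> omega" and sym: "\<And>s t. Q s t \<Longrightarrow> Q t s"
    and inv: "\<And>g s t. g \<in> Gn k \<Longrightarrow> s \<in> reps k \<Longrightarrow> t \<in> reps k \<Longrightarrow> Q s t \<Longrightarrow> Q (ap g s) (ap g t)"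
    and 1: "s1 \<in> reps k" "t1 \<in> reps k" "s1 \<noteq> t1" "Q s1 t1"
    and s: "s \<in> reps k" "t \<in> reps k" "s \<noteq> t"
  shows "Q s t"
proof -
  have A: "Q s1 u" if u: "u \<in> reps k" "u \<noteq> s1" for u
  proof -
    have "Q (ap (swap k t1 u) s1) (ap (swap k t1 u) t1)"
      using inv[OF swap_Gn[OF k 1(2) u(1)] 1(1,2,4)] .
    then show ?thesis
      using swap_left[OF k 1(2) u(1)] swap_other[OF k 1(2) u(1) 1(1)] 1(3) u(2) by simp
  qed
  consider "s = s1" | "t = s1" | "s \<noteq> s1" "t \<noteq> s1" by blast
  then show ?thesis
  proof cases
    case 3
    have "Q (ap (swap k s1 s) s1) (ap (swap k s1 s) t)"
      using inv[OF swap_Gn[OF k 1(1) s(1)] 1(1) s(2) A[OF s(2) 3(2)]] .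
    then show ?thesis
      using swap_left[OF k 1(1) s(1)] swap_other[OF k 1(1) s(1,2)] s(3) 3 by simp
  qed (use A s sym in auto)
qed

text \<open>
  The orbit of \<open>w\<close> under \<open>G_k\<close> is indexed equivariantly by the nonzero \<open>k\<close>-blocks, and
  transpositions of blocks make any two pairs of distinct elements indiscernible. Hence the orbit is a
  clique, and no support fixes enough of it to allow an injection into \<open>\<omega>\<close>, or it is independent,
  and its members indexed by the atoms \<open>(0, \<dots>, 0, i + 1, 0, \<dots>)\<close> are all fixed by \<open>G_{k+1}\<close>.
\<close>

lemma edm_orbit:
  assumes V: "V \<in> N9" "E \<in> N9" "is_graph V E" "supports k V" "supports k E"
    and w: "w \<epsilon> V" and s0: "s0 \<in> reps k"
    and stab: "\<And>g. g \<in> Gn k \<Longrightarrow> ap g s0 = s0 \<Longrightarrow> act' g w = w"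
    and moved: "g0 \<in> Gn k" "act' g0 w \<noteq> w"
  shows "edm_conclusion V E"
proof -
  have k: "k \<epsilon> omega"
    using V(4) unfolding supports_def by blast
  \<comment> \<open>By \<open>stab\<close>, the image of \<open>w\<close> depends only on the
    representative to which \<open>s0\<close> is sent; the transposition is one way of sending it to
    \<open>t\<close>.\<close>
  define v where "v t = act' (swap k s0 t) w" for t
  have act_V: "act' g x \<epsilon> V \<longleftrightarrow> x \<epsilon> V" if "g \<in> Gn k" for g x
    using V(4) that mem_act'_iff[OF Gn_perm[OF that]] unfolding supports_def by metis
  have act_E: "upair (act' g x) (act' g y) \<epsilon> E \<longleftrightarrow> upair x y \<epsilon> E" if "g \<in> Gn k" for g x y
    using V(5) that mem_act'_iff[OF Gn_perm[OF that]] act'_upair[OF Gn_perm[OF that]]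
    unfolding supports_def by metis
  have v_V: "v t \<epsilon> V" if "t \<in> reps k" for t
    unfolding v_def using act_V swap_Gn[OF k s0 that] w by blast
  have equiv: "act' g (v s) = v (ap g s)" if g: "g \<in> Gn k" and s: "s \<in> reps k" for g s
  proof -
    have gs: "ap g s \<in> reps k"
      by (rule Gn_reps[OF k g s])
    let ?s = "swap k s0 s" and ?t = "swap k s0 (ap g s)"
    have st: "?s \<in> Gn k" "?t \<in> Gn k"
      using swap_Gn k s0 s gs by blast+
    have s0A: "s0 \<epsilon> A" using s0 reps_in by blast
    \<comment> \<open>First \<open>?s\<close>, then \<open>g\<close>, then \<open>?t\<close> leads
      \<open>s0\<close> back to \<open>s0\<close>, so the product fixes \<open>w\<close>. As
      \<open>?t\<close> is an involution, it can be moved to the other side.\<close>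
    have "ap (compose_perm ?t (compose_perm g ?s)) s0 = s0"
      using ap_comp[OF s0A] swap_left[OF k s0 s] swap_right[OF k s0 gs] by simp
    then have "act' (compose_perm ?t (compose_perm g ?s)) w = w"
      using stab Gn_comp[OF k st(2) Gn_comp[OF k g st(1)]] by blast
    then have "act' ?t (act' g (v s)) = w"
      unfolding v_def using act'_comp' Gn_perm st g Gn_comp[OF k g st(1)] by simp
    then have "act' ?t w = act' g (v s)"
      using act_swap_swap[OF k s0 gs, of "act' g (v s)"] by simp
    then show ?thesis unfolding v_def by simp
  qed
  have v_s0: "v s0 = w"
    unfolding v_def using stab swap_Gn[OF k s0 s0] swap_left[OF k s0 s0] by blast
  define t0 where "t0 = ap g0 s0"
  have t0: "t0 \<in> reps k"
    unfolding t0_def by (rule Gn_reps[OF k moved(1) s0])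
  have "v s0 \<noteq> v t0"
    using equiv[OF moved(1) s0] moved(2) v_s0 unfolding t0_def by simp
  then have "s0 \<noteq> t0" by blast
  have v_inj: "v s \<noteq> v t" if "s \<in> reps k" "t \<in> reps k" "s \<noteq> t" for s t
  proof (rule reps_pairs[where Q = "\<lambda>s t. v s \<noteq> v t", OF k _ _ s0 t0 \<open>s0 \<noteq> t0\<close> \<open>v s0 \<noteq> v t0\<close> that])
    show "v (ap g s) \<noteq> v (ap g t)" if "g \<in> Gn k" "s \<in> reps k" "t \<in> reps k" "v s \<noteq> v t" for g s t
      using that equiv act'_inj[OF Gn_perm[OF that(1)]] by metis
  qed simp
  have edge_inv: "upair (v (ap g s)) (v (ap g t)) \<epsilon> E \<longleftrightarrow> upair (v s) (v t) \<epsilon> E"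
    if "g \<in> Gn k" "s \<in> reps k" "t \<in> reps k" for g s t
    using act_E[OF that(1)] equiv[OF that(1,2)] equiv[OF that(1,3)] by metis
  have t_v: "trm (\<lambda>e. v (t e))" if "trm t" for t
    unfolding v_def by (intro dfn_intros that)
  show ?thesis
  proof (cases "upair (v s0) (v t0) \<epsilon> E")
    case True
    have all: "upair (v s) (v t) \<epsilon> E" if "s \<in> reps k" "t \<in> reps k" "s \<noteq> t" for s t
      by (rule reps_pairs[where Q = "\<lambda>s t. upair (v s) (v t) \<epsilon> E", OF k _ _ s0 t0 \<open>s0 \<noteq> t0\<close> True that])
        (use edge_inv upair_commute in auto)
    define C where "C = Col V (\<lambda>x. \<exists>t. t \<in> reps k \<and> x = v t)"
    have d: "dfn (\<lambda>e. \<exists>t. t \<in> reps k \<and> e 0 = v t)"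
      by (intro dfn_intros t_v)
    have C: "x \<epsilon> C \<longleftrightarrow> (\<exists>t. t \<in> reps k \<and> x = v t)" for x
      unfolding C_def mem_Col[OF d] using v_V by blast
    have C_set: "is_set C"
      unfolding C_def by (rule is_set_Col[OF d])
    have CV: "els C \<subseteq> els V"
      unfolding els_subset_iff C using v_V by blast
    have "supports k C"
    proof (rule supports_setI[OF k C_set])
      show "act' f u \<epsilon> C" if "f \<in> Gn k" "u \<epsilon> C" for f u
        using that equiv Gn_reps[OF k] unfolding C by blast
    qed
    moreover have "\<not> (\<exists>f\<in>N9. is_injection f C omega)"
    proof
      assume "\<exists>f\<in>N9. is_injection f C omega"
      then obtain f where f: "f \<in> N9" "is_function f C omega" "inj_on (app f) (els C)"
        unfolding is_injection_def by blast
      obtain j where j: "supports j f"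
        using f(1) N9_iff by blast
      then have "j \<epsilon> omega"
        unfolding supports_def by blast
      \<comment> \<open>Beyond the support of \<open>f\<close>, a transposition of two
        \<open>l\<close>-blocks fixes \<open>f\<close> and every natural number, but sends one
        vertex of \<open>C\<close> to another one.\<close>
      then obtain l where l: "l \<epsilon> omega" "leq j l" "leq k l"
        using upper_bound k by blast
      let ?s = "unit_atom l (suc zero)" and ?t = "unit_atom l (suc (suc zero))"
      have st: "?s \<in> reps l" "?t \<in> reps l"
        using unit_atom_reps[OF l(1)] by simp_all
      have "?s \<noteq> ?t"
        using unit_atom_inj[OF l(1), of "suc zero" "suc (suc zero)"] by auto
      have st_k: "?s \<in> reps k" "?t \<in> reps k"
        using reps_mono[OF l(1) k l(3)] st by blast+
      let ?g = "swap l ?s ?t"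
      have g: "?g \<in> Gn l" "?g \<in> Gn k" "?g \<in> Gn j"
        using swap_Gn[OF l(1) st] Gn_mono[OF _ l(1)] l k \<open>j \<epsilon> omega\<close> by blast+
      note p = Gn_perm[OF g(1)]
      have "act' ?g (v ?s) = v ?t"
        using equiv[OF g(2) st_k(1)] swap_left[OF l(1) st] by simp
      moreover have vC: "v ?s \<epsilon> C" "v ?t \<epsilon> C"
        using C st_k by blast+
      then have "opair (v ?s) (ap f (v ?s)) \<epsilon> f" and n: "ap f (v ?s) \<epsilon> omega"
        using opair_mem_function[OF f(2)] ap_in[OF f(2)] by blast+
      then have "act' ?g (opair (v ?s) (ap f (v ?s))) \<epsilon> act' ?g f"
        using mem_act'_iff[OF p] by blast
      moreover have "act' ?g f = f"
        using j g(3) unfolding supports_def by blast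
      ultimately have "opair (v ?t) (ap f (v ?s)) \<epsilon> f"
        using act'_opair[OF p] act'_nat[OF p n] by simp
      then have "ap f (v ?s) = ap f (v ?t)"
        using opair_mem_function[OF f(2)] by blast
      then have "v ?s = v ?t"
        using f(3) vC app_eq_ap[OF f(2)] unfolding inj_on_def by simp
      then show False
        using v_inj[OF st_k \<open>?s \<noteq> ?t\<close>] by blast
    qed
    ultimately show ?thesis
    proof (intro edm_clique[OF V(1,2) C_set CV])
      show "upair x y \<epsilon> E" if "x \<epsilon> C" "y \<epsilon> C" "x \<noteq> y" for x y
        using that all unfolding C by metis
    qed
  next
    case False
    have none: "\<not> upair (v s) (v t) \<epsilon> E" if "s \<in> reps k" "t \<in> reps k" "s \<noteq> t" for s t
      by (rule reps_pairs[where Q = "\<lambda>s t. \<not> upair (v s) (v t) \<epsilon> E", OF k _ _ s0 t0 \<open>s0 \<noteq> t0\<close> False that])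
        (use edge_inv upair_commute in auto)
    \<comment> \<open>The value \<open>suc i\<close> keeps the atom different from
      \<open>zero_atom\<close>, while it still lies in the block of \<open>zero_atom\<close> for
      \<open>suc k\<close>, which \<open>Gn (suc k)\<close> fixes pointwise.\<close>
    let ?u = "\<lambda>i. unit_atom k (suc i)"
    have u: "?u i \<in> reps k" if "i \<epsilon> omega" for i
      using unit_atom_reps[OF k that] .
    have u_inj: "?u i \<noteq> ?u j" if "i \<epsilon> omega" "j \<epsilon> omega" "i \<noteq> j" for i j
      using unit_atom_inj[OF k suc_omega[OF that(1)] suc_omega[OF that(2)]] suc_inj that(3) by blast
    show ?thesis
    proof (rule edm_independent[OF V(1,2), where F = "\<lambda>i. v (?u i)" and m = "suc k"])
      show "trm (\<lambda>e. v (?u (e 0)))"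
        by (intro t_v dfn_intros)
      show "v (?u i) \<noteq> v (?u j) \<and> \<not> upair (v (?u i)) (v (?u j)) \<epsilon> E"
        if "i \<epsilon> omega" "j \<epsilon> omega" "i \<noteq> j" for i j
        using v_inj none u u_inj that by blast
      show "supports (suc k) (v (?u i))" if i: "i \<epsilon> omega" for i
        unfolding supports_def
      proof (intro conjI ballI)
        fix f assume f: "f \<in> Gn (suc k)"
        have fk: "f \<in> Gn k"
          using Gn_mono[OF k suc_omega[OF k] _ f] unfolding leq_def by simp
        have "tail_eq (suc k) (?u i) zero_atom"
          unfolding tail_eq_def
        proof (intro allI impI)
          fix j assume j: "j \<epsilon> omega" "leq (suc k) j"
          then have "j \<noteq> k"
            using mem_asym[of k "suc k"] unfolding leq_def by auto
          then show "co (?u i) j = co zero_atom j"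
            using co_unit_atom[OF k suc_omega[OF i] j(1)] j(1) by simp
        qed
        then have "ap f (?u i) = ?u i"
          using f k reps_in[OF u[OF i]] unfolding Gn_iff[OF suc_omega[OF k]] by blast
        then show "act' f (v (?u i)) = v (?u i)"
          using equiv[OF fk u[OF i]] by simp
      qed (use k in simp)
    qed (use v_V u k in auto)
  qed
qed

text \<open>Identities between products of permutations, once checked on atoms, carry over to
  arbitrary sets.\<close>

lemma act'_transfer:
  assumes "atom_perm f" "atom_perm g" "atom_perm h" "atom_perm i"
    "\<And>a. a \<epsilon> A \<Longrightarrow> ap f (ap g a) = ap h (ap i a)"
  shows "act' f (act' g x) = act' h (act' i x)"
proof -
  have "act' (compose_perm f g) x = act' h (act' i x)"
    using assms ap_comp by (intro act'_comp) auto
  then show ?thesis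
    using act'_comp'[OF assms(1,2)] by simp
qed

lemma suc_eq_iff [simp]: "suc m = suc n \<longleftrightarrow> m = n"
  using suc_inj by blast

section \<open>Moving the dependence on \<open>A_0^k\<close> to other blocks\<close>

lemma tail_bound:
  assumes "k \<epsilon> omega" "s \<epsilon> A"
  obtains l where "l \<epsilon> omega" "leq k l" "tail_eq l s zero_atom"
proof -
  obtain m where m: "m \<epsilon> omega" "tail_eq m s zero_atom"
    using atom_tail_zero[OF assms(2)] by blast
  obtain l where l: "l \<epsilon> omega" "leq m l" "leq k l"
    using upper_bound[OF m(1) assms(1)] by blast
  have "tail_eq l s zero_atom"
    using tail_eq_mono[OF l(1,2) m(2)] .
  then show thesis using that l by blast
qed

text \<open>The point of \<open>A_0^k\<close> with the \<open>k\<close>-location of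
  \<open>a\<close>; it carries the action of a permutation of \<open>A_0^k\<close> to the other
  blocks.\<close>

definition base :: "'m \<Rightarrow> 'm \<Rightarrow> 'm" where
  "base k a = splice k a zero_atom"

lemma trm_base [dfn_intros]: "trm k \<Longrightarrow> trm a \<Longrightarrow> trm (\<lambda>e. base (k e) (a e))"
  unfolding base_def by (intro dfn_intros)

lemma
  assumes k: "k \<epsilon> omega" and a: "a \<epsilon> A"
  shows base_in: "base k a \<epsilon> A"
    and base_tail: "tail_eq k (base k a) zero_atom"
    and base_agree: "agree k (base k a) a"
    and base_splice: "c \<epsilon> A \<Longrightarrow> base k (splice k a c) = base k a"
    and splice_base: "c \<epsilon> A \<Longrightarrow> splice k (base k a) c = splice k a c"
    and base_eq: "tail_eq k a zero_atom \<Longrightarrow> base k a = a"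
proof -
  show "base k a \<epsilon> A" "tail_eq k (base k a) zero_atom" "agree k (base k a) a"
    unfolding base_def using k a by simp_all
  show "c \<epsilon> A \<Longrightarrow> base k (splice k a c) = base k a"
    unfolding base_def using splice_splice[OF k a _ zero_atom_in] .
  show "c \<epsilon> A \<Longrightarrow> splice k (base k a) c = splice k a c"
    unfolding base_def using splice_splice[OF k a zero_atom_in] .
  show "tail_eq k a zero_atom \<Longrightarrow> base k a = a"
    unfolding base_def using splice_eq_left[OF k a zero_atom_in] .
qed

lemma base_Gn:
  assumes "k \<epsilon> omega" "g \<in> Gn k" "a \<epsilon> A"
  shows "base k (ap g a) = base k a" "ap g (base k a) = base k a"
proof -
  note g = assms(2)[unfolded Gn_iff[OF assms(1)]]
  show "base k (ap g a) = base k a"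
    unfolding base_def
  proof (rule splice_cong[OF assms(1) perm_in[OF Gn_perm[OF assms(2)] assms(3)] zero_atom_in assms(3) zero_atom_in])
    show "agree k (ap g a) a"
      using g assms(3) by blast
  qed simp
  show "ap g (base k a) = base k a"
    using g base_in[OF assms(1,3)] base_tail[OF assms(1,3)] by blast
qed

text \<open>
  \<open>exch n k s\<close> exchanges the \<open>k\<close>-blocks of \<open>0\<close> and \<open>s\<close>, except for the locations that vanish
  from \<open>n\<close> on: in the block of \<open>0\<close> these make up \<open>A_0^n\<close>, which elements of \<open>G_n\<close> have to fix.
\<close>

definition exch :: "'m \<Rightarrow> 'm \<Rightarrow> 'm \<Rightarrow> 'm \<Rightarrow> 'm" where
  "exch n k s a = (if tail_eq k a zero_atom \<and> \<not> tail_eq n a zero_atom then splice k a s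
     else if tail_eq k a s \<and> \<not> tail_eq n (base k a) zero_atom then base k a else a)"

lemma trm_exch [dfn_intros]:
  assumes "trm a"
  shows "trm (\<lambda>e. exch n k s (a e))"
  unfolding exch_def by (intro dfn_intros assms)

lemma ap_exch: "a \<epsilon> A \<Longrightarrow> ap (Lam A (exch n k s)) a = exch n k s a"
  by (rule ap_Lam) (intro dfn_intros)

text \<open>Whether a point is moved, and in which way, depends only on its \<open>n\<close>-block,
  and coordinates below \<open>k\<close> never change.\<close>

lemma exch_Gn:
  assumes n: "n \<epsilon> omega" and k: "k \<epsilon> omega" "leq n k" and s: "s \<in> reps k"
  shows "Lam A (exch n k s) \<in> Gn n"
proof -
  have sA: "s \<epsilon> A" using s reps_in by blast
  have s0: "\<not> tail_eq k s zero_atom" using reps_tail[OF k(1) s] .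
  obtain l where l: "l \<epsilon> omega" "leq k l" "tail_eq l s zero_atom"
    using tail_bound[OF k(1) sA] by blast
  have inA: "exch n k s a \<epsilon> A" if "a \<epsilon> A" for a
    unfolding exch_def using that sA k base_in[OF k(1) that] by simp
  have inv: "exch n k s (exch n k s a) = a" if a: "a \<epsilon> A" for a
  proof -
    consider (1) "tail_eq k a zero_atom \<and> \<not> tail_eq n a zero_atom"
      | (2) "\<not> tail_eq k a zero_atom" "tail_eq k a s \<and> \<not> tail_eq n (base k a) zero_atom"
      | (3) "\<not> (tail_eq k a zero_atom \<and> \<not> tail_eq n a zero_atom)"
         "\<not> (tail_eq k a s \<and> \<not> tail_eq n (base k a) zero_atom)"
      using s0 tail_eq_sym tail_eq_trans by blast
    then show ?thesis
    proof cases
      case 1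
      let ?c = "splice k a s"
      have c: "tail_eq k ?c s" using k a sA by simp
      then have "\<not> tail_eq k ?c zero_atom" using s0 tail_eq_sym tail_eq_trans by blast
      moreover have "base k ?c = a" using base_splice[OF k(1) a sA] base_eq[OF k(1) a] 1 by simp
      ultimately show ?thesis
        using 1 c unfolding exch_def by simp
    next
      case 2
      have "splice k (base k a) s = a"
        using splice_base[OF k(1) a sA] splice_eq_left[OF k(1) a sA] 2 by simp
      then show ?thesis
        using 2 base_tail[OF k(1) a] unfolding exch_def by simp
    next
      case 3
      then have "exch n k s a = a" unfolding exch_def by presburger
      then show ?thesis by simp
    qed
  qed
  have tail: "tail_eq n (exch n k s a) (exch n k s c)" if ac: "a \<epsilon> A" "c \<epsilon> A" "tail_eq n a c" for a c
  proof -
    have "tail_eq k a c" using tail_eq_mono[OF k ac(3)] .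
    then have 1: "tail_eq k a u \<longleftrightarrow> tail_eq k c u" "tail_eq n a u \<longleftrightarrow> tail_eq n c u" for u
      using tail_eq_cong ac(3) by blast+
    have b: "tail_eq n (base k a) (base k c)"
      unfolding base_def using tail_eq_splice[OF n k(1) ac(1) _ ac(2) _ ac(3)] by simp
    then have "tail_eq n (base k a) u \<longleftrightarrow> tail_eq n (base k c) u" for u
      using tail_eq_cong by blast
    then show ?thesis
      unfolding exch_def using 1 b ac(3) tail_eq_splice[OF n k(1) ac(1) sA ac(2) sA ac(3)] by simp
  qed
  show ?thesis
  proof (rule Gn_Lam[OF n _ inA inA inv inv _ tail tail _ l(1)])
    show "trm (\<lambda>e. exch n k s (e 0))"
      by (intro dfn_intros)
    show "agree n (exch n k s a) a" if "a \<epsilon> A" for a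
      unfolding exch_def using agree_splice[OF n k that sA] agree_mono[OF k base_agree[OF k(1) that]] by simp
    show "exch n k s a = a" if "a \<epsilon> A" "tail_eq n a zero_atom" for a
    proof -
      have "tail_eq k a zero_atom" using tail_eq_mono[OF k that(2)] .
      then have "\<not> tail_eq k a s" using s0 tail_eq_sym tail_eq_trans by blast
      then show ?thesis unfolding exch_def using that(2) by simp
    qed
    show "tail_eq l a zero_atom" if "a \<epsilon> A" "exch n k s a \<noteq> a" for a
    proof -
      have "tail_eq k a zero_atom \<or> tail_eq k a s"
        using that(2) unfolding exch_def by presburger
      then show ?thesis
        using tail_eq_mono[OF l(1,2)] l(3) tail_eq_trans by blast
    qed
  qed
qed

text \<open>As \<open>g\<close> keeps locations and fixes \<open>A_0^k\<close> pointwise,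
  conjugation by \<open>g\<close> merely replaces the target block.\<close>

lemma exch_equivariant:
  assumes k: "k \<epsilon> omega" and s: "s \<in> reps k" and g: "g \<in> Gn k" and a: "a \<epsilon> A"
  shows "ap g (exch n k s a) = exch n k (ap g s) (ap g a)"
proof -
  note g' = g[unfolded Gn_iff[OF k]]
  have sA: "s \<epsilon> A" using s reps_in by blast
  have s0: "\<not> tail_eq k s zero_atom" using reps_tail[OF k s] .
  have gs: "tail_eq k (ap g a) (ap g s) \<longleftrightarrow> tail_eq k a s"
    using g' a sA by blast
  have "ap g zero_atom = zero_atom" using g' by simp
  then have g0: "tail_eq k (ap g a) zero_atom \<longleftrightarrow> tail_eq k a zero_atom"
    using g' a zero_atom_in by metis
  show ?thesis
  proof (cases "tail_eq k a zero_atom")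
    case True
    then have ga: "ap g a = a" using g' a by blast
    have "\<not> tail_eq k a s" using True s0 tail_eq_sym tail_eq_trans by blast
    then have "\<not> tail_eq k a (ap g s)" using gs ga by simp
    then show ?thesis
      unfolding exch_def ga using True \<open>\<not> tail_eq k a s\<close> ga Gn_splice[OF k g a sA] by simp
  next
    case False
    then show ?thesis
      unfolding exch_def using g0 gs base_Gn[OF k g a] by simp
  qed
qed

text \<open>
  \<open>copy k f P\<close> permutes every \<open>k\<close>-block satisfying \<open>P\<close> in the way \<open>f\<close> permutes \<open>A_0^k\<close>.
\<close>

definition copy :: "'m \<Rightarrow> 'm \<Rightarrow> ('m \<Rightarrow> bool) \<Rightarrow> 'm \<Rightarrow> 'm" where
  "copy k f P a = (if P a then splice k (ap f (base k a)) a else a)"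

lemma trm_copy:
  assumes "dfn (\<lambda>e. P (e 0))"
  shows "trm (\<lambda>e. copy k f P (e 0))"
  unfolding copy_def by (intro dfn_intros assms)

lemma ap_copy:
  assumes "dfn (\<lambda>e. P (e 0))" "a \<epsilon> A"
  shows "ap (Lam A (copy k f P)) a = copy k f P a"
  by (rule ap_Lam[OF trm_copy[OF assms(1)] assms(2)])

lemma copy_in: "k \<epsilon> omega \<Longrightarrow> atom_perm f \<Longrightarrow> a \<epsilon> A \<Longrightarrow> copy k f P a \<epsilon> A"
  unfolding copy_def using base_in perm_in by simp

lemma copy_tail: "k \<epsilon> omega \<Longrightarrow> atom_perm f \<Longrightarrow> a \<epsilon> A \<Longrightarrow> tail_eq k (copy k f P a) a"
  unfolding copy_def using base_in perm_in by simp

text \<open>The image of a moved point is moved too, and all moved points lie in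
  \<open>A_0^k\<close>; hence \<open>f\<close> does not leave this block.\<close>

lemma perm_block:
  assumes f: "atom_perm f" "\<And>a. a \<epsilon> A \<Longrightarrow> ap f a \<noteq> a \<Longrightarrow> tail_eq k a zero_atom"
    and a: "a \<epsilon> A" "tail_eq k a zero_atom"
  shows "tail_eq k (ap f a) zero_atom"
proof (cases "ap f a = a")
  case False
  then have "ap f (ap f a) \<noteq> ap f a"
    using perm_inj[OF f(1) _ a(1)] perm_in[OF f(1) a(1)] by blast
  then show ?thesis
    using f(2) perm_in[OF f(1) a(1)] by blast
qed (use a in simp)

text \<open>Since \<open>f\<close> preserves \<open>A_0^k\<close>, the base point of the copied
  point is the image under \<open>f\<close> of the old base point, and \<open>g\<close> leads back
  from there.\<close>

lemma copy_inverse: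
  assumes k: "k \<epsilon> omega" and P: "\<And>a c. a \<epsilon> A \<Longrightarrow> c \<epsilon> A \<Longrightarrow> tail_eq k a c \<Longrightarrow> P a \<longleftrightarrow> P c"
    and f: "atom_perm f" "\<And>a. a \<epsilon> A \<Longrightarrow> ap f a \<noteq> a \<Longrightarrow> tail_eq k a zero_atom"
    and g: "\<And>a. a \<epsilon> A \<Longrightarrow> ap g (ap f a) = a" and a: "a \<epsilon> A"
  shows "copy k g P (copy k f P a) = a"
proof (cases "P a")
  case True
  let ?b = "ap f (base k a)"
  have b: "base k a \<epsilon> A" "?b \<epsilon> A" "tail_eq k ?b zero_atom"
    using base_in[OF k a] perm_in[OF f(1)] perm_block[OF f base_in[OF k a] base_tail[OF k a]] by auto
  have c: "splice k ?b a \<epsilon> A" "tail_eq k (splice k ?b a) a"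
    using k b a by auto
  then have "P (splice k ?b a)"
    using P a True by blast
  moreover have "base k (splice k ?b a) = ?b"
    using base_splice[OF k b(2) a] base_eq[OF k b(2,3)] by simp
  moreover have "splice k (base k a) (splice k ?b a) = a"
    using splice_splice_right[OF k b(1,2) a] splice_base[OF k a a] splice_self[OF k a] by simp
  ultimately show ?thesis
    using True g[OF b(1)] unfolding copy_def by simp
next
  case False
  then show ?thesis unfolding copy_def by simp
qed

text \<open>The common bound \<open>l\<close> for the blocks satisfying \<open>P\<close> keeps the
  permutation in \<open>G\<close> even if there are infinitely many such blocks.\<close>

lemma copy_Gn:
  assumes n: "n \<epsilon> omega" and k: "k \<epsilon> omega" "leq n k"
    and P: "dfn (\<lambda>e. P (e 0))" "\<And>a c. a \<epsilon> A \<Longrightarrow> c \<epsilon> A \<Longrightarrow> tail_eq k a c \<Longrightarrow> P a \<longleftrightarrow> P c"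
    and l: "l \<epsilon> omega" "\<And>a. a \<epsilon> A \<Longrightarrow> P a \<Longrightarrow> tail_eq l a zero_atom"
    and f: "f \<in> Gn n" "\<And>a. a \<epsilon> A \<Longrightarrow> ap f a \<noteq> a \<Longrightarrow> tail_eq k a zero_atom"
  shows "Lam A (copy k f P) \<in> Gn n"
proof -
  let ?g = "inverse_perm f"
  note p = Gn_perm[OF f(1)]
  note q = perm_inverse[OF p]
  have g: "?g \<in> Gn n"
    by (rule Gn_inverse[OF n f(1)])
  have g2: "tail_eq k a zero_atom" if "a \<epsilon> A" "ap ?g a \<noteq> a" for a
    using f(2)[OF that(1)] inverse_ap[OF p that(1)] that(2) by fastforce
  have tail: "tail_eq n (copy k h P a) (copy k h P c)"
    if h: "h \<in> Gn n" and ac: "a \<epsilon> A" "c \<epsilon> A" "tail_eq n a c" for h a c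
  proof -
    have "tail_eq k a c" using tail_eq_mono[OF k ac(3)] .
    then have "P a \<longleftrightarrow> P c" using P(2) ac by blast
    moreover have "tail_eq n (base k a) (base k c)"
      unfolding base_def using tail_eq_splice[OF n k(1) ac(1) _ ac(2) _ ac(3)] by simp
    then have "tail_eq n (ap h (base k a)) (ap h (base k c))"
      using h base_in[OF k(1)] ac unfolding Gn_iff[OF n] by blast
    then have "tail_eq n (splice k (ap h (base k a)) a) (splice k (ap h (base k c)) c)"
      using tail_eq_splice[OF n k(1) perm_in[OF Gn_perm[OF h] base_in[OF k(1) ac(1)]] ac(1)
          perm_in[OF Gn_perm[OF h] base_in[OF k(1) ac(2)]] ac(2) _ \<open>tail_eq k a c\<close>] by blast
    ultimately show ?thesis
      unfolding copy_def using ac(3) by simp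
  qed
  show ?thesis
  proof (rule Gn_Lam[OF n trm_copy[OF P(1)] copy_in[OF k(1) p] copy_in[OF k(1) q] _ _ _ tail[OF f(1)] tail[OF g] _ l(1)])
    show "copy k ?g P (copy k f P a) = a" if "a \<epsilon> A" for a
      using copy_inverse[OF k(1) P(2) p f(2) inverse_ap[OF p] that] .
    show "copy k f P (copy k ?g P a) = a" if "a \<epsilon> A" for a
      using copy_inverse[OF k(1) P(2) q g2 ap_inverse[OF p] that] .
    show "agree n (copy k f P a) a" if a: "a \<epsilon> A" for a
    proof -
      note b = base_in[OF k(1) a]
      have 1: "agree n (splice k (ap f (base k a)) a) (ap f (base k a))"
        using agree_splice[OF n k perm_in[OF p b] a] .
      have 2: "agree n (ap f (base k a)) (base k a)"
        using f(1) b unfolding Gn_iff[OF n] by blast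
      have "agree n (base k a) a"
        using agree_mono[OF k base_agree[OF k(1) a]] .
      from agree_trans[OF agree_trans[OF 1 2] this] show ?thesis
        unfolding copy_def by simp
    qed
    show "copy k f P a = a" if a: "a \<epsilon> A" "tail_eq n a zero_atom" for a
    proof -
      have "base k a = a"
        using base_eq[OF k(1) a(1) tail_eq_mono[OF k a(2)]] .
      moreover have "ap f a = a"
        using f(1) a unfolding Gn_iff[OF n] by blast
      ultimately show ?thesis
        unfolding copy_def using splice_self[OF k(1) a(1)] by simp
    qed
    show "tail_eq l a zero_atom" if "a \<epsilon> A" "copy k f P a \<noteq> a" for a
      using l(2)[OF that(1)] that(2) unfolding copy_def by presburger
  qed
qed

text \<open>\<open>copy\<close> changes locations and \<open>g\<close> changes blocks, so
  conjugation by \<open>g\<close> affects only the collection of blocks on which the copies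
  act.\<close>

lemma copy_equivariant:
  assumes k: "k \<epsilon> omega" and f: "atom_perm f" and g: "g \<in> Gn k" and a: "a \<epsilon> A"
    and P: "P' (ap g a) \<longleftrightarrow> P a"
  shows "ap g (copy k f P a) = copy k f P' (ap g a)"
  unfolding copy_def using P base_Gn[OF k g a] Gn_splice[OF k g perm_in[OF f base_in[OF k a]] a] by simp

lemma copy_copy:
  assumes k: "k \<epsilon> omega" and f: "atom_perm f" and a: "a \<epsilon> A"
    and PQ: "\<And>a c. a \<epsilon> A \<Longrightarrow> c \<epsilon> A \<Longrightarrow> tail_eq k a c \<Longrightarrow> P a \<longleftrightarrow> P c" "Q a \<Longrightarrow> \<not> P a"
  shows "copy k f P (copy k f Q a) = copy k f (\<lambda>a. P a \<or> Q a) a"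
proof (cases "Q a")
  case True
  have "P (copy k f Q a) \<longleftrightarrow> P a"
    by (rule PQ(1)[OF copy_in[OF k f a] a copy_tail[OF k f a]])
  then show ?thesis
    using True PQ(2) unfolding copy_def by simp
qed (simp add: copy_def)

text \<open>The exchange touches only the blocks of \<open>zero_atom\<close> and \<open>s\<close>,
  the copy only the block of \<open>t\<close>.\<close>

lemma copy_exch_commute:
  assumes k: "k \<epsilon> omega" and f: "atom_perm f" and s: "s \<in> reps k" and t: "t \<in> reps k" "s \<noteq> t"
    and a: "a \<epsilon> A"
  shows "copy k f (\<lambda>a. tail_eq k a t) (exch n k s a) = exch n k s (copy k f (\<lambda>a. tail_eq k a t) a)"
proof -
  have sA: "s \<epsilon> A" using s reps_in by blast
  have st: "\<not> tail_eq k s t" "\<not> tail_eq k zero_atom t"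
    using reps_eqI[OF k s t(1)] t(2) reps_tail[OF k t(1)] tail_eq_sym by blast+
  show ?thesis
  proof (cases "tail_eq k a t")
    case True
    let ?c = "copy k f (\<lambda>a. tail_eq k a t) a"
    have *: "exch n k s c = c" if "tail_eq k c t" for c
    proof -
      have "\<not> tail_eq k c s" "\<not> tail_eq k c zero_atom"
        using that st tail_eq_sym tail_eq_trans by blast+
      then show ?thesis unfolding exch_def by simp
    qed
    have "tail_eq k ?c t"
      using copy_tail[OF k f a] True tail_eq_trans by blast
    then show ?thesis using * True by simp
  next
    case False
    have "\<not> tail_eq k (exch n k s a) t"
    proof -
      have "tail_eq k (splice k a s) s" "tail_eq k (base k a) zero_atom"
        using k a sA base_tail[OF k a] by auto
      then have "\<not> tail_eq k (splice k a s) t" "\<not> tail_eq k (base k a) t"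
        using st tail_eq_sym tail_eq_trans by blast+
      then show ?thesis
        using False unfolding exch_def by simp
    qed
    then show ?thesis using False unfolding copy_def by simp
  qed
qed

text \<open>The exchange with the block of \<open>t\<close> conjugates \<open>f\<close> into its
  copy there. The locations left out by \<open>exch\<close> do no harm: they correspond to
  \<open>A_0^n\<close>, which \<open>f\<close> fixes pointwise.\<close>

lemma copy_exch_conjugate:
  assumes n: "n \<epsilon> omega" and k: "k \<epsilon> omega" "leq n k" and t: "t \<in> reps k"
    and f: "f \<in> Gn n" "\<And>a. a \<epsilon> A \<Longrightarrow> ap f a \<noteq> a \<Longrightarrow> tail_eq k a zero_atom"
    and a: "a \<epsilon> A"
  shows "copy k f (\<lambda>a. tail_eq k a t) (exch n k t a) = exch n k t (ap f a)"
proof -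
  note p = Gn_perm[OF f(1)]
  have tA: "t \<epsilon> A" using t reps_in by blast
  have t0: "\<not> tail_eq k t zero_atom" using reps_tail[OF k(1) t] .
  have f0: "tail_eq n (ap f c) zero_atom \<longleftrightarrow> tail_eq n c zero_atom" if "c \<epsilon> A" for c
  proof -
    have "ap f zero_atom = zero_atom" "tail_eq n c zero_atom \<longleftrightarrow> tail_eq n (ap f c) (ap f zero_atom)"
      using f(1) that zero_atom_in tail_eq_refl unfolding Gn_iff[OF n] by blast+
    then show ?thesis by simp
  qed
  have fix0: "ap f c = c" if "c \<epsilon> A" "tail_eq n c zero_atom" for c
    using f(1) that unfolding Gn_iff[OF n] by blast
  show ?thesis
  proof (cases "tail_eq k a zero_atom")
    case True
    have fa: "tail_eq k (ap f a) zero_atom" "ap f a \<epsilon> A"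
      using perm_block[OF p f(2) a True] perm_in[OF p a] by auto
    have at: "\<not> tail_eq k a t"
      using True t0 tail_eq_sym tail_eq_trans by blast
    show ?thesis
    proof (cases "tail_eq n a zero_atom")
      case True
      then show ?thesis
        using fix0[OF a True] at unfolding exch_def copy_def by simp
    next
      case False
      let ?c = "splice k a t"
      have c: "tail_eq k ?c t" "base k ?c = a"
        using k(1) a tA base_splice[OF k(1) a tA] base_eq[OF k(1) a True] by auto
      have "splice k (ap f a) ?c = splice k (ap f a) t"
        using splice_splice_right[OF k(1) fa(2) a tA] .
      then show ?thesis
        using True False fa f0[OF a] c unfolding exch_def copy_def by simp
    qed
  next
    case False
    then have fa: "ap f a = a" using f(2) a by blast
    show ?thesis
    proof (cases "tail_eq k a t \<and> \<not> tail_eq n (base k a) zero_atom")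
      case True
      have "\<not> tail_eq k (base k a) t"
        using base_tail[OF k(1) a] t0 tail_eq_sym tail_eq_trans by blast
      then show ?thesis
        using False fa True unfolding exch_def copy_def by simp
    next
      case *: False
      then have e: "exch n k t a = a"
        using False unfolding exch_def by presburger
      have "copy k f (\<lambda>a. tail_eq k a t) a = a"
      proof (cases "tail_eq k a t")
        case True
        then have "ap f (base k a) = base k a"
          using * fix0 base_in[OF k(1) a] by blast
        then show ?thesis
          unfolding copy_def using splice_base[OF k(1) a a] splice_self[OF k(1) a] by simp
      qed (simp add: copy_def)
      then show ?thesis
        using e fa by simp
    qed
  qed
qed

section \<open>Rearranging the \<open>k\<close>-blocks inside \<open>(k+1)\<close>-blocks\<close>

lemma tail_eq_suc:
  assumes "k \<epsilon> omega"
  shows "tail_eq k a c \<longleftrightarrow> tail_eq (suc k) a c \<and> co a k = co c k"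
proof -
  have "leq k j \<longleftrightarrow> leq (suc k) j \<or> j = k" if "j \<epsilon> omega" for j
  proof
    assume "leq k j"
    then show "leq (suc k) j \<or> j = k"
      using suc_mem_suc[OF that, of k] unfolding leq_def by auto
  next
    assume "leq (suc k) j \<or> j = k"
    then show "leq k j"
      using nat_trans[OF that, of "suc k" k] unfolding leq_def by auto
  qed
  then show ?thesis
    unfolding tail_eq_def using assms by blast
qed

lemma suc_reps: "k \<epsilon> omega \<Longrightarrow> s \<in> reps (suc k) \<Longrightarrow> co s k = zero"
  unfolding reps_def agree_def by simp

text \<open>The \<open>k\<close>-blocks within a \<open>(k+1)\<close>-block are numbered by
  coordinate \<open>k\<close>; \<open>put k j s\<close> represents number \<open>j\<close> in the
  block of \<open>s\<close>.\<close>

definition put :: "'m \<Rightarrow> 'm \<Rightarrow> 'm \<Rightarrow> 'm" where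
  "put k j s = splice (suc k) (unit_atom k j) s"

lemma trm_put [dfn_intros]: "trm j \<Longrightarrow> trm (\<lambda>e. put k (j e) s)"
  unfolding put_def by (intro dfn_intros)

lemma
  assumes "k \<epsilon> omega" "j \<epsilon> omega" "s \<epsilon> A"
  shows put_in: "put k j s \<epsilon> A"
    and put_tail: "tail_eq (suc k) (put k j s) s"
    and co_put: "co (put k j s) k = j"
  unfolding put_def
  using assms co_splice[OF suc_omega[OF assms(1)] unit_atom_in[OF assms(1,2)] assms(3,1)]
    co_unit_atom[OF assms(1,2,1)] by simp_all

text \<open>
  A Hilbert hotel on three \<open>(k+1)\<close>-blocks: the \<open>k\<close>-blocks contained in that of \<open>t\<close> are
  exchanged with those contained in that of \<open>s\<close> together with the \<open>k\<close>-block of \<open>d\<close>.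
\<close>

definition hotel :: "'m \<Rightarrow> 'm \<Rightarrow> 'm \<Rightarrow> 'm \<Rightarrow> 'm \<Rightarrow> 'm" where
  "hotel k s t d a =
    (if tail_eq (suc k) a t then if co a k = zero then d else put k (big_union (co a k)) s
     else if tail_eq (suc k) a s then put k (suc (co a k)) t
     else if tail_eq k a d then t else a)"

lemma trm_hotel [dfn_intros]: "trm a \<Longrightarrow> trm (\<lambda>e. hotel k s t d (a e))"
  unfolding hotel_def by (intro dfn_intros)

context
  fixes k s t d :: 'm
  assumes k: "k \<epsilon> omega"
    and std: "s \<in> reps (suc k)" "t \<in> reps (suc k)" "d \<in> reps (suc k)"
    and distinct: "s \<noteq> t" "s \<noteq> d" "t \<noteq> d"
begin

private lemma std_A: "s \<epsilon> A" "t \<epsilon> A" "d \<epsilon> A"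
  using std reps_in by blast+

private lemma tails_distinct:
  assumes "u \<in> reps (suc k)" "v \<in> reps (suc k)" "u \<noteq> v" "tail_eq (suc k) a u"
  shows "\<not> tail_eq (suc k) a v"
proof
  assume "tail_eq (suc k) a v"
  then have "tail_eq (suc k) u v"
    using assms(4) tail_eq_sym tail_eq_trans by blast
  then show False
    using reps_eqI[OF suc_omega[OF k] assms(1,2)] assms(3) by blast
qed

text \<open>The correspondence: number 0 of the block of \<open>t\<close> belongs to the
  \<open>k\<close>-block of \<open>d\<close>, and number \<open>i + 1\<close> to number
  \<open>i\<close> of the block of \<open>s\<close>.\<close>

private lemma hotel_cases:
  assumes a: "a \<epsilon> A"
  obtains (t0) "tail_eq (suc k) a t" "co a k = zero" "hotel k s t d a = d" "tail_eq k a t"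
  | (t) i where "i \<epsilon> omega" "tail_eq (suc k) a t" "co a k = suc i" "hotel k s t d a = put k i s"
  | (s) i where "i \<epsilon> omega" "tail_eq (suc k) a s" "co a k = i" "hotel k s t d a = put k (suc i) t"
  | (d) "tail_eq (suc k) a d" "tail_eq k a d" "hotel k s t d a = t"
  | (other) "\<not> tail_eq (suc k) a t" "\<not> tail_eq (suc k) a s" "\<not> tail_eq k a d" "hotel k s t d a = a"
proof -
  have i: "co a k \<epsilon> omega" using co_omega[OF a k] .
  show thesis
  proof (cases "tail_eq (suc k) a t")
    case True
    show thesis
    proof (cases rule: omega_cases[OF i])
      case 1
      moreover have "tail_eq k a t"
        using tail_eq_suc[OF k, of a t] True 1 suc_reps[OF k std(2)] by simp
      ultimately show thesis using t0 True unfolding hotel_def by simp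
    next
      case (2 m)
      then show thesis using t True big_union_suc[OF 2(1)] unfolding hotel_def by simp
    qed
  next
    case not_t: False
    show thesis
    proof (cases "tail_eq (suc k) a s")
      case True
      then show thesis using s[of "co a k"] i not_t unfolding hotel_def by simp
    next
      case not_s: False
      show thesis
      proof (cases "tail_eq k a d")
        case True
        then show thesis using d not_t not_s tail_eq_suc[OF k, of a d] unfolding hotel_def by simp
      next
        case False
        then show thesis using other not_t not_s unfolding hotel_def by simp
      qed
    qed
  qed
qed

private lemma hotel_in:
  assumes "a \<epsilon> A"
  shows "hotel k s t d a \<epsilon> A"
  by (rule hotel_cases[OF assms]) (use assms std_A put_in[OF k] suc_omega in simp_all)

private lemma hotel_cong:
  assumes "tail_eq k a c"
  shows "tail_eq k (hotel k s t d a) (hotel k s t d c)"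
proof -
  have "co a k = co c k" "tail_eq (suc k) a c"
    using assms tail_eq_suc[OF k] by auto
  then have "tail_eq (suc k) a u \<longleftrightarrow> tail_eq (suc k) c u" "tail_eq k a u \<longleftrightarrow> tail_eq k c u" for u
    using tail_eq_cong assms by blast+
  then show ?thesis
    unfolding hotel_def using assms \<open>co a k = co c k\<close> by simp
qed

text \<open>\<open>hotel\<close> is an involution on \<open>k\<close>-blocks, not on atoms;
  \<open>room_swap\<close> restores the locations.\<close>

private lemma hotel_inv:
  assumes a: "a \<epsilon> A"
  shows "tail_eq k (hotel k s t d (hotel k s t d a)) a"
proof (rule hotel_cases[OF a])
  assume h: "tail_eq k a t" "hotel k s t d a = d"
  have "\<not> tail_eq (suc k) d t" "\<not> tail_eq (suc k) d s"
    using tails_distinct[OF std(3,2), of d] tails_distinct[OF std(3,1), of d] distinct by auto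
  then have "hotel k s t d d = t"
    unfolding hotel_def by simp
  then show ?thesis using h tail_eq_sym by simp
next
  fix i assume h: "i \<epsilon> omega" "tail_eq (suc k) a t" "co a k = suc i" "hotel k s t d a = put k i s"
  note p = put_tail[OF k h(1) std_A(1)] co_put[OF k h(1) std_A(1)]
  have "hotel k s t d (put k i s) = put k (suc i) t"
    unfolding hotel_def using p tails_distinct[OF std(1,2) distinct(1) p(1)] by simp
  moreover have "tail_eq (suc k) (put k (suc i) t) a"
    using put_tail[OF k suc_omega[OF h(1)] std_A(2)] h(2) tail_eq_sym tail_eq_trans by blast
  ultimately show ?thesis
    unfolding h(4) tail_eq_suc[OF k] using h(3) co_put[OF k suc_omega[OF h(1)] std_A(2)] by simp
next
  fix i assume h: "i \<epsilon> omega" "tail_eq (suc k) a s" "co a k = i" "hotel k s t d a = put k (suc i) t"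
  note p = put_tail[OF k suc_omega[OF h(1)] std_A(2)] co_put[OF k suc_omega[OF h(1)] std_A(2)]
  have "hotel k s t d (put k (suc i) t) = put k i s"
    unfolding hotel_def using p big_union_suc[OF h(1)] by simp
  moreover have "tail_eq (suc k) (put k i s) a"
    using put_tail[OF k h(1) std_A(1)] h(2) tail_eq_sym tail_eq_trans by blast
  ultimately show ?thesis
    unfolding h(4) tail_eq_suc[OF k] using h(3) co_put[OF k h(1) std_A(1)] by simp
next
  assume h: "tail_eq k a d" "hotel k s t d a = t"
  have "hotel k s t d t = d"
    unfolding hotel_def using suc_reps[OF k std(2)] by simp
  then show ?thesis using h tail_eq_sym by simp
qed simp

definition room_swap :: 'm where
  "room_swap = Lam A (\<lambda>a. splice k a (hotel k s t d a))"

lemma ap_room_swap: "a \<epsilon> A \<Longrightarrow> ap room_swap a = splice k a (hotel k s t d a)"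
  unfolding room_swap_def by (rule ap_Lam) (intro dfn_intros)

text \<open>The map breaks up \<open>(k+1)\<close>-blocks but respects \<open>k\<close>-blocks, and
  in \<open>edm_moved\<close> the vertex \<open>v\<close> is fixed by all of
  \<open>Gn k\<close>.\<close>

lemma room_swap_Gn: "room_swap \<in> Gn k"
proof -
  let ?F = "\<lambda>a. splice k a (hotel k s t d a)"
  obtain ls where ls: "ls \<epsilon> omega" "leq (suc k) ls" "tail_eq ls s zero_atom"
    using tail_bound[OF suc_omega[OF k] std_A(1)] .
  obtain lt where lt: "lt \<epsilon> omega" "leq ls lt" "tail_eq lt t zero_atom"
    using tail_bound[OF ls(1) std_A(2)] .
  obtain l where l: "l \<epsilon> omega" "leq lt l" "tail_eq l d zero_atom"
    using tail_bound[OF lt(1) std_A(3)] .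
  have "leq ls l" using leq_trans[OF l(1) lt(2) l(2)] .
  then have "leq (suc k) l" using leq_trans[OF l(1) ls(2)] by blast
  have lz: "tail_eq l s zero_atom" "tail_eq l t zero_atom"
    using tail_eq_mono[OF l(1) \<open>leq ls l\<close> ls(3)] tail_eq_mono[OF l(1,2) lt(3)] .
  have F_in: "?F a \<epsilon> A" if "a \<epsilon> A" for a
    using that hotel_in[OF that] k by simp
  have inv: "?F (?F a) = a" if a: "a \<epsilon> A" for a
  proof -
    have h: "tail_eq k (?F a) (hotel k s t d a)"
      using k a hotel_in[OF a] by simp
    have "tail_eq k (hotel k s t d (?F a)) a"
      using tail_eq_trans[OF hotel_cong[OF h] hotel_inv[OF a]] .
    then show ?thesis
      using splice_splice[OF k a hotel_in[OF a] hotel_in[OF F_in[OF a]]]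
        splice_eq_left[OF k a hotel_in[OF F_in[OF a]]] tail_eq_sym by simp
  qed
  have tail: "tail_eq k (?F a) (?F c)" if "a \<epsilon> A" "c \<epsilon> A" "tail_eq k a c" for a c
    using tail_eq_splice[OF k k that(1) hotel_in[OF that(1)] that(2) hotel_in[OF that(2)] that(3)
        hotel_cong[OF that(3)]] .
  have t: "trm (\<lambda>e. ?F (e 0))"
    by (intro dfn_intros)
  show ?thesis
    unfolding room_swap_def
  proof (rule Gn_Lam[OF k t F_in F_in inv inv _ tail tail _ l(1)])
    show "agree k (?F a) a" if "a \<epsilon> A" for a
      using k that hotel_in[OF that] by simp
    show "?F a = a" if a: "a \<epsilon> A" "tail_eq k a zero_atom" for a
    proof -
      have no: "\<not> tail_eq (suc k) a u" if "u \<in> reps (suc k)" for u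
        using reps_tail[OF suc_omega[OF k] that] a(2) tail_eq_sym tail_eq_trans
        unfolding tail_eq_suc[OF k] by blast
      have "hotel k s t d a = a"
        unfolding hotel_def using no[OF std(1)] no[OF std(2)] no[OF std(3)] tail_eq_suc[OF k, of a d] by simp
      then show ?thesis using splice_self[OF k a(1)] by simp
    qed
    show "tail_eq l a zero_atom" if a: "a \<epsilon> A" "?F a \<noteq> a" for a
    proof -
      have "hotel k s t d a \<noteq> a"
        using a splice_self[OF k a(1)] by auto
      then have "tail_eq (suc k) a s \<or> tail_eq (suc k) a t \<or> tail_eq (suc k) a d"
        using tail_eq_suc[OF k, of a d] unfolding hotel_def by presburger
      then show ?thesis
        using tail_eq_mono[OF l(1) \<open>leq (suc k) l\<close>] lz l(3) tail_eq_trans by blast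
    qed
  qed
qed

text \<open>With \<open>copy_equivariant\<close>, this turns the copies over the block of
  \<open>t\<close> into those over the block of \<open>s\<close> and one more, in the
  \<open>k\<close>-block of \<open>d\<close>.\<close>

lemma room_swap_t:
  assumes a: "a \<epsilon> A"
  shows "tail_eq (suc k) (ap room_swap a) s \<or> tail_eq k (ap room_swap a) d \<longleftrightarrow> tail_eq (suc k) a t"
proof -
  let ?h = "hotel k s t d a"
  have "tail_eq k (ap room_swap a) ?h"
    using ap_room_swap[OF a] k a hotel_in[OF a] by simp
  then have "tail_eq k (ap room_swap a) u \<longleftrightarrow> tail_eq k ?h u"
    "tail_eq (suc k) (ap room_swap a) u \<longleftrightarrow> tail_eq (suc k) ?h u" for u
    using tail_eq_cong tail_eq_suc[OF k] by blast+
  moreover have "tail_eq (suc k) ?h s \<or> tail_eq k ?h d \<longleftrightarrow> tail_eq (suc k) a t"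
  proof -
    have no: "\<not> (tail_eq (suc k) c s \<or> tail_eq k c d)" if "tail_eq (suc k) c t" for c
      using tails_distinct[OF std(2,1) _ that] tails_distinct[OF std(2,3) _ that] distinct
        tail_eq_suc[OF k, of c d] by blast
    have nt: "\<not> tail_eq (suc k) c t" if "tail_eq (suc k) c s \<or> tail_eq (suc k) c d" for c
      using that tails_distinct[OF std(1,2) distinct(1)] tails_distinct[OF std(3,2)] distinct(3) by blast
    show ?thesis
    proof (rule hotel_cases[OF a])
      fix i assume h: "i \<epsilon> omega" "tail_eq (suc k) a t" "?h = put k i s"
      then show ?thesis using put_tail[OF k h(1) std_A(1)] by simp
    next
      fix i assume h: "i \<epsilon> omega" "tail_eq (suc k) a s" "?h = put k (suc i) t"
      then show ?thesis
        using no[OF put_tail[OF k suc_omega[OF h(1)] std_A(2)]] nt[of a] by simp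
    next
      assume h: "tail_eq (suc k) a d" "?h = t"
      then show ?thesis using no[of t] nt[of a] by simp
    qed simp_all
  qed
  ultimately show ?thesis by blast
qed

text \<open>Provides a \<open>(k+1)\<close>-block that the hotel leaves in place, so that the copies
  over it commute with \<open>room_swap\<close>.\<close>

lemma room_swap_other:
  assumes a: "a \<epsilon> A" and u: "u \<in> reps (suc k)" "u \<noteq> s" "u \<noteq> t" "u \<noteq> d"
  shows "tail_eq (suc k) (ap room_swap a) u \<longleftrightarrow> tail_eq (suc k) a u"
proof -
  let ?h = "hotel k s t d a"
  have "tail_eq k (ap room_swap a) ?h"
    using ap_room_swap[OF a] k a hotel_in[OF a] by simp
  then have "tail_eq (suc k) (ap room_swap a) u \<longleftrightarrow> tail_eq (suc k) ?h u"
    using tail_eq_cong tail_eq_suc[OF k] by blast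
  moreover have "tail_eq (suc k) ?h u \<longleftrightarrow> tail_eq (suc k) a u"
  proof -
    have no: "\<not> tail_eq (suc k) c u" if "tail_eq (suc k) c x" "x = s \<or> x = t \<or> x = d" for c x
      using tails_distinct[OF _ u(1) _ that(1)] that(2) std u(2-4) by blast
    show ?thesis
    proof (rule hotel_cases[OF a])
      fix i assume h: "i \<epsilon> omega" "tail_eq (suc k) a t" "?h = put k i s"
      then show ?thesis using no[OF put_tail[OF k h(1) std_A(1)]] no[OF h(2)] by simp
    next
      fix i assume h: "i \<epsilon> omega" "tail_eq (suc k) a s" "?h = put k (suc i) t"
      then show ?thesis using no[OF put_tail[OF k suc_omega[OF h(1)] std_A(2)]] no[OF h(2)] by simp
    next
      assume h: "tail_eq (suc k) a d" "?h = t"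
      then show ?thesis using no[of t t] no[OF h(1)] by simp
    next
      assume h: "tail_eq (suc k) a t" "?h = d"
      then show ?thesis using no[of d d] no[OF h(1)] by simp
    qed simp
  qed
  ultimately show ?thesis by blast
qed

end

text \<open>
  Assume that no orbit as in \<open>edm_orbit\<close> is available. Then \<open>exch n k s\<close> moves \<open>v\<close> to the same
  vertex for all \<open>s\<close>, and therefore the copy of \<open>f\<close> in any single \<open>k\<close>-block moves \<open>v\<close>. Likewise
  the simultaneous copies of \<open>f\<close> in all \<open>k\<close>-blocks of a \<open>(k+1)\<close>-block move \<open>v\<close> to a vertex not
  depending on that block. By \<open>room_swap\<close>, one more copy, in the block of \<open>d\<close>, makes no
  difference either, so that this single copy fixes \<open>v\<close>, a contradiction.
\<close>

lemma edm_moved: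
  assumes V: "V \<in> N9" "E \<in> N9" "is_graph V E" "supports n V" "supports n E"
    and v: "v \<epsilon> V" and f: "f \<in> Gn n" "act' f v \<noteq> v"
  shows "edm_conclusion V E"
proof (rule ccontr)
  assume no: "\<not> edm_conclusion V E"
  have n: "n \<epsilon> omega"
    using V(4) unfolding supports_def by blast
  note pf = Gn_perm[OF f(1)]
  obtain m where m: "supports m v"
    using N9_trans[OF V(1) v] N9_iff by blast
  then have mo: "m \<epsilon> omega"
    unfolding supports_def by blast
  obtain k0 where k0: "k0 \<epsilon> omega" "\<And>a. a \<epsilon> A \<Longrightarrow> ap f a \<noteq> a \<Longrightarrow> tail_eq k0 a zero_atom"
    using Gn_sub_G[OF f(1)] unfolding G_iff by blast
  obtain k1 where k1: "k1 \<epsilon> omega" "leq n k1" "leq m k1"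
    using upper_bound[OF n mo] .
  \<comment> \<open>\<open>k\<close> lies beyond the support \<open>n\<close> of the graph, the
    support \<open>m\<close> of \<open>v\<close> and the bound \<open>k0\<close> for
    \<open>f\<close>. Thus \<open>Gn k\<close> fixes \<open>v\<close>, and \<open>f\<close> moves
    points of \<open>A_0^k\<close> only.\<close>
  obtain k where k: "k \<epsilon> omega" "leq k1 k" "leq k0 k"
    using upper_bound[OF k1(1) k0(1)] .
  have nk: "leq n k" and mk: "leq m k"
    using leq_trans[OF k(1) _ k(2)] k1 by blast+
  have fk: "tail_eq k a zero_atom" if "a \<epsilon> A" "ap f a \<noteq> a" for a
    using tail_eq_mono[OF k(1,3) k0(2)[OF that]] .
  let ?q = "suc k"
  have q: "?q \<epsilon> omega" "leq k ?q"
    using k(1) unfolding leq_def by simp_all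
  have act_V: "act' g x \<epsilon> V" if "g \<in> Gn n" "x \<epsilon> V" for g x
    using V(4) that mem_act'_iff[OF Gn_perm[OF that(1)]] unfolding supports_def by metis
  have sup: "supports k V" "supports k E" "supports k v"
    using supports_mono[OF V(4) k(1) nk] supports_mono[OF V(5) k(1) nk] supports_mono[OF m k(1) mk] .
  have fix_v: "act' g v = v" if "g \<in> Gn k" for g
    using sup(3) that unfolding supports_def by blast
  let ?s = "\<lambda>s. Lam A (exch n k s)"
  have s_Gn: "?s s \<in> Gn n" if "s \<in> reps k" for s
    using exch_Gn[OF n k(1) nk that] .
  have s_eq: "act' g (act' (?s s) v) = act' (?s (ap g s)) v" if g: "g \<in> Gn k" and s: "s \<in> reps k" for g s
  proof -
    note gs = Gn_reps[OF k(1) g s]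
    have "act' g (act' (?s s) v) = act' (?s (ap g s)) (act' g v)"
    proof (rule act'_transfer)
      show "ap g (ap (?s s) a) = ap (?s (ap g s)) (ap g a)" if "a \<epsilon> A" for a
        using ap_exch exch_equivariant[OF k(1) s g that] that perm_in[OF Gn_perm[OF g] that] by simp
    qed (use Gn_perm g s_Gn[OF s] s_Gn[OF gs] in blast)+
    then show ?thesis using fix_v[OF g] by simp
  qed
  \<comment> \<open>By \<open>s_eq\<close>, elements of \<open>Gn k\<close> that fix
    \<open>s\<close> also fix the exchanged vertex. If some element of \<open>Gn k\<close> moved it,
    \<open>edm_orbit\<close> would apply.\<close>
  have fixed: "act' g (act' (?s s) v) = act' (?s s) v" if "g \<in> Gn k" "s \<in> reps k" for g s
  proof (rule ccontr)
    assume moved: "act' g (act' (?s s) v) \<noteq> act' (?s s) v"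
    have "edm_conclusion V E"
      by (rule edm_orbit[OF V(1-3) sup(1,2) act_V[OF s_Gn[OF that(2)] v] that(2) _ that(1) moved])
        (use s_eq that(2) in simp)
    then show False using no by blast
  qed
  have same: "act' (?s s) v = act' (?s t) v" if "s \<in> reps k" "t \<in> reps k" for s t
    using fixed[OF swap_Gn[OF k(1) that] that(1)] s_eq[OF swap_Gn[OF k(1) that] that(1)]
      swap_left[OF k(1) that] by simp
  let ?c = "\<lambda>P. Lam A (copy k f P)"
  let ?B = "\<lambda>t a. tail_eq k a t" and ?Q = "\<lambda>t a. tail_eq ?q a t"
  have dB: "dfn (\<lambda>e. ?B t (e 0))" and dQ: "dfn (\<lambda>e. ?Q t (e 0))" for t
    by (intro dfn_intros)+
  have iB: "?B t a \<longleftrightarrow> ?B t c" and iQ: "?Q t a \<longleftrightarrow> ?Q t c" if "tail_eq k a c" for t a c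
    using tail_eq_cong that tail_eq_mono[OF q that] by blast+
  have c_Gn: "?c (?B t) \<in> Gn n" "?c (?Q t) \<in> Gn n" if t: "t \<epsilon> A" for t
  proof -
    obtain l where l: "l \<epsilon> omega" "leq ?q l" "tail_eq l t zero_atom"
      using tail_bound[OF q(1) t] .
    have "tail_eq l a zero_atom" if "?Q t a" for a
      using tail_eq_trans[OF tail_eq_mono[OF l(1,2) that] l(3)] .
    moreover have "?Q t a" if "?B t a" for a
      using tail_eq_mono[OF q that] .
    ultimately show "?c (?B t) \<in> Gn n" "?c (?Q t) \<in> Gn n"
      using copy_Gn[OF n k(1) nk dB iB l(1) _ f(1) fk] copy_Gn[OF n k(1) nk dQ iQ l(1) _ f(1) fk] by blast+
  qed
  have moves: "act' (?c (?B t)) v \<noteq> v" if t: "t \<in> reps k" for t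
  proof
    assume v: "act' (?c (?B t)) v = v"
    have tA: "t \<epsilon> A" using t reps_in by blast
    have "unit_atom k (suc zero) \<noteq> unit_atom k (suc (suc zero))"
      using unit_atom_inj[OF k(1), of "suc zero" "suc (suc zero)"] by auto
    moreover have "unit_atom k (suc zero) \<in> reps k" "unit_atom k (suc (suc zero)) \<in> reps k"
      using unit_atom_reps[OF k(1)] by simp_all
    ultimately obtain s where s: "s \<in> reps k" "s \<noteq> t"
      by metis
    note perms = Gn_perm[OF s_Gn[OF s(1)]] Gn_perm[OF s_Gn[OF t]] Gn_perm[OF c_Gn(1)[OF tA]]
    \<comment> \<open>A copy fixing \<open>v\<close> also fixes the exchanged vertex, as it commutes
      with the exchange along \<open>s\<close>. By \<open>same\<close> this is the exchanged vertex
      along \<open>t\<close> as well, and conjugating back there shows that \<open>f\<close> fixes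
      \<open>v\<close>.\<close>
    have "act' (?c (?B t)) (act' (?s s) v) = act' (?s s) (act' (?c (?B t)) v)"
    proof (rule act'_transfer[OF perms(3,1,1,3)])
      show "ap (?c (?B t)) (ap (?s s) a) = ap (?s s) (ap (?c (?B t)) a)" if "a \<epsilon> A" for a
        using copy_exch_commute[OF k(1) pf s(1) t s(2) that, of n] ap_exch ap_copy[OF dB]
          that copy_in[OF k(1) pf that, of "?B t"] perm_in[OF perms(1) that] by simp
    qed
    then have 1: "act' (?c (?B t)) (act' (?s t) v) = act' (?s t) v"
      using v same[OF s(1) t] by simp
    have "act' (?c (?B t)) (act' (?s t) v) = act' (?s t) (act' f v)"
    proof (rule act'_transfer[OF perms(3,2,2) pf])
      show "ap (?c (?B t)) (ap (?s t) a) = ap (?s t) (ap f a)" if "a \<epsilon> A" for a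
        using copy_exch_conjugate[OF n k(1) nk t f(1) fk that] ap_exch ap_copy[OF dB]
          that perm_in[OF pf that] perm_in[OF perms(2) that] by simp
    qed
    then have "act' f v = v"
      using 1 act'_inj[OF perms(2)] by simp
    then show False using f(2) by blast
  qed
  let ?w = "\<lambda>x. act' (?c (?Q x)) v"
  have w_eq: "act' g (?w x) = ?w y"
    if g: "g \<in> Gn k" and xy: "x \<epsilon> A" "y \<epsilon> A" "\<And>a. a \<epsilon> A \<Longrightarrow> ?Q y (ap g a) \<longleftrightarrow> ?Q x a" for g x y
  proof -
    have "act' g (?w x) = act' (?c (?Q y)) (act' g v)"
    proof (rule act'_transfer)
      show "ap g (ap (?c (?Q x)) a) = ap (?c (?Q y)) (ap g a)" if "a \<epsilon> A" for a
        using copy_equivariant[OF k(1) pf g that, of "?Q y" "?Q x"] xy(3)[OF that] ap_copy[OF dQ]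
          that perm_in[OF Gn_perm[OF g] that] by simp
    qed (use Gn_perm g c_Gn(2) xy in blast)+
    then show ?thesis using fix_v[OF g] by simp
  qed
  have w_eq_q: "act' g (?w x) = ?w (ap g x)" if g: "g \<in> Gn ?q" and x: "x \<in> reps ?q" for g x
  proof (rule w_eq)
    show "g \<in> Gn k"
      using Gn_mono[OF k(1) q g] .
    show "?Q (ap g x) (ap g a) \<longleftrightarrow> ?Q x a" if "a \<epsilon> A" for a
      using g that reps_in[OF x] unfolding Gn_iff[OF q(1)] by blast
  qed (use reps_in[OF x] reps_in[OF Gn_reps[OF q(1) g x]] in blast)+
  have fixed_q: "act' g (?w x) = ?w x" if "g \<in> Gn ?q" "x \<in> reps ?q" for g x
  proof (rule ccontr)
    assume moved: "act' g (?w x) \<noteq> ?w x"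
    have "edm_conclusion V E"
      by (rule edm_orbit[OF V(1-3) supports_mono[OF sup(1) q] supports_mono[OF sup(2) q]
          act_V[OF c_Gn(2)[OF reps_in[OF that(2)]] v] that(2) _ that(1) moved])
        (use w_eq_q that(2) in simp)
    then show False using no by blast
  qed
  have same_q: "?w x = ?w y" if "x \<in> reps ?q" "y \<in> reps ?q" for x y
    using fixed_q[OF swap_Gn[OF q(1) that] that(1)] w_eq_q[OF swap_Gn[OF q(1) that] that(1)]
      swap_left[OF q(1) that] by simp
  define one where "one = suc zero"
  have one: "one \<epsilon> omega" unfolding one_def by simp
  \<comment> \<open>Three blocks for the hotel and a fourth, \<open>u\<close>, outside it; the
    values start at \<open>one\<close> to stay away from \<open>zero_atom\<close>.\<close>
  define s where "s = unit_atom ?q one"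
  define t where "t = unit_atom ?q (suc one)"
  define d where "d = unit_atom ?q (suc (suc one))"
  define u where "u = unit_atom ?q (suc (suc (suc one)))"
  have reps: "s \<in> reps ?q" "t \<in> reps ?q" "d \<in> reps ?q" "u \<in> reps ?q"
    unfolding s_def t_def d_def u_def one_def using unit_atom_reps[OF q(1)] by simp_all
  have distinct: "s \<noteq> t" "s \<noteq> d" "t \<noteq> d" "u \<noteq> s" "u \<noteq> t" "u \<noteq> d"
  proof -
    have "unit_atom ?q i = unit_atom ?q j \<longleftrightarrow> i = j" if "i \<epsilon> omega" "j \<epsilon> omega" for i j
      using unit_atom_inj[OF q(1) that] by blast
    then show "s \<noteq> t" "s \<noteq> d" "t \<noteq> d" "u \<noteq> s" "u \<noteq> t" "u \<noteq> d"
      unfolding s_def t_def d_def u_def one_def by simp_all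
  qed
  note std = k(1) reps(1-3) distinct(1-3)
  define h where "h = room_swap k s t d"
  have h: "h \<in> Gn k"
    unfolding h_def by (rule room_swap_Gn[OF std])
  \<comment> \<open>The hotel preserves the block of \<open>u\<close> and hence fixes
    \<open>?w u\<close>; by \<open>same_q\<close> this is also \<open>?w t\<close>.\<close>
  have "act' h (?w u) = ?w u"
    by (rule w_eq[OF h reps_in[OF reps(4)] reps_in[OF reps(4)]])
      (unfold h_def, rule room_swap_other[OF std _ reps(4) distinct(4-6)])
  then have ht: "act' h (?w t) = ?w t"
    using same_q[OF reps(2,4)] by simp
  note perms = Gn_perm[OF c_Gn(2)[OF reps_in[OF reps(1)]]] Gn_perm[OF c_Gn(1)[OF reps_in[OF reps(3)]]]
    Gn_perm[OF c_Gn(2)[OF reps_in[OF reps(2)]]] Gn_perm[OF h]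
  \<comment> \<open>Conjugation by \<open>h\<close> adds the copy in the block of \<open>d\<close>.
    Since \<open>h\<close> fixes \<open>?w t\<close>, which equals \<open>?w s\<close>, the copies
    over \<open>s\<close> can be cancelled, and the additional copy fixes \<open>v\<close>.\<close>
  have "act' h (?w t) = act' (compose_perm (?c (?Q s)) (?c (?B d))) (act' h v)"
  proof (rule act'_transfer[OF perms(4,3) perm_comp[OF perms(1,2)] perms(4)])
    fix a assume a: "a \<epsilon> A"
    note ha = perm_in[OF perms(4) a]
    have nQ: "\<not> ?Q s c" if "?B d c" for c
    proof
      assume "?Q s c"
      then have "tail_eq ?q s d"
        using tail_eq_mono[OF q that] tail_eq_sym tail_eq_trans by blast
      then show False using reps_eqI[OF q(1) reps(1,3)] distinct(2) by blast
    qed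
    have "ap h (ap (?c (?Q t)) a) = ap h (copy k f (?Q t) a)"
      using ap_copy[OF dQ a] by simp
    also have "\<dots> = copy k f (\<lambda>a. ?Q s a \<or> ?B d a) (ap h a)"
      by (rule copy_equivariant[OF k(1) pf h a]) (unfold h_def, rule room_swap_t[OF std a])
    also have "\<dots> = copy k f (?Q s) (copy k f (?B d) (ap h a))"
      using copy_copy[OF k(1) pf ha iQ nQ] by simp
    also have "\<dots> = ap (?c (?Q s)) (ap (?c (?B d)) (ap h a))"
      using ap_copy[OF dB ha] ap_copy[OF dQ copy_in[OF k(1) pf ha]] by simp
    also have "\<dots> = ap (compose_perm (?c (?Q s)) (?c (?B d))) (ap h a)"
      using ap_comp[OF ha] by simp
    finally show "ap h (ap (?c (?Q t)) a) = ap (compose_perm (?c (?Q s)) (?c (?B d))) (ap h a)" .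
  qed
  also have "\<dots> = act' (?c (?Q s)) (act' (?c (?B d)) v)"
    using fix_v[OF h] act'_comp'[OF perms(1,2)] by simp
  finally have "act' (?c (?Q s)) (act' (?c (?B d)) v) = ?w s"
    using ht same_q[OF reps(1,2)] by simp
  then have "act' (?c (?B d)) v = v"
    using act'_inj[OF perms(1)] by blast
  then show False
    using moves[OF reps_mono[OF q(1) k(1) q(2) reps(3)]] by blast
qed

lemma N9_EDM_BG: "n9.EDM_BG"
proof (rule EDM_BG_N9I)
  fix V E assume V: "V \<in> N9" "E \<in> N9" "is_graph V E" "\<not> (\<exists>f\<in>N9. is_injection f V omega)"
  obtain n0 m0 where "supports n0 V" "supports m0 E"
    using V(1,2) N9_iff by meson
  then obtain n where n: "supports n V" "supports n E"
    by (rule common_support)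
  show "edm_conclusion V E"
  proof (cases "\<forall>v. v \<epsilon> V \<longrightarrow> supports n v")
    case True
    then show ?thesis
      using edm_well_orderable[OF V(1-4)] n(1) unfolding supports_def by blast
  next
    case False
    then obtain v f where "v \<epsilon> V" "f \<in> Gn n" "act' f v \<noteq> v"
      using n(1) unfolding supports_def by blast
    then show ?thesis
      using edm_moved[OF V(1-3) n] by blast
  qed
qed

end

theorem theorem6p20:
  fixes mem :: "'m \<Rightarrow> 'm \<Rightarrow> bool" and A b :: 'm
  assumes "N9_setting mem A b"
  shows "eps_structure.EDM_BG (N9_setting.N9 mem A b) mem A"
  using N9_setting.N9_EDM_BG[OF assms] .

end
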